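(* Let $S\in\mathbb{T}(2,d;x)'$ and let $Z$ be any critical scheme for $S$ (i.e. a $d$-critical scheme for $S$). Let $s=s(Z)$ and let $n_0\ge\cdots\ge n_{s-1}$ be the numerical character of $Z$. Then $n_0=d+2>n_1$ and the numerical character $n_0\ge\cdots\ge n_{s-1}$ is connected.
   Context: We work over an algebraically closed field of characteristic $0$. For a finite set $S\subset\mathbb{P}^n$, $2S$ denotes the union of the double points supported at the points of $S$, i.e. the zero-dimensional scheme with ideal sheaf $\bigcap_{p\in S}\mathcal{I}_p^2$. For a closed subscheme $X\subset\mathbb{P}^n$, $\mathcal{I}_X$ is its ideal sheaf and $h^i(\mathcal{I}_X(t))=\dim H^i(\mathbb{P}^n,\mathcal{I}_X\otimes\mathcal{O}_{\mathbb{P}^n}(t))$. Terracini loci: $\mathbb{T}(n,d;x)$ is the set of all sets $S$ of $x$ distinct points of $\mathbb{P}^n$ such that $h^0(\mathcal{I}_{2S}(d))>0$, $h^1(\mathcal{I}_{2S}(d))>0$, and the linear span of $S$ is $\mathbb{P}^n$. $\mathbb{T}(n,d;x)'$ is the set of all $S\in\mathbb{T}(n,d;x)$ such that $h^1(\mathcal{I}_{2A}(d))=0$ for all $A\subsetneq S$. Critical schemes: given a finite set $S\subset\mathbb{P}^n$, a zero-dimensional scheme $Z$ is $d$-critical for $S$ if $Z\subseteq 2S$ and every connected component of $Z$ has degree $\le 2$; $h^1(\mathcal{I}_Z(d))>0$; and $h^1(\mathcal{I}_{Z'}(d))=0$ for every $Z'\subsetneq Z$. For $S\in\mathbb{T}(n,d;x)'$,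 "critical scheme for $S$" means $d$-critical scheme for $S$. For a nonempty zero-dimensional scheme $Z\subset\mathbb{P}^n$, $s(Z)$ is the minimal integer $t$ with $h^0(\mathcal{I}_Z(t))>0$. Numerical character: for a nonempty zero-dimensional scheme $Z\subset\mathbb{P}^2$ with $s=s(Z)$, the numerical character of $Z$ is the (unique) sequence of integers $n_0\ge n_1\ge\cdots\ge n_{s-1}\ge s$ such that for all $t\ge 0$ $$h^1(\mathcal{I}_Z(t))=\sum_{i=0}^{s-1}\big((n_i-t-1)_+-(i-t-1)_+\big),$$ where $a_+=\max\{a,0\}$. It is called connected if $n_i\le n_{i+1}+1$ for all $0\le i\le s-2$. *)

theory Defs
  imports
    "HOL-Analysis.Cartesian_Space"
    "HOL-Computational_Algebra.Polynomial"
    "HOL-Library.Poly_Mapping"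
    "HOL-Library.Function_Algebras"
begin

text \<open>
  Projective space of dimension n over a field has homogeneous coordinates indexed by a finite
  linearly ordered type with n + 1 elements; the plane uses the index type 3.
\<close>

section \<open>Polynomials and ideals\<close>

text \<open>The homogeneous coordinate ring, and its localisation at the product of all variables.\<close>

type_synonym ('v, 'k) hpoly = "('v \<Rightarrow>\<^sub>0 nat) \<Rightarrow>\<^sub>0 'k"
type_synonym ('v, 'k) laurent = "('v \<Rightarrow>\<^sub>0 int) \<Rightarrow>\<^sub>0 'k"

definition var :: "'v \<Rightarrow> ('v, 'k::comm_ring_1) hpoly" where
  "var i = Poly_Mapping.single (Poly_Mapping.single i 1) 1"

definition exp_degree :: "('v::finite \<Rightarrow>\<^sub>0 'e::comm_monoid_add) \<Rightarrow> 'e" where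
  "exp_degree m = (\<Sum>i\<in>UNIV. Poly_Mapping.lookup m i)"

text \<open>The forms of degree t, including 0; used both for polynomials and for Laurent polynomials.\<close>

definition forms :: "'e \<Rightarrow> (('v::finite \<Rightarrow>\<^sub>0 'e::comm_monoid_add) \<Rightarrow>\<^sub>0 'k::zero) set" where
  "forms t = {f. \<forall>m\<in>Poly_Mapping.keys f. exp_degree m = t}"

definition eval_at :: "('v::finite, 'k::comm_ring_1) hpoly \<Rightarrow> 'k ^ 'v \<Rightarrow> 'k" where
  "eval_at f v =
     (\<Sum>m\<in>Poly_Mapping.keys f.
        Poly_Mapping.lookup f m * (\<Prod>i\<in>UNIV. (v $ i) ^ Poly_Mapping.lookup m i))"

definition smult_pm :: "'k \<Rightarrow> ('e::comm_monoid_add \<Rightarrow>\<^sub>0 'k) \<Rightarrow> ('e \<Rightarrow>\<^sub>0 'k::comm_ring_1)" where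
  "smult_pm c f = Poly_Mapping.single 0 c * f"

text \<open>An ideal of a commutative ring is a submodule of the ring over itself: ideals are the
  sets I with \<open>ideal.subspace I\<close>, and \<open>ideal.span G\<close> is the ideal generated by G.\<close>

global_interpretation ideal: module "(*) :: 'a::comm_ring_1 \<Rightarrow> 'a \<Rightarrow> 'a"
  by unfold_locales (simp_all add: algebra_simps)

definition ideal_square :: "'a::comm_ring_1 set \<Rightarrow> 'a set" where
  "ideal_square I = ideal.span {f * g | f g. f \<in> I \<and> g \<in> I}"

section \<open>Dimensions of quotients\<close>

text \<open>The dimension of V / W for subspaces W of V, as the dimension of any linear complement of
  W in V.  As for the library's dim, the value is 0 if the quotient is infinite-dimensional.\<close>

definition (in vector_space) quotient_dim :: "'b set \<Rightarrow> 'b set \<Rightarrow> nat" where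
  "quotient_dim V W =
     (THE m. \<exists>U. subspace U \<and> U \<inter> W = {0} \<and> {u + w | u w. u \<in> U \<and> w \<in> W} = V \<and> dim U = m)"

global_interpretation polyvs:
  vector_space "smult_pm :: 'k::field \<Rightarrow> ('e::comm_monoid_add \<Rightarrow>\<^sub>0 'k) \<Rightarrow> ('e \<Rightarrow>\<^sub>0 'k)"
  by unfold_locales
     (simp_all add: smult_pm_def distrib_left distrib_right Poly_Mapping.single_add
        Poly_Mapping.mult_single flip: mult.assoc)

section \<open>Closed subschemes of projective space\<close>

text \<open>
  A closed subscheme is represented by its saturated homogeneous ideal.  This reverses
  inclusions: X is a subscheme of Y iff the ideal of Y is contained in the ideal of X.  The
  unit ideal represents the empty scheme.
\<close>

definition closed_subscheme :: "('v::finite, 'k::comm_ring_1) hpoly set \<Rightarrow> bool" where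
  "closed_subscheme I \<longleftrightarrow>
     ideal.subspace I \<and>
     ideal.span {f \<in> I. \<exists>t. f \<in> forms t} = I \<and>
     (\<forall>f. (\<forall>i. \<exists>N. var i ^ N * f \<in> I) \<longrightarrow> f \<in> I)"

text \<open>Points are the one-dimensional linear subspaces of the space of coordinate vectors.\<close>

definition proj_points :: "('k::field ^ 'v::finite) set set" where
  "proj_points = {L. vec.subspace L \<and> vec.dim L = 1}"

definition point_ideal :: "('k::field ^ 'v::finite) set \<Rightarrow> ('v, 'k) hpoly set" where
  "point_ideal p = {f. \<forall>v\<in>p. eval_at f v = 0}"

definition scheme_support :: "('v::finite, 'k::field) hpoly set \<Rightarrow> ('k ^ 'v) set set" where
  "scheme_support I = {p \<in> proj_points. I \<subseteq> point_ideal p}"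

text \<open>The ground field being algebraically closed, a closed subscheme has dimension at most 0
  iff it has finitely many points.  The empty scheme is included.\<close>

definition zero_dim_scheme :: "('v::finite, 'k::field) hpoly set \<Rightarrow> bool" where
  "zero_dim_scheme I \<longleftrightarrow> closed_subscheme I \<and> finite (scheme_support I)"

text \<open>The degree of a zero-dimensional scheme is its (constant) Hilbert polynomial.\<close>

definition scheme_degree :: "('v::finite, 'k::field) hpoly set \<Rightarrow> nat" where
  "scheme_degree I =
     (THE m. \<forall>\<^sub>F t in sequentially. polyvs.quotient_dim (forms t) (I \<inter> forms t) = m)"

text \<open>For a point p of a zero-dimensional scheme with ideal I, the ideal of the connected
  component supported at p: the contraction of the localisation of I at the prime of p.\<close>

definition component_at ::
    "('v::finite, 'k::field) hpoly set \<Rightarrow> ('k ^ 'v) set \<Rightarrow> ('v, 'k) hpoly set" where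
  "component_at I p = {f. \<exists>g. g \<notin> point_ideal p \<and> g * f \<in> I}"

text \<open>The scheme 2S; the squares of the ideals of points are saturated, and hence so is their
  intersection.\<close>

definition double_points :: "('k::field ^ 'v::finite) set set \<Rightarrow> ('v, 'k) hpoly set" where
  "double_points S = (\<Inter>p\<in>S. ideal_square (point_ideal p))"

section \<open>Cohomology of twisted ideal sheaves\<close>

text \<open>
  The cohomology of the twist by t of the ideal sheaf of X is computed by the alternating Cech
  complex of the standard affine cover, indexed by the nonempty sets \<open>\<sigma>\<close> of variables.  The
  sections over the intersection of the opens \<open>x\<^sub>i \<noteq> 0\<close>, i in \<open>\<sigma>\<close>, are the degree t part
  of the localisation of the ideal at the product of the \<open>x\<^sub>i\<close>, i in \<open>\<sigma>\<close>.
\<close>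

definition to_laurent :: "('v, 'k::comm_ring_1) hpoly \<Rightarrow> ('v, 'k) laurent" where
  "to_laurent f =
     (\<Sum>m\<in>Poly_Mapping.keys f.
        Poly_Mapping.single (Poly_Mapping.map int m) (Poly_Mapping.lookup f m))"

definition local_sections ::
    "('v::finite, 'k::comm_ring_1) hpoly set \<Rightarrow> int \<Rightarrow> 'v set \<Rightarrow> ('v, 'k) laurent set" where
  "local_sections I t \<sigma> =
     {F \<in> forms t. \<exists>N. to_laurent (\<Prod>i\<in>\<sigma>. var i ^ N) * F \<in> to_laurent ` I}"

type_synonym ('v, 'k) cochain = "'v set \<Rightarrow> ('v, 'k) laurent"

definition cochains ::
    "('v::finite, 'k::comm_ring_1) hpoly set \<Rightarrow> int \<Rightarrow> nat \<Rightarrow> ('v, 'k) cochain set" where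
  "cochains I t p =
     {s. \<forall>\<sigma>. if card \<sigma> = Suc p then s \<sigma> \<in> local_sections I t \<sigma> else s \<sigma> = 0}"

definition cech_diff ::
    "('v::{finite,linorder}, 'k::comm_ring_1) cochain \<Rightarrow> ('v, 'k) cochain" where
  "cech_diff s = (\<lambda>\<sigma>. \<Sum>j\<in>\<sigma>. (-1) ^ card {l\<in>\<sigma>. l < j} * s (\<sigma> - {j}))"

definition cocycles ::
    "('v::{finite,linorder}, 'k::comm_ring_1) hpoly set \<Rightarrow> int \<Rightarrow> nat \<Rightarrow> ('v, 'k) cochain set" where
  "cocycles I t p = {s \<in> cochains I t p. cech_diff s = 0}"

definition coboundaries ::
    "('v::{finite,linorder}, 'k::comm_ring_1) hpoly set \<Rightarrow> int \<Rightarrow> nat \<Rightarrow> ('v, 'k) cochain set" where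
  "coboundaries I t p = (if p = 0 then {0} else cech_diff ` cochains I t (p - 1))"

definition smult_cochain ::
    "'k::comm_ring_1 \<Rightarrow> ('v, 'k) cochain \<Rightarrow> ('v, 'k) cochain" where
  "smult_cochain c s = (\<lambda>\<sigma>. smult_pm c (s \<sigma>))"

global_interpretation cochainvs:
  vector_space "smult_cochain :: 'k::field \<Rightarrow> ('v, 'k) cochain \<Rightarrow> ('v, 'k) cochain"
  by unfold_locales
     (simp_all add: smult_cochain_def fun_eq_iff polyvs.scale_right_distrib
        polyvs.scale_left_distrib)

definition h_ideal :: "nat \<Rightarrow> ('v::{finite,linorder}, 'k::field) hpoly set \<Rightarrow> int \<Rightarrow> nat" where
  "h_ideal i I t = cochainvs.quotient_dim (cocycles I t i) (coboundaries I t i)"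

section \<open>Terracini loci, critical schemes and the numerical character\<close>

definition terracini ::
    "int \<Rightarrow> nat \<Rightarrow> ('k::field ^ 'v::{finite,linorder}) set set set" where
  "terracini d x =
     {S. S \<subseteq> proj_points \<and> finite S \<and> card S = x \<and>
         h_ideal 0 (double_points S) d > 0 \<and> h_ideal 1 (double_points S) d > 0 \<and>
         vec.span (\<Union>S) = UNIV}"

definition min_terracini ::
    "int \<Rightarrow> nat \<Rightarrow> ('k::field ^ 'v::{finite,linorder}) set set set" where
  "min_terracini d x =
     {S \<in> terracini d x. \<forall>A. A \<subset> S \<longrightarrow> h_ideal 1 (double_points A) d = 0}"

definition critical_scheme ::
    "int \<Rightarrow> ('k::field ^ 'v::{finite,linorder}) set set \<Rightarrow> ('v, 'k) hpoly set \<Rightarrow> bool" where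
  "critical_scheme d S Z \<longleftrightarrow>
     zero_dim_scheme Z \<and>
     double_points S \<subseteq> Z \<and>
     (\<forall>p\<in>scheme_support Z. scheme_degree (component_at Z p) \<le> 2) \<and>
     h_ideal 1 Z d > 0 \<and>
     (\<forall>Z'. closed_subscheme Z' \<and> Z \<subset> Z' \<longrightarrow> h_ideal 1 Z' d = 0)"

definition min_degree :: "('v::{finite,linorder}, 'k::field) hpoly set \<Rightarrow> int" where
  "min_degree Z = (LEAST t. h_ideal 0 Z t > 0)"

definition numerical_character :: "(3, 'k::field) hpoly set \<Rightarrow> int list \<Rightarrow> bool" where
  "numerical_character Z ns \<longleftrightarrow>
     int (length ns) = min_degree Z \<and>
     sorted_wrt (\<ge>) ns \<and>
     (\<forall>i<length ns. ns ! i \<ge> min_degree Z) \<and>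
     (\<forall>t\<ge>0. int (h_ideal 1 Z t) =
        (\<Sum>i<length ns. max 0 (ns ! i - t - 1) - max 0 (int i - t - 1)))"

definition connected_character :: "int list \<Rightarrow> bool" where
  "connected_character ns \<longleftrightarrow> (\<forall>i. i + 1 < length ns \<longrightarrow> ns ! i \<le> ns ! (i + 1) + 1)"

end

theory Submission
  imports Defs "HOL-Computational_Algebra.Polynomial_Factorial"
begin

text \<open>
  A line that misses the points of \<open>S\<close> has an affine plane as complement.  Let \<open>P\<close> be the ring of
  polynomials in two variables \<open>X\<close> and \<open>Y\<close> of this plane, \<open>P t\<close> the space of those of total degree
  at most \<open>t\<close>, and \<open>J\<close> the ideal of \<open>Z\<close> in \<open>P\<close>.  The number \<open>h_ideal 1 Z t\<close> is the dimension of
  \<open>P / (J + P t)\<close> (\<open>h1_affine\<close>): a cocycle of the Cech complex is a difference of local functions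
  that fit together to a function on \<open>Z\<close>, and it is a coboundary if this function comes from a form of
  degree \<open>t\<close>.  Hence criticality says that \<open>J + P d\<close> is not \<open>P\<close>, whereas adding \<open>P d\<close> to any ideal
  larger than \<open>J\<close> gives \<open>P\<close> (\<open>critical_ideal\<close>).  This has two consequences.

  Some function \<open>g\<close> outside \<open>J\<close> spans an ideal of dimension one modulo \<open>J\<close>: start with 1 and multiply by
  linear factors that eventually carry it into \<open>J\<close>.  So \<open>g\<close> and \<open>J + P d\<close> span \<open>P\<close>, and
  \<open>h_ideal 1 Z d = 1\<close> (\<open>h1_eq_1\<close>).  In the formula that defines the numerical character all summands
  are nonnegative, so just one of the \<open>ns ! i\<close> exceeds \<open>d + 1\<close>, and it is \<open>ns ! 0 = d + 2\<close>.  There is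
  an entry \<open>ns ! 1\<close> because \<open>Z\<close> lies on no line (\<open>critical_scheme_not_in_line\<close>).

  Secondly, a function \<open>F\<close> with \<open>F * P \<subseteq> J + P d\<close> belongs to \<open>J\<close>, because all such functions form an
  ideal (\<open>multiples_interpolated_imp_zero\<close>).  This gives connectedness.  The drop of \<open>h1\<close> from
  \<open>t - 1\<close> to \<open>t\<close> is the codimension of the leading forms of degree \<open>t\<close> of \<open>J\<close> among all forms
  (\<open>h1_drop\<close>).  If \<open>ns ! i > ns ! (i + 1) + 1\<close>, this codimension is \<open>c = i + 1\<close> in the two degrees
  \<open>T = ns ! (i + 1)\<close> and \<open>T + 1\<close>, where \<open>T \<le> d\<close>.  Then the members of \<open>J\<close> of degree at most \<open>T\<close>
  share a factor \<open>F\<close> of degree \<open>c\<close>, and their cofactors have all forms of degree \<open>T - c\<close> as leading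
  forms, so that \<open>F * P \<subseteq> J + P T\<close> (\<open>multiples_low_degree\<close>).  Therefore \<open>F\<close> belongs to \<open>J\<close> and defines
  a curve of degree \<open>c\<close> through \<open>Z\<close>, although \<open>c\<close> is less than the least degree \<open>s = length ns\<close> of
  such a curve.
\<close>

section \<open>Dimensions of quotients and complements\<close>

context vector_space
begin

text \<open>A subset of the spanning set that is minimal among those spanning \<open>V\<close> together with \<open>W\<close>
  is a basis of a complement.\<close>

lemma finite_complement:
  assumes W: "subspace W" and V: "subspace V" "W \<subseteq> V"
    and C: "finite C" "C \<subseteq> V" "V \<subseteq> span (W \<union> C)"
  obtains X B where "subspace X" "X = span B" "finite B" "independent B" "X \<subseteq> V" "card B \<le> card C"
    "\<And>x. x \<in> X \<Longrightarrow> x \<in> W \<Longrightarrow> x = 0" "\<And>v. v \<in> V \<Longrightarrow> \<exists>x\<in>X. v - x \<in> W"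
proof -
  define m where "m = (LEAST m. \<exists>B\<subseteq>C. card B = m \<and> V \<subseteq> span (W \<union> B))"
  have "\<exists>B\<subseteq>C. card B = m \<and> V \<subseteq> span (W \<union> B)"
    unfolding m_def by (rule LeastI_ex) (use C in blast)
  then obtain B where B: "B \<subseteq> C" "card B = m" "V \<subseteq> span (W \<union> B)" by blast
  have fin: "finite B" using B C finite_subset by blast
  have min: "b \<notin> span (W \<union> (B - {b}))" if "b \<in> B" for b
  proof
    assume b: "b \<in> span (W \<union> (B - {b}))"
    have "W \<union> B \<subseteq> span (W \<union> (B - {b}))"
      using b by (auto intro: span_base)
    then have "V \<subseteq> span (W \<union> (B - {b}))"
      using B(3) span_minimal[OF _ subspace_span] by blast
    moreover have "B - {b} \<subseteq> C" using B by blast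
    ultimately have "m \<le> card (B - {b})" unfolding m_def by (intro Least_le) blast
    then show False using that fin B(2) by (simp add: card_gt_0_iff card_Diff_singleton_if split: if_splits)
      (metis One_nat_def card_gt_0_iff diff_less emptyE leD zero_less_one)
  qed
  have zero: "u b = 0" if u: "(\<Sum>b\<in>B. scale (u b) b) \<in> W" and b: "b \<in> B" for u b
  proof (rule ccontr)
    assume nz: "u b \<noteq> 0"
    let ?r = "\<Sum>b\<in>B - {b}. scale (u b) b"
    have "(\<Sum>b\<in>B. scale (u b) b) = scale (u b) b + ?r" using b fin by (simp add: sum.remove)
    then have "scale (u b) b = (\<Sum>b\<in>B. scale (u b) b) - ?r" by simp
    moreover have "?r \<in> span (W \<union> (B - {b}))"
      by (intro span_sum span_scale span_base) auto
    ultimately have "scale (u b) b \<in> span (W \<union> (B - {b}))"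
      using u by (simp add: span_base span_diff)
    then have "scale (inverse (u b)) (scale (u b) b) \<in> span (W \<union> (B - {b}))" by (rule span_scale)
    then show False using min[OF b] nz by simp
  qed
  have ind: "independent B"
    by (rule independent_if_scalars_zero[OF fin]) (use zero subspace_0[OF W] in metis)
  show ?thesis
  proof (rule that[OF subspace_span refl fin ind])
    show "span B \<subseteq> V" using B C V by (meson order_trans span_minimal)
    show "card B \<le> card C" using B C card_mono by blast
    show "x = 0" if x: "x \<in> span B" "x \<in> W" for x
    proof -
      obtain u where u: "x = (\<Sum>b\<in>B. scale (u b) b)" using x(1) fin by (auto simp: span_finite)
      then have "\<forall>b\<in>B. u b = 0" using zero x(2) by blast
      with u show ?thesis by simp
    qed
    show "\<exists>x\<in>span B. v - x \<in> W" if "v \<in> V" for v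
    proof -
      have "v \<in> span (W \<union> B)" using that B by blast
      then obtain w b where "v = w + b" "w \<in> span W" "b \<in> span B" unfolding span_Un by blast
      then show ?thesis using span_eq_iff[of W] W by (intro bexI[of _ b]) (simp_all del: span_eq_iff)
    qed
  qed
qed

end

context vector_space_pair
begin

lemma dim_injective_image:
  assumes f: "Vector_Spaces.linear s1 s2 f" and X: "vs1.subspace X"
    and inj: "\<And>x. x \<in> X \<Longrightarrow> f x = 0 \<Longrightarrow> x = 0"
  shows "vs2.dim (f ` X) = vs1.dim X"
proof -
  interpret f: Vector_Spaces.linear s1 s2 f by (rule f)
  obtain B where B: "B \<subseteq> X" "vs1.independent B" "X \<subseteq> vs1.span B" "card B = vs1.dim X"
    using vs1.basis_exists by blast
  have sp: "vs1.span B = X" using B X vs1.span_minimal by blast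
  have "inj_on f X"
    unfolding f.inj_on_iff_eq_0[OF X] using inj by blast
  then have "vs2.independent (f ` B)" and ca: "card (f ` B) = card B"
    using f.independent_injective_image[OF B(2)] sp B(1) by (auto simp: card_image inj_on_subset)
  then show ?thesis
    using vs2.dim_unique[of "f ` B" "f ` X" "card B"] B sp f.span_image[of B] by auto
qed

text \<open>The definition of a quotient dimension speaks of an arbitrary complement \<open>U\<close>.  Moving the
  images of a basis of \<open>X\<close> by elements of \<open>W\<close> places them in \<open>U\<close>, and this gives an isomorphism
  from \<open>X\<close> to \<open>U\<close>.\<close>

lemma quotient_dim_eqI:
  assumes f: "Vector_Spaces.linear s1 s2 f" and X: "vs1.subspace X"
    and W: "vs2.subspace W" and V: "vs2.subspace V" and WV: "W \<subseteq> V" and fX: "f ` X \<subseteq> V"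
    and inj: "\<And>x. x \<in> X \<Longrightarrow> f x \<in> W \<Longrightarrow> x = 0"
    and surj: "\<And>v. v \<in> V \<Longrightarrow> \<exists>x\<in>X. v - f x \<in> W"
  shows "vs2.quotient_dim V W = vs1.dim X"
  unfolding vs2.quotient_dim_def
proof (rule the_equality)
  interpret f: Vector_Spaces.linear s1 s2 f by (rule f)
  have W0: "0 \<in> W" using W vs2.subspace_0 by blast
  have sub: "vs2.subspace (f ` X)" using f.subspace_image[OF X] .
  have "f ` X \<inter> W = {0}"
  proof -
    have "f x = 0" if "x \<in> X" "f x \<in> W" for x using inj[OF that] f.zero by simp
    then have "f ` X \<inter> W \<subseteq> {0}" by auto
    moreover have "{0} \<subseteq> f ` X \<inter> W" using W0 vs2.subspace_0[OF sub] by simp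
    ultimately show ?thesis by (rule subset_antisym)
  qed
  moreover have "{u + w |u w. u \<in> f ` X \<and> w \<in> W} = V"
  proof (intro equalityI subsetI)
    fix v assume "v \<in> V"
    then obtain x where "x \<in> X" "v - f x \<in> W" using surj[of v] by blast
    then show "v \<in> {u + w |u w. u \<in> f ` X \<and> w \<in> W}"
      by (intro CollectI exI[of _ "f x"] exI[of _ "v - f x"]) auto
  next
    fix v assume "v \<in> {u + w |u w. u \<in> f ` X \<and> w \<in> W}"
    then obtain u w where "v = u + w" "u \<in> V" "w \<in> V" using fX WV by blast
    then show "v \<in> V" using vs2.subspace_add[OF V] by simp
  qed
  moreover have "vs2.dim (f ` X) = vs1.dim X"
  proof (rule dim_injective_image[OF f X])
    fix x assume "x \<in> X" "f x = 0"
    then show "x = 0" using inj[of x] W0 by simp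
  qed
  ultimately show "\<exists>U. vs2.subspace U \<and> U \<inter> W = {0} \<and>
      {u + w |u w. u \<in> U \<and> w \<in> W} = V \<and> vs2.dim U = vs1.dim X"
    using sub by (intro exI conjI)
next
  interpret f: Vector_Spaces.linear s1 s2 f by (rule f)
  fix m assume "\<exists>U. vs2.subspace U \<and> U \<inter> W = {0} \<and>
      {u + w |u w. u \<in> U \<and> w \<in> W} = V \<and> vs2.dim U = m"
  then obtain U where U: "vs2.subspace U" "U \<inter> W = {0}"
    "{u + w |u w. u \<in> U \<and> w \<in> W} = V" "vs2.dim U = m" by blast
  have UV: "u \<in> V" if "u \<in> U" for u
  proof -
    have "u + 0 \<in> {u + w |u w. u \<in> U \<and> w \<in> W}"
      using that vs2.subspace_0[OF W] by blast
    then show ?thesis unfolding U(3) by simp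
  qed
  obtain B where B: "B \<subseteq> X" "vs1.independent B" "X \<subseteq> vs1.span B"
    by (rule vs1.basis_exists[of X])
  have sp: "vs1.span B = X" using B X vs1.span_minimal by blast
  have "\<forall>b\<in>B. \<exists>u\<in>U. f b - u \<in> W"
  proof
    fix b assume "b \<in> B"
    then have "f b \<in> V" using B(1) fX by blast
    then have "f b \<in> {u + w |u w. u \<in> U \<and> w \<in> W}" unfolding U(3) .
    then obtain u w where "f b = u + w" "u \<in> U" "w \<in> W" by blast
    then show "\<exists>u\<in>U. f b - u \<in> W" by (intro bexI[of _ u]) auto
  qed
  then obtain g0 where "\<forall>b\<in>B. g0 b \<in> U \<and> f b - g0 b \<in> W"
    using bchoice[of B "\<lambda>b u. u \<in> U \<and> f b - u \<in> W"] by blast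
  then have g0: "g0 b \<in> U" "f b - g0 b \<in> W" if "b \<in> B" for b using that by blast+
  define g where "g = construct B g0"
  have lin: "Vector_Spaces.linear s1 s2 g" unfolding g_def by (rule linear_construct[OF B(2)])
  interpret g: Vector_Spaces.linear s1 s2 g by (rule lin)
  have gb: "g b = g0 b" if "b \<in> B" for b unfolding g_def using construct_basis[OF B(2) that] .
  have gU: "g x \<in> U" if "x \<in> X" for x
  proof -
    have "g ` B \<subseteq> U" using gb g0(1) by (simp add: image_subset_iff)
    then have "vs2.span (g ` B) \<subseteq> U" using U(1) vs2.span_minimal by blast
    then show ?thesis using that g.span_image[of B] sp by auto
  qed
  have fg: "f x - g x \<in> W" if "x \<in> X" for x
  proof -
    have "Vector_Spaces.linear s1 s2 (\<lambda>x. f x - g x)" using linear_compose_sub f lin by blast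
    then interpret h: Vector_Spaces.linear s1 s2 "\<lambda>x. f x - g x" .
    have "B \<subseteq> {x. f x - g x \<in> W}" using gb g0(2) by (simp add: subset_eq)
    then have "vs1.span B \<subseteq> {x. f x - g x \<in> W}"
      using vs1.span_minimal h.subspace_linear_preimage[OF W] by blast
    then show ?thesis using that sp by blast
  qed
  have "g ` X = U"
  proof (intro equalityI subsetI)
    fix u assume u: "u \<in> U"
    then obtain x where x: "x \<in> X" "u - f x \<in> W" using surj[OF UV] by blast
    have "(u - f x) + (f x - g x) \<in> W" using vs2.subspace_add[OF W x(2) fg[OF x(1)]] .
    then have "u - g x \<in> W" by simp
    moreover have "u - g x \<in> U" using vs2.subspace_diff[OF U(1) u gU[OF x(1)]] .
    ultimately have "u - g x = 0" using U(2) by blast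
    then show "u \<in> g ` X" using x by auto
  qed (use gU in blast)
  moreover have "vs2.dim (g ` X) = vs1.dim X"
  proof (rule dim_injective_image[OF lin X])
    fix x assume x: "x \<in> X" "g x = 0"
    then have "f x \<in> W" using fg[of x] by simp
    then show "x = 0" by (rule inj[OF x(1)])
  qed
  ultimately show "m = vs1.dim X" using U(4) by simp
qed

end

context vector_space
begin

lemma quotient_dim_complement:
  assumes "subspace X" "subspace W" "subspace V" "W \<subseteq> V" "X \<subseteq> V"
    "\<And>x. x \<in> X \<Longrightarrow> x \<in> W \<Longrightarrow> x = 0" "\<And>v. v \<in> V \<Longrightarrow> \<exists>x\<in>X. v - x \<in> W"
  shows "quotient_dim V W = dim X"
proof -
  interpret vector_space_pair scale scale by unfold_locales
  show ?thesis
    by (rule quotient_dim_eqI[OF linear_ident assms(1-4)]) (simp_all add: assms(5-7))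
qed

lemma quotient_dim_le:
  assumes "subspace W" "subspace V" "W \<subseteq> V" "finite C" "C \<subseteq> V" "V \<subseteq> span (W \<union> C)"
  shows "quotient_dim V W \<le> card C" and "quotient_dim V W = 0 \<longleftrightarrow> V = W"
proof -
  obtain X B where X: "subspace X" "X = span B" "finite B" "independent B" "X \<subseteq> V" "card B \<le> card C"
    and d: "\<And>x. x \<in> X \<Longrightarrow> x \<in> W \<Longrightarrow> x = 0" "\<And>v. v \<in> V \<Longrightarrow> \<exists>x\<in>X. v - x \<in> W"
    by (rule finite_complement[OF assms]) (rule that)
  have q: "quotient_dim V W = card B"
    using quotient_dim_complement[OF X(1) assms(1-3) X(5) d] X dim_eq_card_independent by simp
  then show "quotient_dim V W \<le> card C" using X by simp
  show "quotient_dim V W = 0 \<longleftrightarrow> V = W"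
  proof
    assume "quotient_dim V W = 0"
    then have "X = {0}" using q X(2,3) by simp
    then show "V = W" using d(2) assms(3) by auto
  next
    assume "V = W"
    then have "B \<subseteq> {0}" using d(1) X(2,5) span_base by blast
    then have "B = {}" using X(4) dependent_zero by blast
    then show "quotient_dim V W = 0" using q by simp
  qed
qed

text \<open>A complement of \<open>W\<close> in \<open>V'\<close> and one of \<open>V'\<close> in \<open>V\<close> add up to a complement of \<open>W\<close> in \<open>V\<close>.\<close>

lemma quotient_dim_additive:
  assumes sub: "subspace W" "subspace V'" "subspace V" "W \<subseteq> V'" "V' \<subseteq> V"
    and C: "finite C" "C \<subseteq> V" "V \<subseteq> span (V' \<union> C)"
    and C': "finite C'" "C' \<subseteq> V'" "V' \<subseteq> span (W \<union> C')"
  shows "quotient_dim V W = quotient_dim V V' + quotient_dim V' W"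
proof -
  obtain X B where X: "subspace X" "X = span B" "finite B" "independent B" "X \<subseteq> V"
    and d: "\<And>x. x \<in> X \<Longrightarrow> x \<in> V' \<Longrightarrow> x = 0" "\<And>v. v \<in> V \<Longrightarrow> \<exists>x\<in>X. v - x \<in> V'"
    by (rule finite_complement[OF sub(2,3,5) C]) (rule that)
  obtain X' B' where X': "subspace X'" "X' = span B'" "finite B'" "independent B'" "X' \<subseteq> V'"
    and d': "\<And>x. x \<in> X' \<Longrightarrow> x \<in> W \<Longrightarrow> x = 0" "\<And>v. v \<in> V' \<Longrightarrow> \<exists>x\<in>X'. v - x \<in> W"
    by (rule finite_complement[OF sub(1,2,4) C']) (rule that)
  have q: "quotient_dim V V' = card B"
    using quotient_dim_complement[OF X(1) sub(2,3,5) X(5) d] X dim_eq_card_independent by simp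
  have q': "quotient_dim V' W = card B'"
    using quotient_dim_complement[OF X'(1) sub(1,2,4) X'(5) d'] X' dim_eq_card_independent by simp
  have disj: "B \<inter> B' = {}"
  proof (rule ccontr)
    assume "B \<inter> B' \<noteq> {}"
    then obtain b where b: "b \<in> B" "b \<in> B'" by blast
    then have "b \<in> X" "b \<in> V'" using X(2) X'(2,5) span_base by blast+
    then have "b = 0" using d by blast
    then show False using b X(4) dependent_zero by blast
  qed
  have ind: "independent (B \<union> B')"
  proof (rule independent_if_scalars_zero)
    fix u x assume s: "(\<Sum>x\<in>B \<union> B'. scale (u x) x) = 0" and x: "x \<in> B \<union> B'"
    have s2: "(\<Sum>x\<in>B. scale (u x) x) + (\<Sum>x\<in>B'. scale (u x) x) = 0"
      using s X(3) X'(3) disj by (simp add: sum.union_disjoint)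
    have i: "(\<Sum>x\<in>B. scale (u x) x) \<in> X" "(\<Sum>x\<in>B'. scale (u x) x) \<in> X'"
      unfolding X(2) X'(2) by (intro span_sum span_scale span_base; assumption)+
    then have "- (\<Sum>x\<in>B'. scale (u x) x) \<in> V'" using X'(5) sub subspace_neg by blast
    moreover have "(\<Sum>x\<in>B. scale (u x) x) = - (\<Sum>x\<in>B'. scale (u x) x)" using s2 by (simp only: eq_neg_iff_add_eq_0)
    ultimately have "(\<Sum>x\<in>B. scale (u x) x) \<in> V'" by (simp only:)
    then have z: "(\<Sum>x\<in>B. scale (u x) x) = 0" by (rule d(1)[OF i(1)])
    then have z': "(\<Sum>x\<in>B'. scale (u x) x) = 0" using s2 by simp
    show "u x = 0"
      using x independentD[OF X(4) X(3) subset_refl z, of x]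
        independentD[OF X'(4) X'(3) subset_refl z', of x] by blast
  qed (use X(3) X'(3) in simp)
  have "quotient_dim V W = dim (span (B \<union> B'))"
  proof (rule quotient_dim_complement)
    have "B \<union> B' \<subseteq> V" using X(2,5) X'(2,5) sub(5) span_superset[of B] span_superset[of B'] by blast
    then show "span (B \<union> B') \<subseteq> V" by (rule span_minimal[OF _ sub(3)])
    fix x assume x: "x \<in> span (B \<union> B')" "x \<in> W"
    then obtain a b where ab: "x = a + b" "a \<in> X" "b \<in> X'" unfolding span_Un X(2) X'(2) by blast
    have "a = x - b" using ab by simp
    moreover have "x \<in> V'" "b \<in> V'" using x(2) sub(4) ab(3) X'(5) by blast+
    ultimately have "a \<in> V'" using subspace_diff[OF sub(2)] by blast
    then have "a = 0" using d ab by blast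
    then have "x \<in> X'" using ab by simp
    then show "x = 0" using d'(1) x(2) by blast
  next
    fix v assume "v \<in> V"
    then obtain x where x: "x \<in> X" "v - x \<in> V'" using d by blast
    then obtain x' where x': "x' \<in> X'" "v - x - x' \<in> W" using d' by blast
    have "x + x' \<in> span (B \<union> B')" using x(1) x'(1) unfolding span_Un X(2) X'(2) by blast
    moreover have "v - (x + x') \<in> W" using x'(2) by (simp add: diff_diff_eq)
    ultimately show "\<exists>x\<in>span (B \<union> B'). v - x \<in> W" by blast
  next
    show "W \<subseteq> V" using sub(4,5) by (rule subset_trans)
  qed (fact subspace_span sub(1) sub(3))+
  also have "\<dots> = card B + card B'"
    using ind X(3) X'(3) disj by (simp add: dim_eq_card_independent card_Un_disjoint)
  finally show ?thesis using q q' by simp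
qed

end

section \<open>Leading forms of plane polynomials\<close>

global_interpretation upoly: vector_space "smult :: 'k::field \<Rightarrow> 'k poly \<Rightarrow> 'k poly"
  by unfold_locales (simp_all add: smult_add_right smult_add_left)

global_interpretation bpoly: vector_space "\<lambda>c. smult [:c:] :: 'k::field poly poly \<Rightarrow> 'k poly poly"
  by unfold_locales (simp_all add: smult_add_right mult.commute flip: smult_add_left one_pCons)

text \<open>Polynomials in \<open>X\<close> and \<open>Y\<close> are polynomials in \<open>X\<close> whose coefficients are polynomials in \<open>Y\<close>;
  this set consists of those of total degree at most \<open>u\<close>.\<close>

definition tdeg_le :: "nat \<Rightarrow> 'k::zero poly poly set" where
  "tdeg_le u = {f. \<forall>i j. coeff (coeff f i) j \<noteq> 0 \<longrightarrow> i + j \<le> u}"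

text \<open>The homogeneous component of degree \<open>u\<close>, with \<open>Y\<close> set to 1 to make it a polynomial in \<open>X\<close>
  alone.  A factor \<open>Y\<close> of the component shows as a degree below \<open>u\<close>.\<close>

definition lead_form :: "nat \<Rightarrow> 'k::comm_monoid_add poly poly \<Rightarrow> 'k poly" where
  "lead_form u f = (\<Sum>i\<le>u. monom (coeff (coeff f i) (u - i)) i)"

abbreviation varX :: "'k::comm_ring_1 poly poly" where "varX \<equiv> [:0, 1:]"
abbreviation varY :: "'k::comm_ring_1 poly poly" where "varY \<equiv> [:[:0, 1:]:]"

lemma coeff_lead_form:
  "coeff (lead_form u f) i = (if i \<le> u then coeff (coeff f i) (u - i) else 0)"
  by (simp add: lead_form_def coeff_sum)

lemma degree_lead_form: "degree (lead_form u f) \<le> u"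
  by (rule degree_le) (simp add: coeff_lead_form)

lemma linear_lead_form:
  "Vector_Spaces.linear (\<lambda>c. smult [:c:]) smult (lead_form u :: 'k::field poly poly \<Rightarrow> 'k poly)"
proof -
  interpret vector_space_pair "\<lambda>c. smult [:c:] :: 'k poly poly \<Rightarrow> 'k poly poly"
    "smult :: 'k \<Rightarrow> 'k poly \<Rightarrow> 'k poly" by unfold_locales
  show ?thesis
    by unfold_locales (auto simp: poly_eq_iff coeff_lead_form)
qed

lemma lead_form_add: "lead_form u (f + g) = lead_form u f + lead_form u g"
  by (auto simp: poly_eq_iff coeff_lead_form)

lemma lead_form_diff: "lead_form u (f - g :: 'k::ab_group_add poly poly) = lead_form u f - lead_form u g"
  by (auto simp: poly_eq_iff coeff_lead_form)

lemma lead_form_0 [simp]: "lead_form u 0 = 0"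
  by (auto simp: poly_eq_iff coeff_lead_form)

lemma tdeg_le_0 [simp]: "0 \<in> tdeg_le u" by (simp add: tdeg_le_def)

lemma tdeg_leI: "(\<And>i j. u < i + j \<Longrightarrow> coeff (coeff f i) j = 0) \<Longrightarrow> f \<in> tdeg_le u"
  unfolding tdeg_le_def by (intro CollectI allI impI) (meson not_le)

lemma tdeg_leD: "f \<in> tdeg_le u \<Longrightarrow> u < i + j \<Longrightarrow> coeff (coeff f i) j = 0"
  unfolding tdeg_le_def using not_le by blast

lemma tdeg_le_add: "f \<in> tdeg_le u \<Longrightarrow> g \<in> tdeg_le u \<Longrightarrow> f + g \<in> tdeg_le u"
  by (rule tdeg_leI) (simp add: tdeg_leD)

lemma tdeg_le_diff: "f \<in> tdeg_le u \<Longrightarrow> g \<in> tdeg_le u \<Longrightarrow> f - g \<in> tdeg_le u"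
  for f :: "'k::ab_group_add poly poly"
  by (rule tdeg_leI) (simp add: tdeg_leD)

lemma tdeg_le_mono: "f \<in> tdeg_le u \<Longrightarrow> u \<le> v \<Longrightarrow> f \<in> tdeg_le v"
  by (rule tdeg_leI) (simp add: tdeg_leD)

lemma tdeg_le_ex: "\<exists>u. f \<in> tdeg_le u"
proof -
  let ?u = "degree f + (MAX i\<in>{..degree f}. degree (coeff f i))"
  have "i + j \<le> ?u" if "coeff (coeff f i) j \<noteq> 0" for i j
  proof -
    have "i \<le> degree f" using that by (intro le_degree) auto
    moreover have "j \<le> degree (coeff f i)" using that by (rule le_degree)
    moreover have "degree (coeff f i) \<le> (MAX i\<in>{..degree f}. degree (coeff f i))"
      using \<open>i \<le> degree f\<close> by (intro Max_ge) auto
    ultimately show ?thesis by linarith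
  qed
  then show ?thesis unfolding tdeg_le_def by blast
qed

lemma subspace_tdeg_le: "bpoly.subspace (tdeg_le u :: 'k::field poly poly set)"
  by (auto simp: bpoly.subspace_def tdeg_le_add) (rule tdeg_leI, simp add: tdeg_leD)

lemma tdeg_le_degree: "f \<in> tdeg_le u \<Longrightarrow> degree f \<le> u"
  by (rule degree_le) (auto simp: poly_eq_iff intro!: tdeg_leD)

lemma lead_form_zero_tdeg:
  assumes "f \<in> tdeg_le (Suc u)" "lead_form (Suc u) f = 0"
  shows "f \<in> tdeg_le u"
  unfolding tdeg_le_def
proof (intro CollectI allI impI)
  fix i j assume nz: "coeff (coeff f i) j \<noteq> 0"
  then have le: "i + j \<le> Suc u" using assms(1) by (auto simp: tdeg_le_def)
  moreover have "i + j \<noteq> Suc u"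
  proof
    assume e: "i + j = Suc u"
    then have "i \<le> Suc u" "j = Suc u - i" by auto
    then have "coeff (lead_form (Suc u) f) i = coeff (coeff f i) j" by (simp add: coeff_lead_form)
    with nz assms(2) show False by simp
  qed
  ultimately show "i + j \<le> u" by simp
qed

lemma lead_form_zero_tdeg_0:
  assumes "f \<in> tdeg_le 0" "lead_form 0 f = 0"
  shows "f = 0"
proof -
  have "coeff (coeff f i) j = 0" for i j
  proof (rule ccontr)
    assume nz: "coeff (coeff f i) j \<noteq> 0"
    then have "i = 0" "j = 0" using assms(1) by (auto simp: tdeg_le_def)
    then have "coeff (lead_form 0 f) 0 = coeff (coeff f i) j" by (simp add: coeff_lead_form)
    with nz assms(2) show False by simp
  qed
  then show ?thesis by (auto simp: poly_eq_iff)
qed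

lemma tdeg_le_lead_form_eq_0: "f \<in> tdeg_le u \<Longrightarrow> u < v \<Longrightarrow> lead_form v f = 0"
  by (auto simp: poly_eq_iff coeff_lead_form intro!: tdeg_leD)

lemma ex_total_degree:
  assumes "f \<noteq> 0"
  obtains u where "f \<in> tdeg_le u" "lead_form u f \<noteq> 0"
proof -
  define u where "u = (LEAST u. f \<in> tdeg_le u)"
  have u: "f \<in> tdeg_le u" unfolding u_def by (rule LeastI_ex[OF tdeg_le_ex])
  have "lead_form u f \<noteq> 0"
  proof
    assume z: "lead_form u f = 0"
    show False
    proof (cases u)
      case 0
      then show False using z u assms lead_form_zero_tdeg_0 by metis
    next
      case (Suc w)
      then have "f \<in> tdeg_le w" using z u lead_form_zero_tdeg by metis
      then have "u \<le> w" unfolding u_def by (rule Least_le)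
      then show False using Suc by simp
    qed
  qed
  with u show ?thesis by (rule that)
qed

lemma coeff_coeff_mult:
  "coeff (coeff (f * g) n) j = (\<Sum>i\<le>n. \<Sum>k\<le>j. coeff (coeff f i) k * coeff (coeff g (n - i)) (j - k))"
  for f g :: "'k::comm_ring_1 poly poly"
  by (simp add: coeff_mult coeff_sum)

lemma tdeg_le_mult:
  fixes f g :: "'k::comm_ring_1 poly poly"
  assumes f: "f \<in> tdeg_le u" and g: "g \<in> tdeg_le v"
  shows "f * g \<in> tdeg_le (u + v)"
  unfolding tdeg_le_def
proof (intro CollectI allI impI)
  fix n j assume nz: "coeff (coeff (f * g) n) j \<noteq> 0"
  show "n + j \<le> u + v"
  proof (rule ccontr)
    assume gt: "\<not> n + j \<le> u + v"
    have "coeff (coeff f i) k * coeff (coeff g (n - i)) (j - k) = 0" if "i \<le> n" "k \<le> j" for i k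
    proof (rule ccontr)
      assume "\<not> ?thesis"
      then have "coeff (coeff f i) k \<noteq> 0" "coeff (coeff g (n - i)) (j - k) \<noteq> 0" by auto
      then have "i + k \<le> u" "(n - i) + (j - k) \<le> v" using f g by (auto simp: tdeg_le_def)
      then show False using that gt by linarith
    qed
    then have "coeff (coeff (f * g) n) j = 0"
      unfolding coeff_coeff_mult by (intro sum.neutral ballI) auto
    with nz show False by simp
  qed
qed

lemma lead_form_mult:
  fixes f g :: "'k::comm_ring_1 poly poly"
  assumes f: "f \<in> tdeg_le u" and g: "g \<in> tdeg_le v"
  shows "lead_form (u + v) (f * g) = lead_form u f * lead_form v g"
proof (rule poly_eqI)
  fix n
  show "coeff (lead_form (u + v) (f * g)) n = coeff (lead_form u f * lead_form v g) n"
  proof (cases "n \<le> u + v")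
    case False
    have "degree (lead_form u f * lead_form v g) \<le> u + v"
      by (rule order_trans[OF degree_mult_le]) (intro add_mono degree_lead_form)
    then show ?thesis using False by (simp add: coeff_lead_form coeff_eq_0)
  next
    case True
    define j where "j = u + v - n"
    have "(\<Sum>k\<le>j. coeff (coeff f i) k * coeff (coeff g (n - i)) (j - k)) =
      coeff (lead_form u f) i * coeff (lead_form v g) (n - i)" if i: "i \<le> n" for i
    proof -
      have z: "coeff (coeff f i) k * coeff (coeff g (n - i)) (j - k) = 0"
        if k: "k \<le> j" "\<not> (i \<le> u \<and> n - i \<le> v \<and> k = u - i)" for k
      proof (rule ccontr)
        assume "\<not> ?thesis"
        then have "coeff (coeff f i) k \<noteq> 0" "coeff (coeff g (n - i)) (j - k) \<noteq> 0" by auto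
        then have "i + k \<le> u" "(n - i) + (j - k) \<le> v" using f g by (auto simp: tdeg_le_def)
        then show False using k i True unfolding j_def by linarith
      qed
      show ?thesis
      proof (cases "i \<le> u \<and> n - i \<le> v")
        case False
        then have "(\<Sum>k\<le>j. coeff (coeff f i) k * coeff (coeff g (n - i)) (j - k)) = 0"
          using z by (intro sum.neutral ballI) auto
        then show ?thesis using False by (auto simp: coeff_lead_form)
      next
        case t: True
        then have m: "u - i \<in> {..j}" and e: "j - (u - i) = v - (n - i)"
          using i True unfolding j_def by auto
        have "(\<Sum>k\<le>j. coeff (coeff f i) k * coeff (coeff g (n - i)) (j - k)) =
           coeff (coeff f i) (u - i) * coeff (coeff g (n - i)) (j - (u - i))"
          using z by (subst sum.remove[OF _ m]) (auto intro!: sum.neutral)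
        then show ?thesis using t e by (simp add: coeff_lead_form)
      qed
    qed
    then have "coeff (coeff (f * g) n) j = coeff (lead_form u f * lead_form v g) n"
      unfolding coeff_coeff_mult coeff_mult[of "lead_form u f"] by (intro sum.cong) auto
    then show ?thesis using True by (simp add: coeff_lead_form j_def)
  qed
qed

lemma varX_tdeg: "varX \<in> tdeg_le 1" "lead_form 1 varX = [:0, 1:]"
  by (auto simp: tdeg_le_def poly_eq_iff coeff_lead_form coeff_pCons split: nat.splits)

lemma varY_tdeg: "varY \<in> tdeg_le 1" "lead_form 1 varY = 1"
  by (auto simp: tdeg_le_def poly_eq_iff coeff_lead_form coeff_pCons split: nat.splits)

lemma varX_mult:
  assumes "f \<in> tdeg_le u"
  shows "varX * f \<in> tdeg_le (Suc u)" "lead_form (Suc u) (varX * f) = [:0, 1:] * lead_form u f"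
  using tdeg_le_mult[OF varX_tdeg(1) assms] lead_form_mult[OF varX_tdeg(1) assms]
  by (simp_all only: varX_tdeg(2) plus_1_eq_Suc)

lemma varY_mult:
  assumes "f \<in> tdeg_le u"
  shows "varY * f \<in> tdeg_le (Suc u)" "lead_form (Suc u) (varY * f) = lead_form u f"
  using tdeg_le_mult[OF varY_tdeg(1) assms] lead_form_mult[OF varY_tdeg(1) assms]
  by (simp_all only: varY_tdeg(2) plus_1_eq_Suc mult_1_left)

lemma const_tdeg: "[:[:c:]:] \<in> tdeg_le 0"
  by (auto simp: tdeg_le_def coeff_pCons split: nat.splits)

lemma tdeg_le_Suc_decompose:
  fixes f :: "'k::comm_ring_1 poly poly"
  assumes "f \<in> tdeg_le (Suc u)"
  obtains p q c where "p \<in> tdeg_le u" "q \<in> tdeg_le u" "f = varX * p + varY * q + [:[:c:]:]"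
proof -
  obtain g p where fg: "f = pCons g p" by (cases f)
  obtain c q where gq: "g = pCons c q" by (cases g)
  have nz: "coeff (coeff f i) j \<noteq> 0 \<Longrightarrow> i + j \<le> Suc u" for i j
    using assms by (auto simp: tdeg_le_def)
  show ?thesis
  proof (rule that)
    show "p \<in> tdeg_le u" using nz[of "Suc _"] fg by (auto simp: tdeg_le_def)
    show "[:q:] \<in> tdeg_le u" using nz[of 0 "Suc _"] fg gq
      by (auto simp: tdeg_le_def coeff_pCons split: nat.splits)
    show "f = varX * p + varY * [:q:] + [:[:c:]:]" unfolding fg gq by simp
  qed
qed

lemma lead_form_zero_mult:
  assumes "f \<in> tdeg_le u" "lead_form u f = 0"
  shows "varX * f \<in> tdeg_le u" "varY * f \<in> tdeg_le u"
proof -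
  have "varX * f \<in> tdeg_le u \<and> varY * f \<in> tdeg_le u"
  proof (cases u)
    case 0
    then have "f = 0" using assms lead_form_zero_tdeg_0 by blast
    then show ?thesis by simp
  next
    case (Suc w)
    then have "f \<in> tdeg_le w" using assms lead_form_zero_tdeg by blast
    then show ?thesis unfolding Suc using varX_mult(1) varY_mult(1) by blast
  qed
  then show "varX * f \<in> tdeg_le u" "varY * f \<in> tdeg_le u" by auto
qed

lemma varY_power_mult:
  assumes "f \<in> tdeg_le u"
  shows "varY ^ n * f \<in> tdeg_le (u + n) \<and> lead_form (u + n) (varY ^ n * f) = lead_form u f"
proof (induction n)
  case (Suc n)
  then show ?case using varY_mult[of "varY ^ n * f" "u + n"] by (simp add: mult.assoc)
qed (use assms in simp)

lemma degree_lead_form_le: "degree (lead_form u f) \<le> degree f"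
  by (rule degree_le) (auto simp: coeff_lead_form coeff_eq_0)

lemma tdeg_le_cofactor:
  fixes f g :: "'k::field poly poly"
  assumes "f \<in> tdeg_le u" "lead_form u f \<noteq> 0" "f * g \<in> tdeg_le T" "g \<noteq> 0"
  shows "u \<le> T" "g \<in> tdeg_le (T - u)"
proof -
  obtain v where v: "g \<in> tdeg_le v" "lead_form v g \<noteq> 0" by (rule ex_total_degree[OF assms(4)])
  have "lead_form (u + v) (f * g) \<noteq> 0"
    unfolding lead_form_mult[OF assms(1) v(1)] using v(2) assms(2) by simp
  then have "u + v \<le> T" using tdeg_le_lead_form_eq_0[OF assms(3)] not_le by blast
  then show "u \<le> T" "g \<in> tdeg_le (T - u)" using tdeg_le_mono[OF v(1)] by auto
qed

lemma degree_le_span_monom: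
  "degree p \<le> n \<Longrightarrow> (p :: 'k::field poly) \<in> upoly.span ((\<lambda>i. monom 1 i) ` {..n})"
proof -
  assume "degree p \<le> n"
  then have "(\<Sum>i\<le>n. smult (coeff p i) (monom 1 i)) = p"
    using poly_as_sum_of_monoms'[of p n] by (simp add: smult_monom)
  moreover have "(\<Sum>i\<le>n. smult (coeff p i) (monom 1 i)) \<in> upoly.span ((\<lambda>i. monom 1 i) ` {..n})"
    by (intro upoly.span_sum upoly.span_scale upoly.span_base) auto
  ultimately show ?thesis by simp
qed

lemma subspace_degree_le: "upoly.subspace {p :: 'k::field poly. degree p \<le> n}"
  by (auto simp: upoly.subspace_def intro: degree_add_le order_trans[OF degree_smult_le])

lemma inj_monom_1: "inj_on (\<lambda>i. monom (1::'k::field) i) A"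
  by (rule inj_onI) (metis degree_monom_eq one_neq_zero)

lemma dim_degree_le: "upoly.dim {p :: 'k::field poly. degree p \<le> n} = Suc n"
proof (rule upoly.dim_unique)
  let ?B = "(\<lambda>i. monom (1::'k) i) ` {..n}"
  show "?B \<subseteq> {p. degree p \<le> n}" by (auto intro: order_trans[OF degree_monom_le])
  show "{p. degree p \<le> n} \<subseteq> upoly.span ?B" using degree_le_span_monom by blast
  show "card ?B = Suc n" by (simp add: card_image inj_monom_1)
  show "upoly.independent ?B"
  proof (rule upoly.independent_if_scalars_zero)
    fix u :: "'k poly \<Rightarrow> 'k" and x
    assume s: "(\<Sum>x\<in>?B. smult (u x) x) = 0" and x: "x \<in> ?B"
    have "(\<Sum>i\<le>n. monom (u (monom 1 i)) i) = 0"
      using s by (simp add: sum.reindex inj_monom_1 smult_monom)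
    then have "coeff (\<Sum>i\<le>n. monom (u (monom 1 i)) i) j = 0" for j by simp
    then have "(if j \<le> n then u (monom 1 j) else 0) = 0" for j by (simp add: coeff_sum)
    then show "u x = 0" using x by (metis (no_types, lifting) atMost_iff imageE)
  qed simp
qed

section \<open>Primitive polynomials\<close>

definition Y_primitive :: "'k::comm_ring_1 poly poly \<Rightarrow> bool" where
  "Y_primitive F \<longleftrightarrow> (\<forall>a. \<not> [:[:- a, 1:]:] dvd F)"

lemma const_mult: "[:d:] * p = smult d p" by simp

lemma degree_linear_mult: "p \<noteq> 0 \<Longrightarrow> degree ([:- a, 1:] * p) = Suc (degree p)"
  for p :: "'k::idom poly"
  by (subst degree_mult_eq) auto

text \<open>Splitting off linear factors in \<open>Y\<close> lowers the degree of the leading coefficient.\<close>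

lemma ex_Y_primitive:
  fixes F :: "'k::field poly poly"
  assumes "F \<noteq> 0"
  shows "\<exists>c F0. c \<noteq> 0 \<and> F = smult c F0 \<and> Y_primitive F0"
  using assms
proof (induction "degree (lead_coeff F)" arbitrary: F rule: less_induct)
  case less
  show ?case
  proof (cases "Y_primitive F")
    case True
    then show ?thesis by (intro exI[of _ 1] exI[of _ F]) simp
  next
    case False
    then obtain a F' where F': "F = [:[:- a, 1:]:] * F'" unfolding Y_primitive_def by (auto elim: dvdE)
    then have nz: "F' \<noteq> 0" using less.prems by auto
    have "lead_coeff F = [:- a, 1:] * lead_coeff F'" unfolding F' by (simp add: lead_coeff_smult)
    then have "degree (lead_coeff F) = Suc (degree (lead_coeff F'))"
      using degree_linear_mult[of "lead_coeff F'" a] nz by (simp only: leading_coeff_0_iff not_False_eq_True)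
    then obtain c F0 where c: "c \<noteq> 0" "F' = smult c F0" "Y_primitive F0"
      using less.hyps[of F'] nz by auto
    have "F = smult ([:- a, 1:] * c) F0" unfolding F' c(2) const_mult smult_smult ..
    moreover have "[:- a, 1:] * c \<noteq> 0" using c(1) by (simp del: mult_pCons_left)
    ultimately show ?thesis using c(3) by blast
  qed
qed

text \<open>Gauss's lemma; over an algebraically closed field the primes of the coefficient ring
  \<open>k[Y]\<close> are linear, so that primitivity only has to be tested at the points of the line.\<close>

lemma Y_primitive_dvd:
  fixes F f :: "'k::alg_closed_field poly poly"
  assumes "Y_primitive F" "c \<noteq> 0" "F dvd smult c f"
  shows "F dvd f"
  using assms(2,3)
proof (induction "degree c" arbitrary: c rule: less_induct)
  case less
  show ?case
  proof (cases "degree c = 0")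
    case True
    then obtain b where b: "c = [:b:]" by (auto elim: degree_eq_zeroE)
    then have "f = smult [:inverse b:] (smult c f)"
      using less.prems(1) by (simp add: smult_smult flip: one_pCons)
    then show ?thesis using less.prems(2) dvd_smult by metis
  next
    case False
    then obtain a where "poly c a = 0" using alg_closed_imp_poly_has_root[of c] by auto
    then obtain c' where c': "c = [:- a, 1:] * c'" by (auto simp: poly_eq_0_iff_dvd elim: dvdE)
    then have nz: "c' \<noteq> 0" using less.prems by auto
    have deg: "degree c' < degree c" unfolding c' degree_linear_mult[OF nz] by simp
    obtain q where q: "smult c f = F * q" using less.prems(2) by (elim dvdE)
    have pr: "prime_elem [:[:- a, 1:]:]" by (intro lift_prime_elem_poly prime_elem_linear_field_poly) simp
    have e: "[:[:- a, 1:]:] * smult c' f = F * q" using q unfolding c' by (simp add: smult_smult)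
    then have "[:[:- a, 1:]:] dvd F * q" by (metis dvd_triv_left)
    then have "[:[:- a, 1:]:] dvd q"
      using prime_elem_dvd_mult_iff[OF pr] assms(1) unfolding Y_primitive_def by blast
    then obtain q' where "q = [:[:- a, 1:]:] * q'" by (elim dvdE)
    then have "[:[:- a, 1:]:] * smult c' f = [:[:- a, 1:]:] * (F * q')" using e by (simp add: mult_ac)
    moreover have "[:[:- a, 1:]:] \<noteq> (0 :: 'k poly poly)" by simp
    ultimately have "smult c' f = F * q'" using mult_left_cancel by blast
    then show ?thesis using less.hyps[OF deg nz] by simp
  qed
qed

section \<open>Ideals with flat growth\<close>

text \<open>A theorem of Davis.  If the leading forms of an ideal \<open>I\<close> have the same codimension \<open>c\<close> in the
  degrees \<open>T\<close> and \<open>T + 1\<close>, then the members of \<open>I\<close> of degree at most \<open>T\<close> share a factor \<open>F\<close> of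
  degree \<open>c\<close>.  Their leading forms of degree \<open>T\<close> are the multiples of some \<open>G\<close> of degree \<open>c\<close>, but
  \<open>G\<close> itself need not be the leading form of a member of \<open>I\<close>, so that \<open>F\<close> has to be found
  otherwise.  The \<open>k[Y]\<close>-module generated by these members consists of polynomials of degree at most
  \<open>T\<close> in \<open>X\<close> and admits multiplication by \<open>X\<close> as long as this bound is respected.  Hence
  pseudo-division makes a member of least degree in \<open>X\<close> divide all others up to factors from
  \<open>k[Y]\<close>, and Gauss's lemma removes these factors.  The polynomial \<open>h\<close> of full degree in \<open>X\<close> says
  that the point at infinity of the \<open>X\<close>-axis is not a zero of \<open>G\<close>; this makes degrees in \<open>X\<close> and
  total degrees agree.\<close>

locale flat_growth =
  fixes I :: "'k::alg_closed_field poly poly set" and T :: nat and h :: "'k poly poly"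
  assumes ideal: "ideal.subspace I"
    and h: "h \<in> I" "h \<in> tdeg_le T" "coeff (lead_form T h) T \<noteq> 0"
    and growth: "upoly.dim (lead_form (Suc T) ` (I \<inter> tdeg_le (Suc T))) =
      Suc (upoly.dim (lead_form T ` (I \<inter> tdeg_le T)))"
begin

abbreviation "V u \<equiv> lead_form u ` (I \<inter> tdeg_le u)"

lemmas add_I = ideal.subspace_add[OF ideal]
  and diff_I = ideal.subspace_diff[OF ideal]
  and mult_I = ideal.subspace_scale[OF ideal]
  and zero_I = ideal.subspace_0[OF ideal]

lemma smult_I: "f \<in> I \<Longrightarrow> smult c f \<in> I"
  using mult_I[of f "[:c:]"] by simp

lemma subspace_V: "upoly.subspace (V u)"
proof -
  interpret l: Vector_Spaces.linear "\<lambda>c. smult [:c:]" smult "lead_form u :: 'k poly poly \<Rightarrow> 'k poly"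
    by (rule linear_lead_form)
  have "bpoly.subspace I" by (auto simp: bpoly.subspace_def zero_I add_I smult_I)
  then show ?thesis using l.subspace_image bpoly.subspace_inter subspace_tdeg_le by blast
qed

lemma V_degree: "v \<in> V u \<Longrightarrow> degree v \<le> u"
  using degree_lead_form by blast

text \<open>The flat growth leaves room in degree \<open>Suc T\<close> only for \<open>Y\<close> times the leading forms of
  degree \<open>T\<close> and for one form of full degree in \<open>X\<close>.\<close>

lemma V_Suc_low:
  assumes "q \<in> V (Suc T)" "degree q \<le> T"
  shows "q \<in> V T"
proof (rule ccontr)
  assume q: "q \<notin> V T"
  have fin: "finite B" if "B \<subseteq> V u" "upoly.independent B" for B u
  proof -
    have "B \<subseteq> upoly.span ((\<lambda>i. monom 1 i) ` {..u})"
      using that(1) V_degree degree_le_span_monom by blast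
    then show ?thesis using upoly.independent_span_bound[OF _ that(2)] by blast
  qed
  obtain B where B: "B \<subseteq> V T" "upoly.independent B" "V T \<subseteq> upoly.span B" "card B = upoly.dim (V T)"
    by (rule upoly.basis_exists[of "V T"])
  have sp: "upoly.span B = V T" using B(1,3) upoly.span_minimal[OF _ subspace_V] by blast
  obtain B' where B': "B' \<subseteq> V (Suc T)" "upoly.independent B'" "V (Suc T) \<subseteq> upoly.span B'"
    "card B' = upoly.dim (V (Suc T))"
    by (rule upoly.basis_exists[of "V (Suc T)"])
  define r where "r = lead_form (Suc T) (varX * h)"
  have r: "r \<in> V (Suc T)" unfolding r_def using varX_mult(1)[OF h(2)] mult_I[OF h(1)] by blast
  have cr: "coeff r (Suc T) \<noteq> 0" unfolding r_def varX_mult(2)[OF h(2)] using h(3) by simp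
  have "insert q B \<subseteq> {p. degree p \<le> T}" using assms(2) B(1) V_degree by blast
  then have "upoly.span (insert q B) \<subseteq> {p. degree p \<le> T}"
    by (rule upoly.span_minimal) (rule subspace_degree_le)
  then have rn: "r \<notin> upoly.span (insert q B)" using cr by (auto simp: coeff_eq_0)
  \<comment> \<open>With \<open>q\<close> and \<open>r\<close>, a basis of \<open>V T\<close> grows by two elements: one too many.\<close>
  have ind: "upoly.independent (insert r (insert q B))"
    using q sp rn B(2) by (intro upoly.independent_insertI) auto
  \<comment> \<open>Multiplication by \<open>Y\<close> does not change a leading form.\<close>
  have VV: "V T \<subseteq> V (Suc T)"
  proof
    fix v assume "v \<in> V T"
    then obtain f where f: "f \<in> I" "f \<in> tdeg_le T" "v = lead_form T f" by blast
    then have "v = lead_form (Suc T) (varY * f)" using varY_mult(2) by metis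
    then show "v \<in> V (Suc T)" using varY_mult(1)[OF f(2)] mult_I[OF f(1)] by blast
  qed
  have "insert r (insert q B) \<subseteq> upoly.span B'"
    using r assms(1) B(1) VV B'(3) by blast
  then have "card (insert r (insert q B)) \<le> card B'"
    using upoly.independent_span_bound[OF fin[OF B'(1,2)] ind] by blast
  moreover have "q \<notin> B" "r \<notin> insert q B" using q rn B(1) upoly.span_base by blast+
  moreover have "finite B" by (rule fin[OF B(1,2)])
  ultimately show False using B(4) B'(4) growth by simp
qed

lemma V_shift: "v \<in> V T \<Longrightarrow> degree v < T \<Longrightarrow> [:0, 1:] * v \<in> V T"
proof -
  assume v: "v \<in> V T" "degree v < T"
  then obtain f where f: "f \<in> I" "f \<in> tdeg_le T" "v = lead_form T f" by blast
  have "[:0, 1:] * v = lead_form (Suc T) (varX * f)" using varX_mult(2)[OF f(2)] f(3) by simp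
  then have "[:0, 1:] * v \<in> V (Suc T)" using varX_mult(1)[OF f(2)] mult_I[OF f(1)] by blast
  moreover have "degree ([:0, 1:] * v) \<le> T" using v(2) degree_mult_le[of "[:0, 1:]" v] by simp
  ultimately show ?thesis by (rule V_Suc_low)
qed

text \<open>By the previous lemma the leading forms are closed under multiplication by the variable, as far
  as degrees permit.  Division with remainder then shows that a member \<open>G\<close> of least degree divides
  all the others.\<close>

lemma V_principal:
  obtains G where "G \<noteq> 0" "degree G \<le> T" "V T = (\<lambda>q. q * G) ` {q. degree q \<le> T - degree G}"
    "upoly.dim (V T) = Suc (T - degree G)"
proof -
  have nz: "lead_form T h \<in> V T - {0}" using h by auto
  define G where "G = arg_min degree (\<lambda>v. v \<in> V T - {0})"
  have G: "G \<in> V T" "G \<noteq> 0" and Gmin: "\<And>v. v \<in> V T \<Longrightarrow> v \<noteq> 0 \<Longrightarrow> degree G \<le> degree v"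
    using arg_min_nat_lemma[of "\<lambda>v. v \<in> V T - {0}", OF nz, of degree] unfolding G_def by auto
  have dG: "degree G \<le> T" using G V_degree by blast
  have mult: "q * G \<in> V T" if "degree q \<le> T - degree G" for q
    using that
  proof (induction q)
    case 0
    then show ?case using upoly.subspace_0[OF subspace_V] by simp
  next
    case (pCons a q)
    show ?case
    proof (cases "q = 0")
      case True
      then show ?thesis using upoly.subspace_scale[OF subspace_V G(1)] by simp
    next
      case False
      then have "degree (q * G) < T" using pCons.prems G(2) dG by (simp add: degree_mult_eq)
      moreover have "q * G \<in> V T" using pCons False by simp
      ultimately have "[:0, 1:] * (q * G) \<in> V T" by (intro V_shift)
      then have "smult a G + [:0, 1:] * (q * G) \<in> V T"
        using upoly.subspace_add[OF subspace_V] upoly.subspace_scale[OF subspace_V G(1)] by blast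
      then show ?thesis by simp
    qed
  qed
  have div: "\<exists>q. v = q * G \<and> degree q \<le> T - degree G" if v: "v \<in> V T" for v
  proof (cases "v = 0")
    case True
    then show ?thesis by (intro exI[of _ 0]) simp
  next
    case False
    have dq: "degree (v div G) \<le> T - degree G"
    proof (cases "v div G = 0")
      case nz: False
      have "degree (v mod G) \<le> T"
        using degree_mod_less[OF G(2), of v] dG by (metis degree_0 le_trans nat_less_le zero_le)
      then have "degree (v - v mod G) \<le> T" using V_degree[OF v] by (intro degree_diff_le)
      moreover have "v - v mod G = v div G * G" by (simp add: minus_mod_eq_div_mult)
      ultimately show ?thesis using nz G(2) by (simp add: degree_mult_eq)
    qed simp
    have "v mod G = v - v div G * G" by (simp add: minus_div_mult_eq_mod)
    then have "v mod G \<in> V T" using upoly.subspace_diff[OF subspace_V v mult[OF dq]] by simp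
    then have "v mod G = 0" using Gmin degree_mod_less[OF G(2), of v] by (meson not_le)
    then show ?thesis using dq by (intro exI[of _ "v div G"]) (simp add: mod_eq_0_iff_dvd)
  qed
  have VG: "V T = (\<lambda>q. q * G) ` {q. degree q \<le> T - degree G}"
    using mult div by (auto simp del: mult_eq_0_iff)
  interpret pr: vector_space_pair "smult :: 'k \<Rightarrow> 'k poly \<Rightarrow> 'k poly" "smult :: 'k \<Rightarrow> 'k poly \<Rightarrow> 'k poly"
    by unfold_locales
  have "upoly.dim ((\<lambda>q. q * G) ` {q. degree q \<le> T - degree G}) = upoly.dim {q::'k poly. degree q \<le> T - degree G}"
  proof (rule pr.dim_injective_image)
    show "Vector_Spaces.linear smult smult (\<lambda>q. q * G)"
      unfolding Vector_Spaces.linear_iff by (simp add: distrib_right upoly.vector_space_axioms)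
  qed (use G(2) subspace_degree_le in auto)
  then show ?thesis using that[OF G(2) dG VG] VG dim_degree_le by metis
qed

text \<open>The \<open>k[Y]\<close>-module generated by the members of \<open>I\<close> of degree at most \<open>T\<close>, filtered by the
  power of \<open>Y\<close> that is used.\<close>

primrec layer :: "nat \<Rightarrow> 'k poly poly set" where
  "layer 0 = I \<inter> tdeg_le T"
| "layer (Suc j) = {varY * f + a | f a. f \<in> layer j \<and> a \<in> I \<inter> tdeg_le T}"

lemma layer_0: "0 \<in> layer j"
proof (induction j)
  case (Suc j)
  have "varY * 0 + 0 \<in> layer (Suc j)" unfolding layer.simps using Suc zero_I tdeg_le_0 by blast
  then show ?case by simp
qed (simp add: zero_I)

lemma layer_SucI: "f \<in> layer j \<Longrightarrow> a \<in> I \<Longrightarrow> a \<in> tdeg_le T \<Longrightarrow> varY * f + a \<in> layer (Suc j)"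
  by auto

lemma layer_SucE:
  assumes "f \<in> layer (Suc j)"
  obtains g a where "f = varY * g + a" "g \<in> layer j" "a \<in> I" "a \<in> tdeg_le T"
  using assms by auto

declare layer.simps(2) [simp del]

lemma layer_add: "f \<in> layer j \<Longrightarrow> g \<in> layer j \<Longrightarrow> f + g \<in> layer j"
proof (induction j arbitrary: f g)
  case (Suc j)
  obtain f' a where f: "f = varY * f' + a" "f' \<in> layer j" "a \<in> I" "a \<in> tdeg_le T"
    by (rule layer_SucE[OF Suc.prems(1)])
  obtain g' b where g: "g = varY * g' + b" "g' \<in> layer j" "b \<in> I" "b \<in> tdeg_le T"
    by (rule layer_SucE[OF Suc.prems(2)])
  have "varY * (f' + g') + (a + b) \<in> layer (Suc j)"
    using f g Suc.IH by (intro layer_SucI add_I tdeg_le_add)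
  moreover have "varY * (f' + g') + (a + b) = f + g" unfolding f(1) g(1) by (simp only: algebra_simps)
  ultimately show ?case by simp
qed (simp add: add_I tdeg_le_add)

lemma layer_const: "f \<in> layer j \<Longrightarrow> smult [:c:] f \<in> layer j"
proof (induction j arbitrary: f)
  case 0
  then show ?case by (auto intro: bpoly.subspace_scale[OF subspace_tdeg_le] smult_I)
next
  case (Suc j)
  obtain f' a where f: "f = varY * f' + a" "f' \<in> layer j" "a \<in> I" "a \<in> tdeg_le T"
    by (rule layer_SucE[OF Suc.prems])
  have "varY * smult [:c:] f' + smult [:c:] a \<in> layer (Suc j)"
    using f Suc.IH by (intro layer_SucI smult_I bpoly.subspace_scale[OF subspace_tdeg_le])
  moreover have "varY * smult [:c:] f' + smult [:c:] a = smult [:c:] f"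
    unfolding f(1) by (simp only: smult_add_right mult_smult_right)
  ultimately show ?case by simp
qed

lemma layer_Suc_mono: "layer j \<subseteq> layer (Suc j)"
proof (induction j)
  case 0
  show ?case
  proof
    fix f assume "f \<in> layer 0"
    then have "varY * 0 + f \<in> layer (Suc 0)" by (intro layer_SucI layer_0) auto
    then show "f \<in> layer (Suc 0)" by simp
  qed
next
  case (Suc j)
  show ?case
  proof
    fix f assume "f \<in> layer (Suc j)"
    then obtain g a where "f = varY * g + a" "g \<in> layer j" "a \<in> I" "a \<in> tdeg_le T"
      by (rule layer_SucE)
    then show "f \<in> layer (Suc (Suc j))" using Suc layer_SucI by blast
  qed
qed

lemma layer_mono: "j \<le> k \<Longrightarrow> layer j \<subseteq> layer k"
  by (rule lift_Suc_mono_le[of layer]) (rule layer_Suc_mono)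

lemma layer_lead:
  "f \<in> layer j \<Longrightarrow> f \<in> tdeg_le (T + j) \<and> lead_form (T + j) f \<in> V T"
proof (induction j arbitrary: f)
  case (Suc j)
  obtain f' a where f: "f = varY * f' + a" "f' \<in> layer j" "a \<in> I" "a \<in> tdeg_le T"
    by (rule layer_SucE[OF Suc.prems])
  have f': "f' \<in> tdeg_le (T + j)" "lead_form (T + j) f' \<in> V T" using Suc.IH f(2) by auto
  have "lead_form (T + Suc j) a = 0" by (rule tdeg_le_lead_form_eq_0[OF f(4)]) simp
  then show ?case using f' varY_mult[OF f'(1)] tdeg_le_mono[OF f(4), of "Suc (T + j)"]
    by (simp add: f(1) lead_form_add tdeg_le_add del: mult_pCons_left)
qed auto

text \<open>A combination with \<open>Y\<close>-powers whose leading form cancels can do with one power less: \<open>Y\<close> times a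
  member of \<open>I\<close> of degree below \<open>T\<close> is again a member of degree at most \<open>T\<close>.\<close>

lemma layer_lead_eq_0: "f \<in> layer (Suc j) \<Longrightarrow> lead_form (T + Suc j) f = 0 \<Longrightarrow> f \<in> layer j"
proof (induction j arbitrary: f)
  case (0 f)
  obtain f' a where f: "f = varY * f' + a" "f' \<in> layer 0" "a \<in> I" "a \<in> tdeg_le T"
    by (rule layer_SucE[OF "0.prems"(1)])
  have "lead_form (T + Suc 0) a = 0" by (rule tdeg_le_lead_form_eq_0[OF f(4)]) simp
  then have "lead_form T f' = 0"
    using 0 varY_mult(2)[of f' T] f(2) by (simp add: f(1) lead_form_add del: mult_pCons_left)
  then have "varY * f' \<in> tdeg_le T" using lead_form_zero_mult(2)[of f' T] f(2) by simp
  then show ?case using f add_I mult_I tdeg_le_add[of "varY * f'" T a]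
    by (simp del: mult_pCons_left)
next
  case (Suc j f)
  obtain f' a where f: "f = varY * f' + a" "f' \<in> layer (Suc j)" "a \<in> I" "a \<in> tdeg_le T"
    by (rule layer_SucE[OF Suc.prems(1)])
  have "lead_form (T + Suc (Suc j)) a = 0" by (rule tdeg_le_lead_form_eq_0[OF f(4)]) simp
  then have "lead_form (T + Suc j) f' = 0"
    using Suc.prems varY_mult(2)[of f' "T + Suc j"] layer_lead[OF f(2)]
    by (simp add: f(1) lead_form_add del: mult_pCons_left)
  then have "f' \<in> layer j" using Suc.IH f(2) by blast
  then show ?case unfolding f(1) using f(3,4) by (rule layer_SucI)
qed

lemma layer_smult: "f \<in> layer j \<Longrightarrow> \<exists>k. smult c f \<in> layer k"
proof (induction c)
  case 0
  then show ?case using layer_0 by auto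
next
  case (pCons a c)
  then obtain k where k: "smult c f \<in> layer k" by blast
  have "varY * smult c f + 0 \<in> layer (Suc k)" by (rule layer_SucI[OF k zero_I tdeg_le_0])
  moreover have "smult [:a:] f \<in> layer j" by (rule layer_const[OF pCons.prems])
  ultimately have "smult [:a:] f + (varY * smult c f + 0) \<in> layer (max j (Suc k))"
    by - (rule layer_add; (erule subsetD[OF layer_mono, rotated], simp))
  moreover have "smult [:a:] f + (varY * smult c f + 0) = smult (pCons a c) f"
    by (simp add: smult_smult flip: smult_add_left)
  ultimately show ?case by metis
qed

lemma layer_degree: "f \<in> layer j \<Longrightarrow> degree f \<le> T"
proof (induction j arbitrary: f)
  case (Suc j)
  obtain f' a where f: "f = varY * f' + a" "f' \<in> layer j" "a \<in> I" "a \<in> tdeg_le T"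
    by (rule layer_SucE[OF Suc.prems])
  have "degree (varY * f') \<le> T"
    using Suc.IH[OF f(2)] by (simp add: order_trans[OF degree_smult_le])
  then show ?case unfolding f(1) using tdeg_le_degree[OF f(4)] by (intro degree_add_le)
qed (simp add: tdeg_le_degree)

text \<open>The leading form of \<open>varX * f\<close> has degree at most \<open>T\<close> in \<open>X\<close>, so it agrees with that of \<open>Y\<close> times
  some member of degree at most \<open>T\<close>; the difference is itself such a member.\<close>

lemma varX_layer_0: "f \<in> layer 0 \<Longrightarrow> coeff f T = 0 \<Longrightarrow> varX * f \<in> layer (Suc 0)"
proof -
  assume 0: "f \<in> layer 0" "coeff f T = 0"
  then have f: "f \<in> I" "f \<in> tdeg_le T" by auto
  have "coeff (lead_form T f) T = 0" using 0 by (simp add: coeff_lead_form)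
  then have "coeff (lead_form T f) n = 0" if "T \<le> n" for n
    using that by (cases "n = T") (simp_all add: coeff_lead_form)
  then have "degree ([:0, 1:] * lead_form T f) \<le> T"
    by (intro degree_le) (auto simp: coeff_pCons split: nat.splits)
  then have "degree (lead_form (Suc T) (varX * f)) \<le> T" unfolding varX_mult(2)[OF f(2)] .
  moreover have "lead_form (Suc T) (varX * f) \<in> V (Suc T)"
    by (intro imageI IntI mult_I varX_mult(1) f)
  ultimately have "lead_form (Suc T) (varX * f) \<in> V T" by (intro V_Suc_low)
  then obtain b where b: "b \<in> I" "b \<in> tdeg_le T" "lead_form (Suc T) (varX * f) = lead_form T b"
    by (elim imageE IntE)
  let ?a = "varX * f - varY * b"
  have "lead_form (Suc T) ?a = 0" unfolding lead_form_diff varY_mult(2)[OF b(2)] b(3) by simp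
  moreover have "?a \<in> tdeg_le (Suc T)"
    by (intro tdeg_le_diff varX_mult(1) varY_mult(1) f(2) b(2))
  ultimately have "?a \<in> tdeg_le T" by (rule lead_form_zero_tdeg[rotated])
  moreover have "?a \<in> I" by (intro diff_I mult_I f(1) b(1))
  ultimately have "varY * b + ?a \<in> layer (Suc 0)" using b by (intro layer_SucI) auto
  moreover have "varY * b + ?a = varX * f" by (simp only: algebra_simps)
  ultimately show ?thesis by simp
qed

lemma layer_varX: "f \<in> layer j \<Longrightarrow> coeff f T = 0 \<Longrightarrow> varX * f \<in> layer (Suc j)"
proof (induction j arbitrary: f)
  case 0
  then show ?case by (rule varX_layer_0)
next
  case (Suc j f)
  obtain f' a where f: "f = varY * f' + a" "f' \<in> layer j" "a \<in> I" "a \<in> tdeg_le T"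
    by (rule layer_SucE[OF Suc.prems(1)])
  have c0: "[:0, 1:] * coeff f' T + coeff a T = 0" using Suc.prems(2) unfolding f(1) by simp
  have ca: "coeff (coeff a T) (Suc n) = 0" for n using tdeg_leD[OF f(4), of T "Suc n"] by simp
  have "coeff (coeff a T) 0 = 0" using arg_cong[OF c0, of "\<lambda>p. coeff p 0"] by simp
  then have a0: "coeff a T = 0" using ca by (intro poly_eqI) (metis coeff_0 not0_implies_Suc)
  then have "coeff f' T = 0" using c0 by simp
  then have 1: "varX * f' \<in> layer (Suc j)" using Suc.IH f(2) by blast
  have "varX * a \<in> layer (Suc 0)"
  proof -
    have "a \<in> layer 0" using f by simp
    then show ?thesis using Suc.prems(1) a0 varX_layer_0 by blast
  qed
  then obtain b a' where b: "varX * a = varY * b + a'" "b \<in> layer 0" "a' \<in> I" "a' \<in> tdeg_le T"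
    by (rule layer_SucE)
  have "b \<in> layer (Suc j)" using b(2) layer_mono[of 0 "Suc j"] by auto
  then have "varY * (varX * f' + b) + a' \<in> layer (Suc (Suc j))"
    using 1 b by (intro layer_SucI layer_add)
  moreover have "varY * (varX * f' + b) + a' = varX * f"
    unfolding f(1) using b(1) by (simp only: algebra_simps)
  ultimately show ?case by simp
qed

text \<open>In the least layer that contains \<open>f\<close>, the leading form of \<open>f\<close> does not vanish and lies in \<open>V T\<close>.
  In layer 0 the total degree of \<open>f\<close> may be less than \<open>T\<close>, for which a power of \<open>Y\<close> makes up.\<close>

lemma layer_degree_ge:
  assumes f: "f \<in> layer k" "f \<noteq> 0"
    and G: "\<And>v. v \<in> V T \<Longrightarrow> v \<noteq> 0 \<Longrightarrow> c \<le> degree v"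
  shows "c \<le> degree f"
proof -
  define j where "j = (LEAST j. f \<in> layer j)"
  have j: "f \<in> layer j" unfolding j_def by (rule LeastI) (rule f)
  have "\<exists>u. lead_form u f \<noteq> 0 \<and> lead_form u f \<in> V T"
  proof (cases j)
    case 0
    then have fI: "f \<in> I" "f \<in> tdeg_le T" using j by auto
    obtain u where u: "f \<in> tdeg_le u" "lead_form u f \<noteq> 0" by (rule ex_total_degree[OF f(2)])
    have "u \<le> T" using tdeg_le_lead_form_eq_0[OF fI(2)] u(2) not_le by blast
    then have "varY ^ (T - u) * f \<in> tdeg_le T" "lead_form T (varY ^ (T - u) * f) = lead_form u f"
      using varY_power_mult[OF u(1), of "T - u"] by auto
    moreover have "varY ^ (T - u) * f \<in> I" by (rule mult_I[OF fI(1)])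
    ultimately have "lead_form u f \<in> V T" by (metis IntI imageI)
    with u(2) show ?thesis by blast
  next
    case (Suc i)
    have "lead_form (T + j) f \<noteq> 0"
    proof
      assume "lead_form (T + j) f = 0"
      then have "f \<in> layer i" using layer_lead_eq_0 j unfolding Suc by blast
      then have "j \<le> i" unfolding j_def by (rule Least_le)
      then show False using Suc by simp
    qed
    then show ?thesis using layer_lead[OF j] by blast
  qed
  then show ?thesis using G degree_lead_form_le order_trans by blast
qed

text \<open>Pseudo-division by a member of least degree in \<open>X\<close> of the \<open>k[Y]\<close>-module that the members of \<open>I\<close>
  of degree at most \<open>T\<close> generate, followed by Gauss's lemma.\<close>

lemma ex_common_factor:
  assumes G: "\<And>v. v \<in> V T \<Longrightarrow> v \<noteq> 0 \<Longrightarrow> c \<le> degree v"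
  obtains F where "F \<noteq> 0" "\<And>f. f \<in> I \<Longrightarrow> f \<in> tdeg_le T \<Longrightarrow> F dvd f" "c \<le> degree F"
proof -
  define N where "N = (\<Union>j. layer j)"
  have add: "f + g \<in> N" if fg: "f \<in> N" "g \<in> N" for f g
  proof -
    obtain i j where "f \<in> layer i" "g \<in> layer j" using fg unfolding N_def by blast
    then have "f \<in> layer (max i j)" "g \<in> layer (max i j)"
      using layer_mono[of i "max i j"] layer_mono[of j "max i j"] by auto
    then show ?thesis unfolding N_def using layer_add by blast
  qed
  have scale: "smult a f \<in> N" if "f \<in> N" for a f
    using that layer_smult unfolding N_def by blast
  have degN: "degree f \<le> T" if "f \<in> N" for f
    using that layer_degree unfolding N_def by blast
  have "h \<in> N" unfolding N_def using h(1,2) by (auto intro: exI[of _ 0])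
  moreover have "h \<noteq> 0" using h(3) by auto
  ultimately have nz: "h \<in> N - {0}" by simp
  define F where "F = arg_min degree (\<lambda>f. f \<in> N - {0})"
  have F: "F \<in> N" "F \<noteq> 0" and Fmin: "\<And>f. f \<in> N \<Longrightarrow> f \<noteq> 0 \<Longrightarrow> degree F \<le> degree f"
    using arg_min_nat_lemma[of "\<lambda>v. v \<in> N - {0}", OF nz, of degree] unfolding F_def by auto
  have shift: "monom 1 i * F \<in> N" if "i \<le> T - degree F" for i
    using that
  proof (induction i)
    case (Suc i)
    then have m: "monom 1 i * F \<in> N" by simp
    have "degree (monom 1 i * F) = i + degree F"
      using F(2) by (simp add: degree_mult_eq degree_monom_eq monom_eq_0_iff)
    then have "coeff (monom 1 i * F) T = 0" using Suc.prems by (intro coeff_eq_0) simp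
    then have "varX * (monom 1 i * F) \<in> N" using m layer_varX unfolding N_def by blast
    moreover have "varX * (monom 1 i * F) = monom 1 (Suc i) * F"
      by (simp add: monom_Suc del: mult_pCons_left) (simp add: mult.assoc[symmetric])
    ultimately show ?case by simp
  qed (use F in simp)
  have pseudo: "\<exists>a q. a \<noteq> 0 \<and> smult a f = F * q" if "f \<in> N" for f
    using that
  proof (induction "degree f" arbitrary: f rule: less_induct)
    case less
    show ?case
    proof (cases "f = 0")
      case True
      then show ?thesis by (intro exI[of _ 1] exI[of _ 0]) simp
    next
      case False
      define n where "n = degree f - degree F"
      have n: "n + degree F = degree f" using Fmin[OF less.prems False] by (simp add: n_def)
      let ?g = "monom 1 n * F"
      define f' where "f' = smult (lead_coeff F) f + smult (- lead_coeff f) ?g"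
      have "?g \<in> N" using shift degN[OF less.prems] n by simp
      then have f'N: "f' \<in> N" unfolding f'_def by (intro add scale less.prems)
      have dg: "degree ?g = degree f"
        using F(2) n by (simp add: degree_mult_eq degree_monom_eq monom_eq_0_iff)
      have lg: "coeff ?g (degree f) = lead_coeff F"
        by (simp add: coeff_monom_mult flip: n)
      have "degree f' \<le> degree f"
        unfolding f'_def using dg by (intro degree_add_le order_trans[OF degree_smult_le]) auto
      moreover have "coeff f' (degree f) = 0" unfolding f'_def using lg by simp
      ultimately have "f' = 0 \<or> degree f' < degree f" by (rule eq_zero_or_degree_less)
      then obtain a q where aq: "a \<noteq> 0" "smult a f' = F * q"
      proof
        assume "f' = 0"
        then show ?thesis using that[of 1 0] by simp
      next
        assume "degree f' < degree f"
        then show ?thesis using less.hyps f'N that by blast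
      qed
      have "smult (a * lead_coeff F) f = smult a f' + smult (a * lead_coeff f) ?g"
        unfolding f'_def by (simp add: smult_add_right smult_diff_right)
      also have "\<dots> = F * (q + smult (a * lead_coeff f) (monom 1 n))"
        unfolding aq(2) by (simp add: algebra_simps)
      finally show ?thesis using aq(1) F(2) by (intro exI[of _ "a * lead_coeff F"]) auto
    qed
  qed
  obtain b F0 where F0: "b \<noteq> 0" "F = smult b F0" "Y_primitive F0" using ex_Y_primitive[OF F(2)] by blast
  show ?thesis
  proof (rule that[of F0])
    show "F0 \<noteq> 0" using F(2) F0(2) by auto
    have "c \<le> degree F" using F layer_degree_ge[OF _ _ G] unfolding N_def by blast
    then show "c \<le> degree F0" unfolding F0(2) using F0(1) by simp
    fix f assume f: "f \<in> I" "f \<in> tdeg_le T"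
    then have "f \<in> layer 0" by simp
    then have "f \<in> N" unfolding N_def by blast
    then obtain a q where a: "a \<noteq> 0" "smult a f = F * q" using pseudo by blast
    have "F0 dvd smult a f" unfolding a(2) F0(2) by (simp add: dvd_smult)
    then show "F0 dvd f" by (rule Y_primitive_dvd[OF F0(3) a(1)])
  qed
qed

text \<open>The common factor \<open>F\<close> has degree \<open>c\<close>, and its leading form generates \<open>V T\<close>.  So the residual ideal
  \<open>{w. F * w \<in> I}\<close> has all forms of degree \<open>T - c\<close> as leading forms, which reduces every cofactor
  \<open>w\<close> to degree at most \<open>T - c\<close>.\<close>

lemma multiples_low_degree:
  obtains F where "F \<noteq> 0" "F \<in> tdeg_le (Suc T - upoly.dim (V T))"
    "\<And>w. \<exists>r\<in>tdeg_le T. F * w - r \<in> I"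
proof -
  obtain G where G: "G \<noteq> 0" "degree G \<le> T" "V T = (\<lambda>q. q * G) ` {q. degree q \<le> T - degree G}"
    "upoly.dim (V T) = Suc (T - degree G)" by (rule V_principal)
  define c where "c = degree G"
  define m where "m = T - c"
  have cm: "c + m = T" using G(2) by (simp add: c_def m_def)
  have c: "Suc T - upoly.dim (V T) = c" using G(2,4) by (simp add: c_def)
  have minG: "c \<le> degree v" if "v \<in> V T" "v \<noteq> 0" for v
    using that G(1) unfolding G(3) c_def by (auto simp: degree_mult_eq)
  obtain F where F: "F \<noteq> 0" "\<And>f. f \<in> I \<Longrightarrow> f \<in> tdeg_le T \<Longrightarrow> F dvd f" "c \<le> degree F"
    by (rule ex_common_factor[of c, OF minG]) blast+
  obtain u where u: "F \<in> tdeg_le u" "lead_form u F \<noteq> 0" by (rule ex_total_degree[OF F(1)])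
  have lead: "\<exists>w. f = F * w \<and> w \<in> tdeg_le (T - u) \<and> u \<le> T \<and>
      lead_form T f = lead_form u F * lead_form (T - u) w"
    if f: "f \<in> I" "f \<in> tdeg_le T" "f \<noteq> 0" for f
  proof -
    obtain w where w: "f = F * w" using F(2)[OF f(1,2)] by (elim dvdE)
    have "w \<noteq> 0" using f(3) w by auto
    then have uT: "u \<le> T" "w \<in> tdeg_le (T - u)"
      using tdeg_le_cofactor[OF u] f(2) unfolding w by blast+
    then show ?thesis using lead_form_mult[OF u(1) uT(2)] w by (intro exI[of _ w]) simp
  qed
  have h0: "h \<noteq> 0" using h(3) by auto
  obtain w0 where w0: "w0 \<in> tdeg_le (T - u)" "u \<le> T"
    "lead_form T h = lead_form u F * lead_form (T - u) w0" using lead[OF h(1,2) h0] by blast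
  have "lead_form T h \<noteq> 0" using h(3) by auto
  then have "degree (lead_form T h) = degree (lead_form u F) + degree (lead_form (T - u) w0)"
    unfolding w0(3) by (intro degree_mult_eq) auto
  moreover have "T \<le> degree (lead_form T h)" using h(3) by (rule le_degree)
  ultimately have du: "degree (lead_form u F) = u"
    using degree_lead_form[of u F] degree_lead_form[of "T - u" w0] w0(2) by linarith
  have "G \<in> V T" unfolding G(3) by (intro image_eqI[of _ _ 1]) auto
  then obtain g where g: "g \<in> I" "g \<in> tdeg_le T" "G = lead_form T g" by blast
  then have "g \<noteq> 0" using G(1) by auto
  then obtain w1 where w1: "G = lead_form u F * lead_form (T - u) w1" using lead g by blast
  have dG: "c = u + degree (lead_form (T - u) w1)"
    unfolding c_def using G(1) du unfolding w1 by (subst degree_mult_eq) auto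
  \<comment> \<open>\<open>F\<close> has degree at least \<open>c\<close> already in \<open>X\<close>.\<close>
  then have uc: "u = c" using F(3) tdeg_le_degree[OF u(1)] by linarith
  have "degree (lead_form (T - u) w1) = 0" using dG uc by simp
  then obtain r where r: "lead_form (T - u) w1 = [:r:]" by (auto elim: degree_eq_zeroE)
  have r0: "r \<noteq> 0" using w1 r G(1) by auto
  have GF: "G = smult r (lead_form c F)" using w1 r unfolding uc by simp
  have Fc: "F \<in> tdeg_le c" using u(1) uc by simp
  define C where "C = {w. F * w \<in> I}"
  have C_add: "w + w' \<in> C" if "w \<in> C" "w' \<in> C" for w w'
    using that add_I by (simp add: C_def distrib_left)
  have C_mult: "p * w \<in> C" if "w \<in> C" for w p
    using mult_I[of "F * w" p] that by (simp only: C_def mem_Collect_eq mult.left_commute)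
  have step: "\<exists>z\<in>C. w - z \<in> tdeg_le m \<and> lead_form m (w - z) = 0" if w: "w \<in> tdeg_le m" for w
  proof (cases "lead_form m w = 0")
    case True
    then show ?thesis using w zero_I by (intro bexI[of _ 0]) (simp_all add: C_def)
  next
    case False
    have "smult (inverse r) (lead_form m w) * G = lead_form c F * lead_form m w"
      unfolding GF using r0 by simp
    moreover have "degree (smult (inverse r) (lead_form m w)) \<le> T - degree G"
      using degree_lead_form[of m w] r0 by (simp add: m_def c_def)
    ultimately have "lead_form c F * lead_form m w \<in> V T"
      unfolding G(3) by (intro image_eqI[of _ _ "smult (inverse r) (lead_form m w)"]) auto
    then obtain f where f: "f \<in> I" "f \<in> tdeg_le T" "lead_form c F * lead_form m w = lead_form T f"
      by blast
    have "f \<noteq> 0" using f(3) False u(2) uc by auto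
    then obtain z where z: "f = F * z" "z \<in> tdeg_le m" "lead_form T f = lead_form c F * lead_form m z"
      using lead[OF f(1,2)] unfolding uc m_def by blast
    have "lead_form m z = lead_form m w" using f(3) z(3) u(2) uc by simp
    then show ?thesis using f(1) z w
      by (intro bexI[of _ z]) (simp_all add: C_def lead_form_diff tdeg_le_diff)
  qed
  have reduce: "\<exists>z\<in>C. w - z \<in> tdeg_le m" if "w \<in> tdeg_le n" for w n
    using that
  proof (induction n arbitrary: w)
    case 0
    then show ?case using tdeg_le_mono[of w 0 m] zero_I by (intro bexI[of _ 0]) (simp_all add: C_def)
  next
    case (Suc n)
    have low: "\<exists>z\<in>C. p - z \<in> tdeg_le m \<and> lead_form m (p - z) = 0" if p: "p \<in> tdeg_le n" for p
    proof -
      obtain z where z: "z \<in> C" "p - z \<in> tdeg_le m" using Suc.IH[OF p] by blast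
      obtain z' where z': "z' \<in> C" "p - z - z' \<in> tdeg_le m \<and> lead_form m (p - z - z') = 0"
        using step[OF z(2)] by blast
      then show ?thesis using C_add[OF z(1) z'(1)] by (intro bexI[of _ "z + z'"]) (simp_all add: diff_diff_eq)
    qed
    obtain p q a where pq: "p \<in> tdeg_le n" "q \<in> tdeg_le n" "w = varX * p + varY * q + [:[:a:]:]"
      by (rule tdeg_le_Suc_decompose[OF Suc.prems])
    obtain z where z: "z \<in> C" "p - z \<in> tdeg_le m" "lead_form m (p - z) = 0" using low[OF pq(1)] by blast
    obtain y where y: "y \<in> C" "q - y \<in> tdeg_le m" "lead_form m (q - y) = 0" using low[OF pq(2)] by blast
    have "varX * (p - z) + varY * (q - y) + [:[:a:]:] \<in> tdeg_le m"
      by (intro tdeg_le_add lead_form_zero_mult z y tdeg_le_mono[OF const_tdeg]) simp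
    moreover have "varX * (p - z) + varY * (q - y) + [:[:a:]:] = w - (varX * z + varY * y)"
      unfolding pq(3) by (simp only: algebra_simps)
    ultimately show ?case using C_add[OF C_mult[OF z(1), of varX] C_mult[OF y(1), of varY]]
      by (intro bexI[of _ "varX * z + varY * y"]) (simp_all only:)
  qed
  show ?thesis
  proof (rule that[OF F(1)])
    show "F \<in> tdeg_le (Suc T - upoly.dim (V T))" unfolding c by (rule Fc)
    fix w :: "'k poly poly"
    obtain n where "w \<in> tdeg_le n" using tdeg_le_ex by blast
    then obtain z where z: "z \<in> C" "w - z \<in> tdeg_le m" using reduce by blast
    have "F * (w - z) \<in> tdeg_le T" using tdeg_le_mult[OF Fc z(2)] cm by simp
    moreover have "F * w - F * (w - z) \<in> I" using z(1) by (simp add: C_def algebra_simps)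
    ultimately show "\<exists>r\<in>tdeg_le T. F * w - r \<in> I" by blast
  qed
qed

end

section \<open>Homogeneous polynomials\<close>

lemma poly_mapping_sum_single:
  "(\<Sum>k\<in>Poly_Mapping.keys f. Poly_Mapping.single k (Poly_Mapping.lookup f k)) = f"
  by (rule poly_mapping_eqI)
    (simp add: lookup_sum lookup_single when_def in_keys_iff)

lemma lookup_single_times:
  fixes F :: "'e::cancel_comm_monoid_add \<Rightarrow>\<^sub>0 'k::comm_ring_1"
  shows "Poly_Mapping.lookup (Poly_Mapping.single e a * F) (e + k) = a * Poly_Mapping.lookup F k"
proof -
  have "Poly_Mapping.single e a * F =
    (\<Sum>l\<in>Poly_Mapping.keys F. Poly_Mapping.single (e + l) (a * Poly_Mapping.lookup F l))"
    by (subst (1) poly_mapping_sum_single[symmetric]) (simp add: sum_distrib_left Poly_Mapping.mult_single)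
  then show ?thesis
    by (auto simp: lookup_sum lookup_single when_def in_keys_iff cong: if_cong)
qed

lemma keys_single_times:
  fixes F :: "'e::cancel_comm_monoid_add \<Rightarrow>\<^sub>0 'k::comm_ring_1"
  shows "Poly_Mapping.keys (Poly_Mapping.single e 1 * F) = (+) e ` Poly_Mapping.keys F"
proof
  show "Poly_Mapping.keys (Poly_Mapping.single e 1 * F) \<subseteq> (+) e ` Poly_Mapping.keys F"
    using keys_mult[of "Poly_Mapping.single e 1" F] by (auto split: if_splits)
  show "(+) e ` Poly_Mapping.keys F \<subseteq> Poly_Mapping.keys (Poly_Mapping.single e 1 * F)"
    by (auto simp: in_keys_iff lookup_single_times)
qed

lemma exp_degree_add: "exp_degree (m + n) = exp_degree m + exp_degree n"
  by (simp add: exp_degree_def lookup_add sum.distrib)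

lemma exp_degree_0 [simp]: "exp_degree 0 = 0"
  by (simp add: exp_degree_def)

lemma exp_degree_single [simp]: "exp_degree (Poly_Mapping.single i e) = e"
  by (simp add: exp_degree_def lookup_single when_def)

lemma forms_0 [simp]: "0 \<in> forms t"
  by (simp add: forms_def)

lemma forms_add: "f \<in> forms t \<Longrightarrow> g \<in> forms t \<Longrightarrow> f + g \<in> forms t"
  unfolding forms_def using Poly_Mapping.keys_add[of f g] by blast

lemma forms_uminus: "f \<in> forms t \<Longrightarrow> - f \<in> forms t"
  for f :: "('v::finite \<Rightarrow>\<^sub>0 'e::comm_monoid_add) \<Rightarrow>\<^sub>0 'k::ab_group_add"
  by (simp add: forms_def in_keys_iff)

lemma forms_diff: "f \<in> forms t \<Longrightarrow> g \<in> forms t \<Longrightarrow> f - g \<in> forms t"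
  for f :: "('v::finite \<Rightarrow>\<^sub>0 'e::comm_monoid_add) \<Rightarrow>\<^sub>0 'k::ab_group_add"
  using forms_add[OF _ forms_uminus] by fastforce

lemma forms_sum: "(\<And>x. x \<in> A \<Longrightarrow> f x \<in> forms t) \<Longrightarrow> sum f A \<in> forms t"
  by (induction A rule: infinite_finite_induct) (auto intro: forms_add)

lemma forms_mult: "f \<in> forms s \<Longrightarrow> g \<in> forms t \<Longrightarrow> f * g \<in> forms (s + t)"
  unfolding forms_def using keys_mult[of f g] by (force simp: exp_degree_add)

lemma forms_single: "exp_degree m = t \<Longrightarrow> Poly_Mapping.single m c \<in> forms t"
  by (auto simp: forms_def split: if_splits)

lemma forms_const: "Poly_Mapping.single 0 c \<in> forms 0"
  by (simp add: forms_single)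

lemma forms_1: "(1 :: ('v::finite \<Rightarrow>\<^sub>0 'e::comm_monoid_add) \<Rightarrow>\<^sub>0 'k::comm_ring_1) \<in> forms 0"
  using forms_const[of "1::'k"] by simp

lemma forms_smult: "f \<in> forms t \<Longrightarrow> smult_pm c f \<in> forms t"
  unfolding smult_pm_def using forms_mult[OF forms_const] by fastforce

lemma forms_var: "var i \<in> forms 1"
  by (simp add: var_def forms_single)

lemma forms_power: "f \<in> forms t \<Longrightarrow> f ^ n \<in> forms (n * t)"
  for f :: "('v::finite, 'k::comm_ring_1) hpoly"
  by (induction n) (auto simp: forms_1 forms_mult)

lemma forms_var_power: "var i ^ n \<in> forms n"
  using forms_power[OF forms_var, of i n] by simp

lemma subspace_forms: "polyvs.subspace (forms t)"
  by (simp add: polyvs.subspace_def forms_add forms_smult)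

definition restrict_keys :: "('a \<Rightarrow> bool) \<Rightarrow> ('a \<Rightarrow>\<^sub>0 'b::zero) \<Rightarrow> ('a \<Rightarrow>\<^sub>0 'b)" where
  "restrict_keys P f = Poly_Mapping.mapp (\<lambda>k v. v when P k) f"

lemma lookup_restrict_keys:
  "Poly_Mapping.lookup (restrict_keys P f) k = (if P k then Poly_Mapping.lookup f k else 0)"
  by (simp add: restrict_keys_def lookup_mapp when_def in_keys_iff)

lemma keys_restrict_keys: "Poly_Mapping.keys (restrict_keys P f) = {k \<in> Poly_Mapping.keys f. P k}"
  by (auto simp: in_keys_iff lookup_restrict_keys split: if_splits)

lemma restrict_keys_split:
  "restrict_keys P f + restrict_keys (\<lambda>k. \<not> P k) f = f" for f :: "'a \<Rightarrow>\<^sub>0 'b::monoid_add"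
  by (rule poly_mapping_eqI) (simp add: lookup_add lookup_restrict_keys)

lemma restrict_keys_add: "restrict_keys P (f + g) = restrict_keys P f + restrict_keys P g"
  for f :: "'a \<Rightarrow>\<^sub>0 'b::monoid_add"
  by (rule poly_mapping_eqI) (simp add: lookup_add lookup_restrict_keys)

lemma restrict_keys_forms: "f \<in> forms t \<Longrightarrow> restrict_keys P f \<in> forms t"
  by (auto simp: forms_def keys_restrict_keys)

definition component :: "'e \<Rightarrow> (('v::finite \<Rightarrow>\<^sub>0 'e::comm_monoid_add) \<Rightarrow>\<^sub>0 'k::zero) \<Rightarrow> _" where
  "component t f = restrict_keys (\<lambda>m. exp_degree m = t) f"

lemma component_forms: "component t f \<in> forms t"
  by (auto simp: forms_def component_def keys_restrict_keys)

lemma component_add: "component t (f + g) = component t f + component t g"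
  for f :: "('v::finite \<Rightarrow>\<^sub>0 'e::comm_monoid_add) \<Rightarrow>\<^sub>0 'k::monoid_add"
  by (simp add: component_def restrict_keys_add)

lemma component_of_form: "f \<in> forms s \<Longrightarrow> component t f = (if s = t then f else 0)"
  by (rule poly_mapping_eqI) (auto simp: component_def lookup_restrict_keys forms_def in_keys_iff)

lemma component_0 [simp]: "component t 0 = 0"
  using component_of_form[OF forms_0, of t t] by simp

lemma sum_components:
  "(\<Sum>t\<in>exp_degree ` Poly_Mapping.keys f. component t f) = f"
proof (rule poly_mapping_eqI)
  fix k
  have "(\<Sum>t\<in>exp_degree ` Poly_Mapping.keys f. Poly_Mapping.lookup (component t f) k) =
    (\<Sum>t\<in>exp_degree ` Poly_Mapping.keys f. if t = exp_degree k then Poly_Mapping.lookup f k else 0)"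
    by (intro sum.cong) (auto simp: component_def lookup_restrict_keys)
  also have "\<dots> = Poly_Mapping.lookup f k"
    by (auto simp: in_keys_iff)
  finally show "Poly_Mapping.lookup (\<Sum>t\<in>exp_degree ` Poly_Mapping.keys f. component t f) k =
      Poly_Mapping.lookup f k" by (simp add: lookup_sum)
qed

lemma component_mult_form:
  fixes f g :: "('v::finite, 'k::comm_ring_1) hpoly"
  assumes f: "f \<in> forms s"
  shows "component (s + t) (f * g) = f * component t g"
proof -
  define h where "h = restrict_keys (\<lambda>m. exp_degree m \<noteq> t) g"
  have g: "g = component t g + h"
    unfolding h_def component_def by (rule restrict_keys_split[symmetric])
  have "component (s + t) (f * h) = 0"
  proof (rule poly_mapping_eqI)
    fix k
    have "exp_degree k \<noteq> s + t" if k: "k \<in> Poly_Mapping.keys (f * h)"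
    proof -
      obtain a b where ab: "k = a + b" "a \<in> Poly_Mapping.keys f" "b \<in> Poly_Mapping.keys h"
        using k keys_mult[of f h] by blast
      have "exp_degree a = s" using ab(2) f by (simp add: forms_def)
      moreover have "exp_degree b \<noteq> t" using ab(3) by (simp add: h_def keys_restrict_keys)
      ultimately show ?thesis using ab(1) by (simp add: exp_degree_add)
    qed
    then show "Poly_Mapping.lookup (component (s + t) (f * h)) k = Poly_Mapping.lookup 0 k"
      by (auto simp: component_def lookup_restrict_keys in_keys_iff)
  qed
  moreover have "component (s + t) (f * component t g) = f * component t g"
    using component_of_form[OF forms_mult[OF f component_forms]] by simp
  ultimately show ?thesis
    by (subst g) (simp add: distrib_left component_add)
qed

lemma component_mult_low:
  fixes f g :: "('v::finite, 'k::comm_ring_1) hpoly"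
  assumes f: "f \<in> forms s" and "t < s"
  shows "component t (f * g) = 0"
proof (rule poly_mapping_eqI)
  fix k
  have "exp_degree k \<noteq> t" if k: "k \<in> Poly_Mapping.keys (f * g)"
  proof -
    obtain a b where ab: "k = a + b" "a \<in> Poly_Mapping.keys f"
      using k keys_mult[of f g] by blast
    have "exp_degree a = s" using ab(2) f by (simp add: forms_def)
    then show ?thesis using ab(1) assms(2) by (simp add: exp_degree_add)
  qed
  then show "Poly_Mapping.lookup (component t (f * g)) k = Poly_Mapping.lookup 0 k"
    by (auto simp: component_def lookup_restrict_keys in_keys_iff)
qed

subsection \<open>Substitution homomorphisms\<close>

lemma single_sum: "(\<Sum>x\<in>A. Poly_Mapping.single k (f x)) = Poly_Mapping.single k (\<Sum>x\<in>A. f x)"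
  by (induction A rule: infinite_finite_induct) (auto simp: Poly_Mapping.single_add)

lemma single_prod: "(\<Prod>x\<in>A. Poly_Mapping.single (e x) (1::'k::comm_semiring_1)) = Poly_Mapping.single (\<Sum>x\<in>A. e x) 1"
  by (induction A rule: infinite_finite_induct) (auto simp: Poly_Mapping.mult_single)

lemma single_power: "Poly_Mapping.single e (1::'k::comm_semiring_1) ^ n = Poly_Mapping.single (\<Sum>i<n. e) 1"
  by (induction n) (auto simp: Poly_Mapping.mult_single add.commute)

lemma sum_single_exponents:
  "(\<Sum>i\<in>UNIV. Poly_Mapping.single i (Poly_Mapping.lookup m i)) = (m :: 'v::finite \<Rightarrow>\<^sub>0 'e::comm_monoid_add)"
  by (rule poly_mapping_eqI) (simp add: lookup_sum lookup_single when_def)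

lemma single_nat_sum: "(\<Sum>j<n. Poly_Mapping.single i (Suc 0)) = Poly_Mapping.single i n"
  by (simp add: single_sum)

lemma single_eq_prod_var:
  "Poly_Mapping.single m c = Poly_Mapping.single 0 c * (\<Prod>i\<in>UNIV. var i ^ Poly_Mapping.lookup m i)"
  for m :: "'v::finite \<Rightarrow>\<^sub>0 nat"
  by (simp add: var_def single_power single_prod single_nat_sum sum_single_exponents Poly_Mapping.mult_single)

text \<open>The polynomial ring is generated by constants and variables.\<close>

lemma hpoly_induct [case_names const var add mult]:
  fixes f :: "('v::finite, 'k::comm_ring_1) hpoly"
  assumes c: "\<And>c. P (Poly_Mapping.single 0 c)" and v: "\<And>i. P (var i)"
    and a: "\<And>f g. P f \<Longrightarrow> P g \<Longrightarrow> P (f + g)" and m: "\<And>f g. P f \<Longrightarrow> P g \<Longrightarrow> P (f * g)"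
  shows "P f"
proof -
  have P1: "P 1" using c[of 1] by simp
  have pw: "P (g ^ n)" if "P g" for g n by (induction n) (auto intro: m that simp: P1)
  have pr: "P (\<Prod>i\<in>A. g i)" if "\<And>i. P (g i)" for g and A :: "'v set"
    by (induction A rule: infinite_finite_induct) (auto intro: m that simp: P1)
  have s: "P (Poly_Mapping.single k (Poly_Mapping.lookup f k))" for k
    unfolding single_eq_prod_var[of k] by (intro m c pr pw v)
  have P0: "P 0" using c[of 0] by simp
  have "P (\<Sum>k\<in>A. Poly_Mapping.single k (Poly_Mapping.lookup f k))" for A
    by (induction A rule: infinite_finite_induct) (auto intro: a s simp: P0)
  then show ?thesis using poly_mapping_sum_single[of f] by metis
qed

definition insertion :: "('k::zero \<Rightarrow> 'r::comm_ring_1) \<Rightarrow> ('v::finite \<Rightarrow> 'r) \<Rightarrow> ('v, 'k) hpoly \<Rightarrow> 'r" where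
  "insertion c r f =
     (\<Sum>m\<in>Poly_Mapping.keys f. c (Poly_Mapping.lookup f m) * (\<Prod>i\<in>UNIV. r i ^ Poly_Mapping.lookup m i))"

locale const_hom =
  fixes c :: "'k::comm_ring_1 \<Rightarrow> 'r::comm_ring_1"
  assumes c_add: "c (a + b) = c a + c b" and c_mult: "c (a * b) = c a * c b"
    and c_0: "c 0 = 0" and c_1: "c 1 = 1"
begin

lemma insertion_superset:
  assumes "finite A" "Poly_Mapping.keys f \<subseteq> A"
  shows "insertion c r f = (\<Sum>m\<in>A. c (Poly_Mapping.lookup f m) * (\<Prod>i\<in>UNIV. r i ^ Poly_Mapping.lookup m i))"
  unfolding insertion_def using assms by (intro sum.mono_neutral_left) (auto simp: in_keys_iff c_0)

lemma insertion_add: "insertion c r (f + g) = insertion c r f + insertion c r g"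
proof -
  let ?A = "Poly_Mapping.keys f \<union> Poly_Mapping.keys g"
  have "Poly_Mapping.keys (f + g) \<subseteq> ?A" by (rule Poly_Mapping.keys_add)
  then show ?thesis
    by (simp add: insertion_superset[of ?A] lookup_add c_add distrib_right sum.distrib)
qed

lemma insertion_0 [simp]: "insertion c r 0 = 0"
  by (simp add: insertion_def)

lemma insertion_sum: "insertion c r (sum F A) = (\<Sum>x\<in>A. insertion c r (F x))"
  by (induction A rule: infinite_finite_induct) (auto simp: insertion_add)

lemma insertion_single:
  "insertion c r (Poly_Mapping.single m a) = c a * (\<Prod>i\<in>UNIV. r i ^ Poly_Mapping.lookup m i)"
  by (simp add: insertion_superset[of "{m}"])

lemma insertion_const [simp]: "insertion c r (Poly_Mapping.single 0 a) = c a"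
  by (simp add: insertion_single)

lemma insertion_1 [simp]: "insertion c r 1 = 1"
  using insertion_const[of r 1] by (simp add: c_1)

lemma insertion_var [simp]: "insertion c r (var i) = r i"
proof -
  have "(\<Prod>j\<in>UNIV. r j ^ Poly_Mapping.lookup (Poly_Mapping.single i 1) j) =
    (\<Prod>j\<in>UNIV. if j = i then r i else 1)"
    by (intro prod.cong) (auto simp: lookup_single when_def)
  then show ?thesis by (simp add: var_def insertion_single c_1)
qed

lemma insertion_mult: "insertion c r (f * g) = insertion c r f * insertion c r g"
proof -
  have s: "insertion c r (Poly_Mapping.single m a * Poly_Mapping.single n b) =
    insertion c r (Poly_Mapping.single m a) * insertion c r (Poly_Mapping.single n b)" for m n a b
    unfolding Poly_Mapping.mult_single insertion_single lookup_add power_add prod.distrib c_mult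
    by (simp only: mult_ac)
  have "insertion c r (f * g) = insertion c r
    ((\<Sum>k\<in>Poly_Mapping.keys f. Poly_Mapping.single k (Poly_Mapping.lookup f k)) *
     (\<Sum>l\<in>Poly_Mapping.keys g. Poly_Mapping.single l (Poly_Mapping.lookup g l)))"
    by (simp add: poly_mapping_sum_single)
  also have "\<dots> = insertion c r (\<Sum>k\<in>Poly_Mapping.keys f. Poly_Mapping.single k (Poly_Mapping.lookup f k)) *
    insertion c r (\<Sum>l\<in>Poly_Mapping.keys g. Poly_Mapping.single l (Poly_Mapping.lookup g l))"
    by (simp only: sum_product insertion_sum s)
  finally show ?thesis by (simp add: poly_mapping_sum_single)
qed

lemma insertion_power: "insertion c r (f ^ n) = insertion c r f ^ n"
  by (induction n) (auto simp: insertion_mult)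

lemma insertion_uminus: "insertion c r (- f) = - insertion c r f"
  using insertion_add[of r f "- f"] by (simp add: eq_neg_iff_add_eq_0 add.commute)

lemma insertion_diff: "insertion c r (f - g) = insertion c r f - insertion c r g"
  using insertion_add[of r f "- g"] by (simp add: insertion_uminus)

lemma insertion_prod: "insertion c r (prod F A) = (\<Prod>x\<in>A. insertion c r (F x))"
  by (induction A rule: infinite_finite_induct) (auto simp: insertion_mult)

lemma insertion_smult_pm: "insertion c r (smult_pm a f) = c a * insertion c r f"
  by (simp add: smult_pm_def insertion_mult)

lemma insertion_unique:
  assumes "\<And>f g. H (f + g) = H f + H g" "\<And>f g. H (f * g) = H f * H g"
    "\<And>a. H (Poly_Mapping.single 0 a) = c a"
  shows "H f = insertion c (\<lambda>i. H (var i)) f"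
  by (induction f rule: hpoly_induct) (simp_all add: assms insertion_add insertion_mult)

end

lemma const_hom_single: "const_hom (Poly_Mapping.single (0::'e::comm_monoid_add) :: 'k::comm_ring_1 \<Rightarrow> _)"
  by unfold_locales (simp_all add: Poly_Mapping.single_add Poly_Mapping.mult_single)

lemma const_hom_id: "const_hom (\<lambda>x. x)"
  by unfold_locales simp_all

lemma const_hom_poly: "const_hom (\<lambda>a::'k::comm_ring_1. [:a:])"
  by unfold_locales (simp_all add: one_pCons)

lemma const_hom_poly2: "const_hom (\<lambda>a::'k::comm_ring_1. [:[:a:]:])"
  by unfold_locales (simp_all add: one_pCons)

lemma eval_at_eq_insertion: "eval_at f v = insertion (\<lambda>x. x) (\<lambda>i. v $ i) f"
  by (simp add: eval_at_def insertion_def)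

subsection \<open>Laurent polynomials\<close>

lemma lookup_map_int: "Poly_Mapping.lookup (Poly_Mapping.map int m) i = int (Poly_Mapping.lookup m i)"
  by (simp add: Poly_Mapping.map.rep_eq when_def)

lemma lookup_map_nat: "Poly_Mapping.lookup (Poly_Mapping.map nat m) i = nat (Poly_Mapping.lookup m i)"
  by (simp add: Poly_Mapping.map.rep_eq when_def)

lemma map_int_inj: "Poly_Mapping.map int m = Poly_Mapping.map int n \<longleftrightarrow> m = n"
  by (auto simp: poly_mapping_eq_iff fun_eq_iff lookup_map_int)

lemma map_int_map_nat:
  "(\<And>i. 0 \<le> Poly_Mapping.lookup k i) \<Longrightarrow> Poly_Mapping.map int (Poly_Mapping.map nat k) = k"
  by (rule poly_mapping_eqI) (simp add: lookup_map_int lookup_map_nat)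

lemma lookup_to_laurent:
  "Poly_Mapping.lookup (to_laurent f) (Poly_Mapping.map int m) = Poly_Mapping.lookup f m"
  by (auto simp: to_laurent_def lookup_sum lookup_single when_def map_int_inj in_keys_iff)

lemma keys_to_laurent:
  "Poly_Mapping.keys (to_laurent f) = Poly_Mapping.map int ` Poly_Mapping.keys f"
proof
  show "Poly_Mapping.keys (to_laurent f) \<subseteq> Poly_Mapping.map int ` Poly_Mapping.keys f"
    unfolding to_laurent_def
    by (rule order_trans[OF Poly_Mapping.keys_sum]) (auto split: if_splits)
  show "Poly_Mapping.map int ` Poly_Mapping.keys f \<subseteq> Poly_Mapping.keys (to_laurent f)"
    by (auto simp: in_keys_iff lookup_to_laurent)
qed

definition lvar :: "'v \<Rightarrow> ('v, 'k::comm_ring_1) laurent" where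
  "lvar i = Poly_Mapping.single (Poly_Mapping.single i 1) 1"

definition lvar_inv :: "'v \<Rightarrow> ('v, 'k::comm_ring_1) laurent" where
  "lvar_inv i = Poly_Mapping.single (Poly_Mapping.single i (- 1)) 1"

lemma lvar_inverse [simp]: "lvar i * lvar_inv i = 1"
  by (simp add: lvar_def lvar_inv_def Poly_Mapping.mult_single flip: Poly_Mapping.single_add)

lemma lvar_power_inverse [simp]: "lvar i ^ n * lvar_inv i ^ n = 1"
  by (simp flip: power_mult_distrib)

lemma to_laurent_insertion:
  "to_laurent f = insertion (Poly_Mapping.single 0) lvar (f :: ('v::finite, 'k::comm_ring_1) hpoly)"
proof -
  have "Poly_Mapping.single (Poly_Mapping.map int m) a =
    Poly_Mapping.single 0 a * (\<Prod>i\<in>UNIV. lvar i ^ Poly_Mapping.lookup m i)"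
    for m :: "'v \<Rightarrow>\<^sub>0 nat" and a :: 'k
  proof -
    have "(\<Sum>j<n. Poly_Mapping.single i (1::int)) = Poly_Mapping.single i (int n)" for i :: 'v and n
      by (simp add: single_sum)
    then have "(\<Prod>i\<in>UNIV. lvar i ^ Poly_Mapping.lookup m i) =
        Poly_Mapping.single (\<Sum>i\<in>UNIV. Poly_Mapping.single i (Poly_Mapping.lookup (Poly_Mapping.map int m) i)) (1::'k)"
      by (simp add: lvar_def single_power single_prod lookup_map_int)
    then show ?thesis by (simp add: sum_single_exponents Poly_Mapping.mult_single)
  qed
  then show ?thesis by (simp add: to_laurent_def insertion_def)
qed

interpretation single_hom: const_hom "Poly_Mapping.single (0::'e::comm_monoid_add) :: 'k::comm_ring_1 \<Rightarrow> _"
  by (rule const_hom_single)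

lemma to_laurent_simps:
  fixes f g :: "('v::finite, 'k::comm_ring_1) hpoly"
  shows "to_laurent (f + g) = to_laurent f + to_laurent g"
    "to_laurent (f - g) = to_laurent f - to_laurent g"
    "to_laurent (- f) = - to_laurent f"
    "to_laurent (f * g) = to_laurent f * to_laurent g"
    "to_laurent (f ^ n) = to_laurent f ^ n"
    "to_laurent (var i :: ('v, 'k) hpoly) = lvar i"
    "to_laurent (0 :: ('v, 'k) hpoly) = 0"
    "to_laurent (1 :: ('v, 'k) hpoly) = 1"
    "to_laurent (Poly_Mapping.single 0 a :: ('v, 'k) hpoly) = Poly_Mapping.single 0 a"
    "to_laurent (prod F A :: ('v, 'k) hpoly) = (\<Prod>x\<in>A. to_laurent (F x))"
  by (simp_all add: to_laurent_insertion single_hom.insertion_add single_hom.insertion_diff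
      single_hom.insertion_uminus single_hom.insertion_mult single_hom.insertion_power single_hom.insertion_prod)

lemma to_laurent_inj [simp]: "to_laurent f = to_laurent g \<longleftrightarrow> f = g"
  by (metis lookup_to_laurent poly_mapping_eqI)

lemma to_laurent_forms:
  fixes f :: "('v::finite, 'k::comm_ring_1) hpoly"
  shows "to_laurent f \<in> forms (int t) \<longleftrightarrow> f \<in> forms t"
proof -
  have "exp_degree (Poly_Mapping.map int m) = int (exp_degree m)" for m :: "'v \<Rightarrow>\<^sub>0 nat"
    by (simp add: exp_degree_def lookup_map_int)
  then show ?thesis by (simp add: forms_def keys_to_laurent)
qed

lemma to_laurent_imageI:
  fixes F :: "('v::finite, 'k::comm_ring_1) laurent"
  assumes "\<And>k i. k \<in> Poly_Mapping.keys F \<Longrightarrow> 0 \<le> Poly_Mapping.lookup k i"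
  shows "F \<in> to_laurent ` UNIV"
proof -
  let ?f = "\<Sum>k\<in>Poly_Mapping.keys F. Poly_Mapping.single (Poly_Mapping.map nat k) (Poly_Mapping.lookup F k)"
  have s: "to_laurent (Poly_Mapping.single m a) = Poly_Mapping.single (Poly_Mapping.map int m) (a::'k)"
    for m :: "'v \<Rightarrow>\<^sub>0 nat" and a by (simp add: to_laurent_def)
  have "to_laurent ?f = (\<Sum>k\<in>Poly_Mapping.keys F. Poly_Mapping.single k (Poly_Mapping.lookup F k))"
    unfolding to_laurent_insertion single_hom.insertion_sum
    unfolding to_laurent_insertion[symmetric] s
    by (intro sum.cong) (simp_all add: map_int_map_nat assms)
  then show ?thesis unfolding poly_mapping_sum_single by (metis rangeI)
qed

lemma to_laurent_image_nonneg:
  "F \<in> to_laurent ` UNIV \<Longrightarrow> k \<in> Poly_Mapping.keys F \<Longrightarrow> 0 \<le> Poly_Mapping.lookup k i"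
  by (auto simp: keys_to_laurent lookup_map_int)

lemma forms_lvar: "lvar i \<in> forms 1" "lvar_inv i \<in> forms (- 1)"
  by (simp_all add: lvar_def lvar_inv_def forms_single)

lemma forms_lvar_power: "lvar i ^ n \<in> forms (int n)" "lvar_inv i ^ n \<in> forms (- int n)"
proof -
  show "lvar i ^ n \<in> forms (int n)"
    using forms_mult[OF forms_lvar(1)] by (induction n) (auto simp: forms_1)
  show "lvar_inv i ^ n \<in> forms (- int n)"
  proof (induction n)
    case (Suc n)
    then show ?case using forms_mult[OF forms_lvar(2)[of i] Suc] by (simp add: algebra_simps)
  qed (simp add: forms_1)
qed

subsection \<open>Finiteness of the spaces of forms\<close>

lemma finite_exponents: "finite {m :: 'v::finite \<Rightarrow>\<^sub>0 nat. exp_degree m = t}"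
proof (rule finite_imageD[where f = Poly_Mapping.lookup])
  have "Poly_Mapping.lookup ` {m :: 'v \<Rightarrow>\<^sub>0 nat. exp_degree m = t} \<subseteq> PiE UNIV (\<lambda>_. {..t})"
  proof
    fix f assume "f \<in> Poly_Mapping.lookup ` {m :: 'v \<Rightarrow>\<^sub>0 nat. exp_degree m = t}"
    then obtain m :: "'v \<Rightarrow>\<^sub>0 nat" where m: "f = Poly_Mapping.lookup m" "exp_degree m = t" by blast
    have "f i \<le> t" for i
      unfolding m(1) m(2)[symmetric] exp_degree_def by (rule member_le_sum) auto
    then show "f \<in> PiE UNIV (\<lambda>_. {..t})" by (simp add: PiE_def)
  qed
  then show "finite (Poly_Mapping.lookup ` {m :: 'v \<Rightarrow>\<^sub>0 nat. exp_degree m = t})"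
    by (rule finite_subset) (simp add: finite_PiE)
  show "inj_on Poly_Mapping.lookup {m :: 'v \<Rightarrow>\<^sub>0 nat. exp_degree m = t}"
    by (simp add: inj_on_def lookup_inject)
qed

lemma forms_span:
  obtains C :: "('v::finite, 'k::field) hpoly set"
  where "finite C" "C \<subseteq> forms t" "forms t \<subseteq> polyvs.span C"
proof (rule that)
  let ?C = "(\<lambda>m. Poly_Mapping.single m (1::'k)) ` {m :: 'v \<Rightarrow>\<^sub>0 nat. exp_degree m = t}"
  show "finite ?C" by (intro finite_imageI finite_exponents)
  show "?C \<subseteq> forms t" by (auto intro: forms_single)
  show "forms t \<subseteq> polyvs.span ?C"
  proof
    fix f :: "('v, 'k) hpoly" assume f: "f \<in> forms t"
    have "f = (\<Sum>m\<in>Poly_Mapping.keys f. smult_pm (Poly_Mapping.lookup f m) (Poly_Mapping.single m 1))"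
      by (simp add: smult_pm_def Poly_Mapping.mult_single poly_mapping_sum_single)
    also have "\<dots> \<in> polyvs.span ?C"
      using f by (intro polyvs.span_sum polyvs.span_scale polyvs.span_base) (auto simp: forms_def)
    finally show "f \<in> polyvs.span ?C" .
  qed
qed

text \<open>Pigeonhole: a monomial of degree at least \<open>CARD('v) * N\<close> has an exponent of at least \<open>N\<close>.\<close>

lemma forms_high_degree:
  fixes g :: "('v::finite, 'k::comm_ring_1) hpoly"
  assumes g: "g \<in> forms n" and n: "CARD('v) * N \<le> n"
  obtains c where "g = (\<Sum>i\<in>UNIV. c i * var i ^ N)" "\<And>i. c i \<in> forms (n - N)"
proof -
  let ?P = "\<lambda>g. \<exists>c. g = (\<Sum>i\<in>UNIV. c i * var i ^ N) \<and> (\<forall>i. c i \<in> forms (n - N))"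
  have P0: "?P 0" by (intro exI[of _ "\<lambda>_. 0"]) simp
  have Padd: "?P (f + g)" if "?P f" "?P g" for f g
  proof -
    obtain c d where "f = (\<Sum>i\<in>UNIV. c i * var i ^ N)" "\<forall>i. c i \<in> forms (n - N)"
      "g = (\<Sum>i\<in>UNIV. d i * var i ^ N)" "\<forall>i. d i \<in> forms (n - N)" using \<open>?P f\<close> \<open>?P g\<close> by blast
    then show ?thesis
      by (intro exI[of _ "\<lambda>i. c i + d i"]) (simp add: sum.distrib distrib_right forms_add)
  qed
  have Ps: "?P (Poly_Mapping.single m a)" if m: "exp_degree m = n" for m :: "'v \<Rightarrow>\<^sub>0 nat" and a :: 'k
  proof -
    have "\<exists>i. N \<le> Poly_Mapping.lookup m i"
    proof (rule ccontr)
      assume "\<not> ?thesis"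
      then have "exp_degree m < CARD('v) * N"
        unfolding exp_degree_def
        using sum_strict_mono[of "UNIV :: 'v set" "Poly_Mapping.lookup m" "\<lambda>_. N"] by (simp add: not_le)
      then show False using m n by simp
    qed
    then obtain i where i: "N \<le> Poly_Mapping.lookup m i" ..
    define m' where "m' = m - Poly_Mapping.single i N"
    have mm: "m' + Poly_Mapping.single i N = m"
      unfolding m'_def using i by (intro poly_mapping_eqI) (auto simp: lookup_add lookup_minus lookup_single when_def)
    have "exp_degree m' + N = n" using m exp_degree_add[of m' "Poly_Mapping.single i N"] unfolding mm by simp
    then have m'f: "Poly_Mapping.single m' a \<in> forms (n - N)" by (intro forms_single) simp
    have vN: "var i ^ N = Poly_Mapping.single (Poly_Mapping.single i N) 1"
      by (simp add: var_def single_power single_nat_sum)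
    have "Poly_Mapping.single m a = (\<Sum>j\<in>UNIV. (if j = i then Poly_Mapping.single m' a else 0) * var j ^ N)"
      by (simp add: if_distrib[of "\<lambda>x. x * _"] vN Poly_Mapping.mult_single mm cong: if_cong)
    then show ?thesis using m'f by (intro exI[of _ "\<lambda>j. if j = i then Poly_Mapping.single m' a else 0"]) simp
  qed
  have "?P (\<Sum>m\<in>A. Poly_Mapping.single m (Poly_Mapping.lookup g m))" if "A \<subseteq> Poly_Mapping.keys g" for A
    using that
  proof (induction A rule: infinite_finite_induct)
    case (insert m A)
    have "exp_degree m = n" using insert g by (auto simp: forms_def)
    then show ?case using Padd[OF Ps] insert by simp
  qed (use P0 in simp_all)
  from this[OF subset_refl] that show ?thesis unfolding poly_mapping_sum_single by blast
qed

lemma ideal_cong_power: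
  fixes I :: "'a::comm_ring_1 set"
  assumes I: "ideal.subspace I" and ab: "a - b \<in> I"
  shows "a ^ n - b ^ n \<in> I"
proof (induction n)
  case (Suc n)
  have "a ^ Suc n - b ^ Suc n = a * (a ^ n - b ^ n) + b ^ n * (a - b)" by (simp add: algebra_simps)
  also have "\<dots> \<in> I"
    by (intro ideal.subspace_add[OF I] ideal.subspace_scale[OF I] Suc ab)
  finally show ?case .
qed (use ideal.subspace_0[OF I] in simp)

section \<open>Cech cohomology of the plane\<close>

lemma UNIV_3': "(UNIV :: 3 set) = {0, 1, 2}"
  using exhaust_3 by force

lemma less_3: "(0::3) < 1" "(1::3) < 2" "(0::3) < 2"
  unfolding less_bit1_def by (simp_all add: bit1.Rep_0 bit1.Rep_1 bit1.Rep_numeral)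

lemma neq_3: "(0::3) \<noteq> 1" "(1::3) \<noteq> 2" "(0::3) \<noteq> 2" "(1::3) \<noteq> 0" "(2::3) \<noteq> 1" "(2::3) \<noteq> 0"
  using less_3 by (metis less_irrefl)+

lemma exhaust_3': "i = 0 \<or> i = 1 \<or> i = (2::3)"
  using UNIV_3' by blast

lemma card_3_cases:
  fixes \<sigma> :: "3 set"
  assumes "card \<sigma> = 2"
  shows "\<sigma> = {0, 1} \<or> \<sigma> = {0, 2} \<or> \<sigma> = {1, 2}"
proof -
  obtain i j where ij: "\<sigma> = {i, j}" "i \<noteq> j" using assms by (meson card_2_iff)
  then show ?thesis using exhaust_3'[of i] exhaust_3'[of j] by auto
qed

definition point_cochain :: "('v \<Rightarrow> ('v, 'k::zero) laurent) \<Rightarrow> ('v, 'k) cochain" where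
  "point_cochain F = (\<lambda>\<sigma>. if card \<sigma> = 1 then F (the_elem \<sigma>) else 0)"

lemma point_cochain_single [simp]: "point_cochain F {i} = F i"
  by (simp add: point_cochain_def)

lemma cech_diff_pair:
  "i < j \<Longrightarrow> cech_diff s {i, j} = s {j} - s {i}"
proof -
  assume ij: "i < j"
  then have "{l \<in> {i, j}. l < i} = {}" "{l \<in> {i, j}. l < j} = {i}" "{i, j} - {i} = {j}" "{i, j} - {j} = {i}"
    by auto
  note sets = this
  have "cech_diff s {i, j} = (- 1) ^ card {l \<in> {i, j}. l < i} * s ({i, j} - {i}) +
      (- 1) ^ card {l \<in> {i, j}. l < j} * s ({i, j} - {j})"
    unfolding cech_diff_def using ij by (subst sum.insert) auto
  then show ?thesis unfolding sets by simp
qed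

lemma cech_diff_triple: "cech_diff s (UNIV :: 3 set) = s {1, 2} - s {0, 2} + s {0, 1}"
proof -
  have lt: "{l \<in> UNIV. l < (0::3)} = {}" "{l \<in> UNIV. l < (1::3)} = {0}" "{l \<in> UNIV. l < (2::3)} = {0, 1}"
    using less_3 by (auto simp: UNIV_3')
  have rest: "UNIV - {0::3} = {1, 2}" "UNIV - {1::3} = {0, 2}" "UNIV - {2::3} = {0, 1}"
    unfolding UNIV_3' using neq_3 by (simp_all add: insert_Diff_if)
  define g where "g = (\<lambda>j::3. (- 1) ^ card {l \<in> UNIV. l < j} * s (UNIV - {j}))"
  have "cech_diff s UNIV = sum g {0, 1, 2}"
    unfolding cech_diff_def g_def UNIV_3'[symmetric] ..
  also have "\<dots> = g 0 + (g 1 + g 2)" using neq_3 by simp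
  also have "\<dots> = s {1, 2} - s {0, 2} + s {0, 1}"
    unfolding g_def lt rest using neq_3 by simp
  finally show ?thesis .
qed

lemma cech_diff_support:
  assumes "\<And>\<tau>. card \<tau> \<noteq> n \<Longrightarrow> s \<tau> = 0" "card \<sigma> \<noteq> Suc n"
  shows "cech_diff s (\<sigma> :: 'v::{finite,linorder} set) = 0"
  unfolding cech_diff_def
proof (rule sum.neutral, rule ballI)
  fix j assume "j \<in> \<sigma>"
  then have "card (\<sigma> - {j}) \<noteq> n"
    using assms(2) by (metis card_Suc_Diff1 finite)
  then show "(- 1) ^ card {l \<in> \<sigma>. l < j} * s (\<sigma> - {j}) = 0" using assms(1) by simp
qed

lemma cech_diff_cech_diff_point:
  fixes F :: "3 \<Rightarrow> (3, 'k::comm_ring_1) laurent"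
  shows "cech_diff (cech_diff (point_cochain F)) = 0"
proof
  fix \<sigma> :: "3 set"
  have sup: "cech_diff (point_cochain F) \<tau> = 0" if "card \<tau> \<noteq> 2" for \<tau>
    by (rule cech_diff_support[of 1]) (use that in \<open>auto simp: point_cochain_def\<close>)
  show "cech_diff (cech_diff (point_cochain F)) \<sigma> = 0 \<sigma>"
  proof (cases "card \<sigma> = 3")
    case False
    then show ?thesis using cech_diff_support[of 2, OF sup] by simp
  next
    case True
    have "card \<sigma> = card (UNIV :: 3 set)" using True by simp
    then have "\<sigma> = UNIV" by (intro card_subset_eq) auto
    then show ?thesis using less_3 by (simp add: cech_diff_triple cech_diff_pair)
  qed
qed

lemma cech_diff_add: "cech_diff (s + s') = cech_diff s + cech_diff s'"
  by (simp add: cech_diff_def fun_eq_iff distrib_left sum.distrib)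

lemma cech_diff_minus: "cech_diff (s - s') = cech_diff s - cech_diff s'"
  by (simp add: cech_diff_def fun_eq_iff right_diff_distrib sum_subtractf)

lemma cech_diff_smult: "cech_diff (smult_cochain c s) = smult_cochain c (cech_diff s)"
  unfolding cech_diff_def smult_cochain_def smult_pm_def sum_distrib_left
  by (simp only: mult.left_commute)

lemma cech_diff_0 [simp]: "cech_diff 0 = 0"
  by (simp add: cech_diff_def fun_eq_iff)

lemma point_cochain_add: "point_cochain (\<lambda>i. F i + G i) = point_cochain F + point_cochain G"
  for F :: "'v \<Rightarrow> ('v, 'k::monoid_add) laurent"
  by (simp add: point_cochain_def fun_eq_iff)

lemma point_cochain_diff: "point_cochain (\<lambda>i. F i - G i) = point_cochain F - point_cochain G"
  for F :: "'v \<Rightarrow> ('v, 'k::ab_group_add) laurent"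
  by (simp add: point_cochain_def fun_eq_iff)

lemma point_cochain_smult: "point_cochain (\<lambda>i. smult_pm c (F i)) = smult_cochain c (point_cochain F)"
  by (simp add: point_cochain_def fun_eq_iff smult_cochain_def smult_pm_def)

lemma to_laurent_smult: "to_laurent (smult_pm c f) = smult_pm c (to_laurent f)"
  for f :: "('v::finite, 'k::comm_ring_1) hpoly"
  by (simp add: smult_pm_def to_laurent_simps)

subsection \<open>Local sections\<close>

text \<open>The degree \<open>t\<close> part of the saturation of \<open>I\<close>.  Cech cohomology depends on \<open>I\<close> only through
  these spaces.\<close>

definition sat_forms :: "('v::finite, 'k::comm_ring_1) hpoly set \<Rightarrow> nat \<Rightarrow> ('v, 'k) hpoly set" where
  "sat_forms I t = {f \<in> forms t. \<forall>i. \<exists>N. var i ^ N * f \<in> I}"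

lemma local_sections_iff:
  "F \<in> local_sections I t \<sigma> \<longleftrightarrow> F \<in> forms t \<and> (\<exists>N. \<exists>g\<in>I. (\<Prod>i\<in>\<sigma>. lvar i ^ N) * F = to_laurent g)"
  by (auto simp: local_sections_def to_laurent_simps)

lemma ideal_shift:
  fixes I :: "('v::finite, 'k::comm_ring_1) hpoly set"
  assumes I: "ideal.subspace I"
    and N: "\<exists>g\<in>I. (\<Prod>i\<in>\<sigma>. lvar i ^ N) * F = to_laurent g" and le: "N \<le> N'"
  shows "\<exists>g\<in>I. (\<Prod>i\<in>\<sigma>. lvar i ^ N') * F = to_laurent g"
proof -
  obtain g where g: "g \<in> I" "(\<Prod>i\<in>\<sigma>. lvar i ^ N) * F = to_laurent g" using N by blast
  have "lvar i ^ N' = lvar i ^ (N' - N) * (lvar i ^ N :: ('v, 'k) laurent)" for i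
    using le power_add[of "lvar i" "N' - N" N] by simp
  then have "(\<Prod>i\<in>\<sigma>. lvar i ^ N') = (\<Prod>i\<in>\<sigma>. lvar i ^ (N' - N) * (lvar i ^ N :: ('v, 'k) laurent))"
    by (intro prod.cong) auto
  then have "(\<Prod>i\<in>\<sigma>. lvar i ^ N') * F = (\<Prod>i\<in>\<sigma>. lvar i ^ (N' - N)) * ((\<Prod>i\<in>\<sigma>. lvar i ^ N) * F)"
    by (simp only: prod.distrib mult.assoc)
  also have "\<dots> = to_laurent ((\<Prod>i\<in>\<sigma>. var i ^ (N' - N)) * g)"
    by (simp add: g(2) to_laurent_simps)
  finally show ?thesis using ideal.subspace_scale[OF I g(1)] by blast
qed

lemma local_sections_add:
  fixes I :: "('v::finite, 'k::comm_ring_1) hpoly set"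
  assumes I: "ideal.subspace I" and F: "F \<in> local_sections I t \<sigma>" and G: "G \<in> local_sections I t \<sigma>"
  shows "F + G \<in> local_sections I t \<sigma>"
proof -
  obtain M N where M: "\<exists>g\<in>I. (\<Prod>i\<in>\<sigma>. lvar i ^ M) * F = to_laurent g"
    and N: "\<exists>g\<in>I. (\<Prod>i\<in>\<sigma>. lvar i ^ N) * G = to_laurent g"
    using F G unfolding local_sections_iff by blast
  obtain g h where gh: "g \<in> I" "(\<Prod>i\<in>\<sigma>. lvar i ^ max M N) * F = to_laurent g"
    "h \<in> I" "(\<Prod>i\<in>\<sigma>. lvar i ^ max M N) * G = to_laurent h"
    using ideal_shift[OF I M max.cobounded1] ideal_shift[OF I N max.cobounded2] by blast
  have "(\<Prod>i\<in>\<sigma>. lvar i ^ max M N) * (F + G) = to_laurent (g + h)"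
    by (simp add: distrib_left gh to_laurent_simps)
  moreover have "g + h \<in> I" using gh ideal.subspace_add[OF I] by blast
  moreover have "F + G \<in> forms t" using F G forms_add unfolding local_sections_iff by blast
  ultimately show ?thesis unfolding local_sections_iff by blast
qed

lemma local_sections_smult:
  fixes I :: "('v::finite, 'k::comm_ring_1) hpoly set"
  assumes I: "ideal.subspace I" and F: "F \<in> local_sections I t \<sigma>"
  shows "smult_pm c F \<in> local_sections I t \<sigma>"
proof -
  obtain N g where g: "g \<in> I" "(\<Prod>i\<in>\<sigma>. lvar i ^ N) * F = to_laurent g"
    using F unfolding local_sections_iff by blast
  have "(\<Prod>i\<in>\<sigma>. lvar i ^ N) * smult_pm c F = smult_pm c ((\<Prod>i\<in>\<sigma>. lvar i ^ N) * F)"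
    by (simp add: smult_pm_def mult.left_commute)
  also have "\<dots> = to_laurent (Poly_Mapping.single 0 c * g)"
    by (simp add: g(2) flip: to_laurent_smult) (simp add: smult_pm_def)
  finally show ?thesis using F forms_smult ideal.subspace_scale[OF I g(1)] unfolding local_sections_iff by blast
qed

lemma local_sections_0:
  assumes I: "ideal.subspace I" shows "0 \<in> local_sections I t \<sigma>"
  unfolding local_sections_iff using ideal.subspace_0[OF I]
  by (auto simp: to_laurent_simps intro!: bexI[of _ 0])

lemma local_sections_diff:
  fixes I :: "('v::finite, 'k::comm_ring_1) hpoly set"
  assumes I: "ideal.subspace I" and F: "F \<in> local_sections I t \<sigma>" and G: "G \<in> local_sections I t \<sigma>"
  shows "F - G \<in> local_sections I t \<sigma>"
proof -
  have "F + smult_pm (- 1) G \<in> local_sections I t \<sigma>"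
    by (intro local_sections_add local_sections_smult I F G)
  moreover have "smult_pm (- 1) G = - G"
    by (simp add: smult_pm_def Poly_Mapping.single_uminus)
  ultimately show ?thesis by simp
qed

lemma local_sections_mono:
  fixes I :: "('v::finite, 'k::comm_ring_1) hpoly set"
  assumes I: "ideal.subspace I" and F: "F \<in> local_sections I t \<sigma>" and sub: "\<sigma> \<subseteq> \<tau>"
  shows "F \<in> local_sections I t \<tau>"
proof -
  obtain N g where g: "g \<in> I" "(\<Prod>i\<in>\<sigma>. lvar i ^ N) * F = to_laurent g"
    using F unfolding local_sections_iff by blast
  have "(\<Prod>i\<in>\<tau>. lvar i ^ N) * F = (\<Prod>i\<in>\<tau> - \<sigma>. lvar i ^ N) * ((\<Prod>i\<in>\<sigma>. lvar i ^ N) * F)"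
    by (subst prod.subset_diff[OF sub finite]) (simp only: mult.assoc)
  also have "\<dots> = to_laurent ((\<Prod>i\<in>\<tau> - \<sigma>. var i ^ N) * g)"
    by (simp add: g(2) to_laurent_simps)
  finally show ?thesis using F ideal.subspace_scale[OF I g(1)] unfolding local_sections_iff by blast
qed

lemma lvar_power_single: "lvar i ^ n = Poly_Mapping.single (Poly_Mapping.single i (int n)) (1::'k::comm_ring_1)"
  by (simp add: lvar_def single_power single_sum)

text \<open>Multiplication by variables from \<open>\<sigma>\<close> leaves the exponents of the other variables alone.\<close>

lemma nonneg_outside_poles:
  fixes F :: "('v::finite, 'k::comm_ring_1) laurent"
  assumes F: "(\<Prod>i\<in>\<sigma>. lvar i ^ N) * F = to_laurent g" and j: "j \<notin> \<sigma>" and k: "k \<in> Poly_Mapping.keys F"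
  shows "0 \<le> Poly_Mapping.lookup k j"
proof -
  let ?e = "\<Sum>i\<in>\<sigma>. Poly_Mapping.single i (int N)"
  have "(\<Prod>i\<in>\<sigma>. lvar i ^ N) = Poly_Mapping.single ?e (1::'k)"
    by (simp add: lvar_power_single single_prod)
  then have "?e + k \<in> Poly_Mapping.keys (to_laurent g)"
    using F k keys_single_times[of ?e F] by auto
  then have "0 \<le> Poly_Mapping.lookup (?e + k) j" by (auto intro: to_laurent_image_nonneg)
  moreover have "Poly_Mapping.lookup ?e j = 0"
    using j by (auto simp: lookup_sum lookup_single when_def intro: sum.neutral)
  ultimately show ?thesis by (simp add: lookup_add)
qed

lemma clear_single_pole:
  fixes F :: "('v::finite, 'k::comm_ring_1) laurent"
  assumes "\<And>k j. k \<in> Poly_Mapping.keys F \<Longrightarrow> j \<noteq> i \<Longrightarrow> 0 \<le> Poly_Mapping.lookup k j"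
  shows "\<exists>N. lvar i ^ N * F \<in> to_laurent ` UNIV"
proof -
  define N where "N = Max (insert 0 ((\<lambda>k. nat (- Poly_Mapping.lookup k i)) ` Poly_Mapping.keys F))"
  have N: "- Poly_Mapping.lookup k i \<le> int N" if "k \<in> Poly_Mapping.keys F" for k
  proof -
    have "nat (- Poly_Mapping.lookup k i) \<le> N" unfolding N_def using that by (intro Max_ge) auto
    then show ?thesis by linarith
  qed
  have "lvar i ^ N * F \<in> to_laurent ` UNIV"
  proof (rule to_laurent_imageI)
    fix k j assume "k \<in> Poly_Mapping.keys (lvar i ^ N * F)"
    then obtain l where l: "k = Poly_Mapping.single i (int N) + l" "l \<in> Poly_Mapping.keys F"
      unfolding lvar_power_single keys_single_times by blast
    show "0 \<le> Poly_Mapping.lookup k j"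
      using N[OF l(2)] assms[OF l(2), of j]
      by (cases "j = i") (auto simp: l(1) lookup_add lookup_single when_def)
  qed
  then show ?thesis ..
qed

text \<open>Each exponent of a monomial of \<open>G\<close> is nonnegative because some other variable suffices to clear
  the denominators of \<open>G\<close>.\<close>

lemma global_section_polynomial:
  fixes G :: "(3, 'k::comm_ring_1) laurent"
  assumes G: "G \<in> forms t" and p: "\<And>i. \<exists>N. lvar i ^ N * G \<in> to_laurent ` UNIV"
  shows "\<exists>g. G = to_laurent g" "t < 0 \<Longrightarrow> G = 0"
proof -
  have nn: "0 \<le> Poly_Mapping.lookup k i" if k: "k \<in> Poly_Mapping.keys G" for k i
  proof -
    obtain j where j: "i \<noteq> (j::3)" using neq_3(1) by metis
    obtain N g where "lvar j ^ N * G = to_laurent g" using p[of j] by blast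
    then have "(\<Prod>i\<in>{j}. lvar i ^ N) * G = to_laurent g" by simp
    then show ?thesis by (rule nonneg_outside_poles) (use j k in auto)
  qed
  then show "\<exists>g. G = to_laurent g" using to_laurent_imageI[of G] by blast
  assume t: "t < 0"
  have "Poly_Mapping.keys G = {}"
  proof (rule ccontr)
    assume "Poly_Mapping.keys G \<noteq> {}"
    then obtain k where k: "k \<in> Poly_Mapping.keys G" by blast
    have "0 \<le> exp_degree k" unfolding exp_degree_def by (intro sum_nonneg nn k)
    moreover have "exp_degree k = t" using G k by (simp add: forms_def)
    ultimately show False using t by simp
  qed
  then show "G = 0" by simp
qed

subsection \<open>Cochain spaces\<close>

lemma cochains_0_iff:
  "s \<in> cochains I t 0 \<longleftrightarrow> (\<exists>a. s = point_cochain a \<and> (\<forall>i. a i \<in> local_sections I t {i}))"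
proof
  assume s: "s \<in> cochains I t 0"
  have "s \<sigma> = point_cochain (\<lambda>i. s {i}) \<sigma>" for \<sigma>
  proof (cases "card \<sigma> = 1")
    case True
    then obtain i where "\<sigma> = {i}" by (meson card_1_singletonE)
    then show ?thesis by simp
  next
    case False
    then show ?thesis using s unfolding cochains_def point_cochain_def
      by (metis (mono_tags, lifting) One_nat_def mem_Collect_eq)
  qed
  then have "s = point_cochain (\<lambda>i. s {i})" ..
  moreover have "s {i} \<in> local_sections I t {i}" for i
    using s unfolding cochains_def by (metis (mono_tags, lifting) One_nat_def card_1_singleton_iff mem_Collect_eq)
  ultimately show "\<exists>a. s = point_cochain a \<and> (\<forall>i. a i \<in> local_sections I t {i})" by blast
next
  assume "\<exists>a. s = point_cochain a \<and> (\<forall>i. a i \<in> local_sections I t {i})"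
  then obtain a where a: "s = point_cochain a" "\<And>i. a i \<in> local_sections I t {i}" by blast
  show "s \<in> cochains I t 0"
    unfolding cochains_def a(1)
    using a(2) by (auto simp: point_cochain_def card_1_singleton_iff)
qed

lemma subspace_cochains:
  fixes I :: "('v::{finite,linorder}, 'k::field) hpoly set"
  assumes I: "ideal.subspace I"
  shows "cochainvs.subspace (cochains I t p)"
  unfolding cochainvs.subspace_def cochains_def smult_cochain_def
  using local_sections_0[OF I] local_sections_add[OF I] local_sections_smult[OF I]
  by (auto simp: smult_pm_def split: if_splits)

lemma subspace_cocycles:
  fixes I :: "('v::{finite,linorder}, 'k::field) hpoly set"
  assumes I: "ideal.subspace I"
  shows "cochainvs.subspace (cocycles I t p)"
  using subspace_cochains[OF I, of t p] unfolding cochainvs.subspace_def cocycles_def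
  by (auto simp: cech_diff_add cech_diff_smult)

lemma subspace_coboundaries:
  fixes I :: "('v::{finite,linorder}, 'k::field) hpoly set"
  assumes I: "ideal.subspace I"
  shows "cochainvs.subspace (coboundaries I t p)"
proof (cases "p = 0")
  case False
  have sub: "cochainvs.subspace (cochains I t (p - 1))" by (rule subspace_cochains[OF I])
  have e: "coboundaries I t p = cech_diff ` cochains I t (p - 1)" using False by (simp add: coboundaries_def)
  interpret l: Vector_Spaces.linear smult_cochain smult_cochain
    "cech_diff :: ('v, 'k) cochain \<Rightarrow> ('v, 'k) cochain"
    by unfold_locales (simp_all add: cech_diff_add cech_diff_smult)
  show ?thesis unfolding e by (rule l.subspace_image[OF sub])
qed (simp add: coboundaries_def)

lemma cech_diff_point_cochain:
  fixes F :: "3 \<Rightarrow> (3, 'k::comm_ring_1) laurent"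
  assumes I: "ideal.subspace I"
    and d: "\<And>i j. i < j \<Longrightarrow> F j - F i \<in> local_sections I t {i, j}"
  shows "cech_diff (point_cochain F) \<in> cocycles I t 1"
  unfolding cocycles_def cochains_def
proof (intro CollectI conjI allI)
  fix \<sigma> :: "3 set"
  show "if card \<sigma> = Suc 1 then cech_diff (point_cochain F) \<sigma> \<in> local_sections I t \<sigma>
    else cech_diff (point_cochain F) \<sigma> = 0"
  proof (cases "card \<sigma> = 2")
    case True
    then show ?thesis
      using card_3_cases[OF True] d less_3 by (auto simp: cech_diff_pair)
  next
    case False
    have "cech_diff (point_cochain F) \<sigma> = 0"
      by (rule cech_diff_support[of 1]) (use False in \<open>auto simp: point_cochain_def\<close>)
    then show ?thesis using False by simp
  qed
qed (rule cech_diff_cech_diff_point)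

lemma coboundaries_1_iff:
  fixes I :: "(3, 'k::comm_ring_1) hpoly set"
  shows "s \<in> coboundaries I t 1 \<longleftrightarrow>
    (\<exists>a. s = cech_diff (point_cochain a) \<and> (\<forall>i. a i \<in> local_sections I t {i}))"
proof -
  have "coboundaries I t 1 = cech_diff ` cochains I t 0" by (simp add: coboundaries_def)
  then have "s \<in> coboundaries I t 1 \<longleftrightarrow> (\<exists>c. s = cech_diff c \<and> c \<in> cochains I t 0)" by (auto simp: image_iff)
  then show ?thesis unfolding cochains_0_iff by blast
qed

lemma coboundaries_le_cocycles:
  fixes I :: "(3, 'k::comm_ring_1) hpoly set"
  assumes I: "ideal.subspace I"
  shows "coboundaries I t 1 \<subseteq> cocycles I t 1"
proof
  fix s assume "s \<in> coboundaries I t 1"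
  then obtain a where a: "s = cech_diff (point_cochain a)" "\<And>i. a i \<in> local_sections I t {i}"
    unfolding coboundaries_1_iff by blast
  show "s \<in> cocycles I t 1"
    unfolding a(1)
    by (intro cech_diff_point_cochain[OF I] local_sections_diff[OF I]; rule local_sections_mono[OF I a(2)]) auto
qed

lemma cech_diff_eq_point_cochain:
  fixes s :: "(3, 'k::comm_ring_1) cochain"
  assumes s: "s \<in> cochains I t 1" and d: "\<And>i j. i < j \<Longrightarrow> s {i, j} = F j - F i"
  shows "s = cech_diff (point_cochain F)"
proof
  fix \<sigma> :: "3 set"
  show "s \<sigma> = cech_diff (point_cochain F) \<sigma>"
  proof (cases "card \<sigma> = 2")
    case True
    then show ?thesis using card_3_cases[OF True] d less_3 by (auto simp: cech_diff_pair)
  next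
    case False
    then have "cech_diff (point_cochain F) \<sigma> = 0"
      by (intro cech_diff_support[of 1]) (auto simp: point_cochain_def)
    moreover have "s \<sigma> = 0" using s False unfolding cochains_def
      by (metis (mono_tags, lifting) Suc_1 mem_Collect_eq)
    ultimately show ?thesis by simp
  qed
qed

text \<open>The first cohomology of the structure sheaf vanishes in every degree: split each section on a
  double intersection according to the sign of the exponent of the first variable.\<close>

lemma cocycle_potential:
  fixes I :: "(3, 'k::comm_ring_1) hpoly set"
  assumes s: "s \<in> cocycles I t 1"
  obtains F where "s = cech_diff (point_cochain F)" "\<And>i. F i \<in> forms t"
    "\<And>i. \<exists>N. lvar i ^ N * F i \<in> to_laurent ` UNIV"
proof -
  have sc: "s \<in> cochains I t 1" and ds: "cech_diff s = 0" using s by (auto simp: cocycles_def)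
  have ls: "s {i, j} \<in> local_sections I t {i, j}" if "i \<noteq> j" for i j
    using sc[unfolded cochains_def, THEN CollectD, THEN spec, of "{i, j}"] that by simp
  have nn: "0 \<le> Poly_Mapping.lookup k l" if ij: "i \<noteq> j" and kl: "k \<in> Poly_Mapping.keys (s {i, j})" "l \<noteq> i" "l \<noteq> j" for i j k l
  proof -
    obtain N g where "(\<Prod>i\<in>{i, j}. lvar i ^ N) * s {i, j} = to_laurent g"
      using ls[OF ij] unfolding local_sections_iff by blast
    then show ?thesis by (rule nonneg_outside_poles) (use kl in auto)
  qed
  have fo: "s {i, j} \<in> forms t" if "i \<noteq> j" for i j
    using ls[OF that] unfolding local_sections_iff by blast
  have cyc: "s {1, 2} - s {0, 2} + s {0, 1} = 0"
    using fun_cong[OF ds, of UNIV] by (simp add: cech_diff_triple)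
  let ?P = "\<lambda>k. Poly_Mapping.lookup k (0::3) < (0::int)"
  \<comment> \<open>The section over the intersection of the last two opens has no pole along the first coordinate line.\<close>
  have z: "restrict_keys ?P (s {1, 2}) = 0"
    using nn[of 1 2 _ 0] neq_3
    by (intro poly_mapping_eqI) (auto simp: lookup_restrict_keys in_keys_iff not_less[symmetric])
  have "s {0, 2} = s {1, 2} + s {0, 1}" using cyc by (simp add: algebra_simps)
  then have r: "restrict_keys ?P (s {0, 2}) = restrict_keys ?P (s {0, 1})"
    using z by (simp add: restrict_keys_add)
  define F where "F = (\<lambda>i::3. if i = 0 then - restrict_keys ?P (s {0, 1})
    else if i = 1 then restrict_keys (\<lambda>k. \<not> ?P k) (s {0, 1}) else restrict_keys (\<lambda>k. \<not> ?P k) (s {0, 2}))"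
  have F: "F 0 = - restrict_keys ?P (s {0, 1})" "F 1 = restrict_keys (\<lambda>k. \<not> ?P k) (s {0, 1})"
    "F 2 = restrict_keys (\<lambda>k. \<not> ?P k) (s {0, 2})" using neq_3 by (auto simp: F_def)
  have d01: "s {0, 1} = F 1 - F 0"
    unfolding F using restrict_keys_split[of ?P "s {0, 1}"] by (simp add: add.commute)
  have d02: "s {0, 2} = F 2 - F 0"
    unfolding F r[symmetric] using restrict_keys_split[of ?P "s {0, 2}"] by (simp add: add.commute)
  have d12: "s {1, 2} = F 2 - F 1" using cyc d01 d02 by (simp add: algebra_simps)
  show ?thesis
  proof (rule that)
    show "s = cech_diff (point_cochain F)"
    proof (rule cech_diff_eq_point_cochain[OF sc])
      fix i j :: 3 assume "i < j"
      then show "s {i, j} = F j - F i"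
        using exhaust_3'[of i] exhaust_3'[of j] d01 d02 d12 less_3 by (auto dest: less_asym)
    qed
    show "F i \<in> forms t" for i
      using exhaust_3'[of i] fo[of 0 1] fo[of 0 2] neq_3
      by (auto simp: F intro!: forms_uminus restrict_keys_forms)
    have key: "0 \<le> Poly_Mapping.lookup k j" if k: "k \<in> Poly_Mapping.keys (F i)" and j: "j \<noteq> i" for i j k
    proof -
      consider "i = 0" | "i = 1" | "i = 2" using exhaust_3' by blast
      then show ?thesis
      proof cases
        case 1
        have 01: "k \<in> Poly_Mapping.keys (s {0, 1})" using k by (simp add: 1 F keys_restrict_keys)
        have 02: "k \<in> Poly_Mapping.keys (s {0, 2})"
          using k by (simp add: 1 F keys_restrict_keys flip: r)
        show ?thesis using j 1 exhaust_3'[of j] nn[OF _ 01, of 2] nn[OF _ 02, of 1] neq_3 by auto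
      next
        case 2
        have "k \<in> Poly_Mapping.keys (s {0, 1})" "\<not> ?P k" using k by (simp_all add: 2 F keys_restrict_keys)
        then show ?thesis using j 2 exhaust_3'[of j] nn[of 0 1 k 2] neq_3 by auto
      next
        case 3
        have "k \<in> Poly_Mapping.keys (s {0, 2})" "\<not> ?P k" using k by (simp_all add: 3 F keys_restrict_keys)
        then show ?thesis using j 3 exhaust_3'[of j] nn[of 0 2 k 1] neq_3 by auto
      qed
    qed
    show "\<exists>N. lvar i ^ N * F i \<in> to_laurent ` UNIV" for i
      by (rule clear_single_pole) (rule key)
  qed
qed

section \<open>Comparison of Cech cohomology with finite-dimensional quotients\<close>

lemma local_sections_singleI:
  fixes I :: "('v::finite, 'k::comm_ring_1) hpoly set"
  assumes "F \<in> forms t" "lvar i ^ N * F = to_laurent g" "g \<in> I"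
  shows "F \<in> local_sections I t {i}"
  unfolding local_sections_iff using assms by auto

lemma local_sections_singleE:
  fixes I :: "('v::finite, 'k::comm_ring_1) hpoly set"
  assumes "F \<in> local_sections I t {i}"
  obtains N g where "lvar i ^ N * F = to_laurent g" "g \<in> I"
  using assms unfolding local_sections_iff by auto

lemma local_sections_forms: "F \<in> local_sections I t \<sigma> \<Longrightarrow> F \<in> forms t"
  unfolding local_sections_iff by blast

lemma local_sections_pairI:
  fixes I :: "('v::finite, 'k::comm_ring_1) hpoly set"
  assumes "i \<noteq> j" "F \<in> forms t" "lvar i ^ N * (lvar j ^ N * F) = to_laurent g" "g \<in> I"
  shows "F \<in> local_sections I t {i, j}"
proof -
  have "(\<Prod>i\<in>{i, j}. lvar i ^ N) * F = to_laurent g"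
    using assms(1,3) by (simp only: prod.insert finite.intros insert_iff empty_iff simp_thms prod.empty mult_1_right mult.assoc)
  then show ?thesis unfolding local_sections_iff using assms by blast
qed

text \<open>The line \<open>l = 0\<close> misses the scheme of \<open>I\<close>: modulo \<open>I\<close>, a power of every variable is a multiple of
  \<open>l\<close>.\<close>

locale line_section =
  fixes I :: "(3, 'k::field) hpoly set" and l :: "(3, 'k) hpoly" and u :: "3 \<Rightarrow> (3, 'k) hpoly" and K :: nat
  assumes I: "ideal.subspace I" and l: "l \<in> forms 1" and K: "0 < K"
    and u: "\<And>i. u i \<in> forms (K - 1)" and lu: "\<And>i. var i ^ K - l * u i \<in> I"
begin

lemmas add_I = ideal.subspace_add[OF I]
  and diff_I = ideal.subspace_diff[OF I]
  and mult_I = ideal.subspace_scale[OF I]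
  and zero_I = ideal.subspace_0[OF I]

lemma mult_I': "f \<in> I \<Longrightarrow> f * g \<in> I"
  using mult_I[of f g] by (simp only: mult.commute)

lemma lu_power: "var i ^ (K * M) - l ^ M * u i ^ M \<in> I"
  using ideal_cong_power[OF I lu, of i M] by (simp only: power_mult power_mult_distrib)

lemma l_power_form: "l ^ M \<in> forms M"
  using forms_power[OF l, of M] by simp

text \<open>A linear form that vanishes nowhere on the scheme is not a zero divisor.\<close>

lemma sat_forms_l_cancel:
  assumes "f \<in> forms t" "l * f \<in> sat_forms I (Suc t)"
  shows "f \<in> sat_forms I t"
  unfolding sat_forms_def
proof (intro CollectI conjI allI assms(1))
  fix i
  obtain N where N: "var i ^ N * (l * f) \<in> I" using assms(2) unfolding sat_forms_def by blast
  have "u i * (var i ^ N * (l * f)) + (var i ^ K - l * u i) * (var i ^ N * f) \<in> I"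
    by (intro add_I mult_I N mult_I' lu)
  moreover have "u i * (var i ^ N * (l * f)) + (var i ^ K - l * u i) * (var i ^ N * f) = var i ^ (K + N) * f"
    by (simp only: algebra_simps power_add)
  ultimately show "\<exists>N. var i ^ N * f \<in> I" by metis
qed

definition potential :: "nat \<Rightarrow> (3, 'k) hpoly \<Rightarrow> 3 \<Rightarrow> (3, 'k) laurent" where
  "potential M f i = to_laurent (f * u i ^ M) * lvar_inv i ^ (K * M)"

text \<open>Division by \<open>l ^ M\<close>: modulo \<open>I\<close>, the linear form \<open>l\<close> is invertible where \<open>var i\<close> is, with
  inverse \<open>u i / var i ^ K\<close>.  The connecting homomorphism then gives a 1-cocycle.\<close>

definition connecting :: "nat \<Rightarrow> (3, 'k) hpoly \<Rightarrow> (3, 'k) cochain" where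
  "connecting M f = cech_diff (point_cochain (potential M f))"

lemma potential_clear: "lvar i ^ (K * M) * potential M f i = to_laurent (f * u i ^ M)"
proof -
  have "lvar i ^ (K * M) * potential M f i = to_laurent (f * u i ^ M) * (lvar i ^ (K * M) * lvar_inv i ^ (K * M))"
    unfolding potential_def by (simp only: mult.left_commute)
  then show ?thesis by simp
qed

lemma potential_forms:
  assumes "f \<in> forms (t + M)" shows "potential M f i \<in> forms (int t)"
proof -
  have "f * u i ^ M \<in> forms (t + M + M * (K - 1))" by (intro forms_mult assms forms_power u)
  then have "to_laurent (f * u i ^ M) \<in> forms (int (t + M + M * (K - 1)))" by (simp only: to_laurent_forms)
  then have "potential M f i \<in> forms (int (t + M + M * (K - 1)) + - int (K * M))"
    unfolding potential_def by (intro forms_mult forms_lvar_power)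
  moreover have "t + M + M * (K - 1) = t + K * M" using K by (cases K) auto
  moreover have "int (t + K * M) + - int (K * M) = int t" by simp
  ultimately show ?thesis by (simp only:)
qed

lemma linear_connecting: "Vector_Spaces.linear smult_pm smult_cochain (connecting M)"
proof -
  have a: "potential M (f + g) i = potential M f i + potential M g i" for f g i
    by (simp only: potential_def distrib_right to_laurent_simps)
  have "smult_pm c f * u i ^ M = smult_pm c (f * u i ^ M)" for c f i
    by (simp only: smult_pm_def mult.assoc)
  then have s: "potential M (smult_pm c f) i = smult_pm c (potential M f i)" for c f i
    by (simp only: potential_def to_laurent_smult) (simp only: smult_pm_def mult.assoc)
  have A: "connecting M (f + g) = connecting M f + connecting M g" for f g
    unfolding connecting_def a point_cochain_add[symmetric] cech_diff_add[symmetric]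
    by (simp only: a[abs_def])
  have S: "connecting M (smult_pm c f) = smult_cochain c (connecting M f)" for c f
    unfolding connecting_def cech_diff_smult[symmetric] point_cochain_smult[symmetric]
    by (simp only: s[abs_def])
  show ?thesis by unfold_locales (simp_all only: A S)
qed

lemma connecting_cocycle:
  assumes f: "f \<in> forms (t + M)" shows "connecting M f \<in> cocycles I (int t) 1"
  unfolding connecting_def
proof (rule cech_diff_point_cochain[OF I])
  fix i j :: 3 assume ij: "i < j"
  let ?N = "K * M"
  have inI: "f * (u j ^ M * (var i ^ ?N - l ^ M * u i ^ M) - u i ^ M * (var j ^ ?N - l ^ M * u j ^ M)) \<in> I"
    by (intro mult_I diff_I lu_power)
  have "lvar i ^ ?N * (lvar j ^ ?N * (potential M f j - potential M f i)) =
      lvar i ^ ?N * (lvar j ^ ?N * potential M f j) - lvar j ^ ?N * (lvar i ^ ?N * potential M f i)"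
    by (simp only: right_diff_distrib mult.left_commute)
  then have "lvar i ^ ?N * (lvar j ^ ?N * (potential M f j - potential M f i)) =
      to_laurent (var i ^ ?N * (f * u j ^ M) - var j ^ ?N * (f * u i ^ M))"
    unfolding potential_clear by (simp only: to_laurent_simps)
  moreover have "var i ^ ?N * (f * u j ^ M) - var j ^ ?N * (f * u i ^ M) =
      f * (u j ^ M * (var i ^ ?N - l ^ M * u i ^ M) - u i ^ M * (var j ^ ?N - l ^ M * u j ^ M))"
    by (simp only: algebra_simps)
  ultimately have "lvar i ^ ?N * (lvar j ^ ?N * (potential M f j - potential M f i)) =
      to_laurent (f * (u j ^ M * (var i ^ ?N - l ^ M * u i ^ M) - u i ^ M * (var j ^ ?N - l ^ M * u j ^ M)))"
    by (simp only:)
  then show "potential M f j - potential M f i \<in> local_sections I (int t) {i, j}"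
    using ij inI by (intro local_sections_pairI forms_diff potential_forms f) auto
qed

lemma connecting_coboundaryI:
  assumes f: "f \<in> forms (t + M)" and g: "g \<in> forms t" and s: "f - l ^ M * g \<in> sat_forms I (t + M)"
  shows "connecting M f \<in> coboundaries I (int t) 1"
  unfolding coboundaries_1_iff
proof (intro exI conjI allI)
  let ?a = "\<lambda>i. potential M f i - to_laurent g"
  have "cech_diff (point_cochain (\<lambda>_::3. to_laurent g)) \<sigma> = 0" for \<sigma>
  proof (cases "card \<sigma> = 2")
    case True
    then show ?thesis using card_3_cases[OF True] less_3 by (auto simp: cech_diff_pair)
  qed (rule cech_diff_support[of 1]; auto simp: point_cochain_def)
  then show "connecting M f = cech_diff (point_cochain ?a)"
    unfolding connecting_def point_cochain_diff cech_diff_minus by (auto simp: fun_eq_iff)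
  fix i
  obtain N where N: "var i ^ N * (f - l ^ M * g) \<in> I" using s unfolding sat_forms_def by blast
  let ?h = "u i ^ M * (var i ^ N * (f - l ^ M * g)) - (var i ^ N * g) * (var i ^ (K * M) - l ^ M * u i ^ M)"
  show "?a i \<in> local_sections I (int t) {i}"
  proof (rule local_sections_singleI)
    show "?a i \<in> forms (int t)" using g by (intro forms_diff potential_forms f) (simp only: to_laurent_forms)
    show "?h \<in> I" by (intro diff_I mult_I N lu_power)
    have "lvar i ^ (N + K * M) * ?a i =
        lvar i ^ N * (lvar i ^ (K * M) * potential M f i) - lvar i ^ N * (lvar i ^ (K * M) * to_laurent g)"
      by (simp only: power_add right_diff_distrib mult.assoc)
    also have "\<dots> = to_laurent (var i ^ N * (f * u i ^ M) - var i ^ N * (var i ^ (K * M) * g))"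
      unfolding potential_clear by (simp only: to_laurent_simps)
    also have "var i ^ N * (f * u i ^ M) - var i ^ N * (var i ^ (K * M) * g) = ?h"
      by (simp only: algebra_simps)
    finally show "lvar i ^ (N + K * M) * ?a i = to_laurent ?h" .
  qed
qed

text \<open>If the cocycle is a coboundary, the local quotients of \<open>f\<close> by \<open>l ^ M\<close> can be corrected by sections
  of the ideal so that they agree.  They are then restrictions of a polynomial \<open>g\<close>.\<close>

lemma connecting_coboundaryD:
  assumes f: "f \<in> forms (t + M)" and c: "connecting M f \<in> coboundaries I (int t) 1"
  shows "\<exists>g\<in>forms t. f - l ^ M * g \<in> sat_forms I (t + M)"
proof -
  obtain a where a: "connecting M f = cech_diff (point_cochain a)"
    and ai: "\<And>i. a i \<in> local_sections I (int t) {i}"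
    using c unfolding coboundaries_1_iff by blast
  have d: "potential M f j - potential M f i = a j - a i" if "i < j" for i j :: 3
    using fun_cong[OF a, of "{i, j}"] that by (simp add: connecting_def cech_diff_pair)
  define G where "G = potential M f 0 - a 0"
  have G: "G = potential M f i - a i" for i
    using exhaust_3'[of i] d[of 0 1] d[of 0 2] less_3 unfolding G_def by (auto simp: algebra_simps)
  have Gf: "G \<in> forms (int t)"
    unfolding G_def by (intro forms_diff potential_forms f local_sections_forms[OF ai])
  have clear: "\<exists>N. lvar i ^ N * G \<in> to_laurent ` UNIV" for i
  proof -
    obtain N h where h: "lvar i ^ N * a i = to_laurent h" by (rule local_sections_singleE[OF ai])
    have "lvar i ^ (N + K * M) * G =
        lvar i ^ N * (lvar i ^ (K * M) * potential M f i) - lvar i ^ (K * M) * (lvar i ^ N * a i)"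
      unfolding G[of i] by (simp only: power_add right_diff_distrib mult.assoc mult.left_commute)
    also have "\<dots> = to_laurent (var i ^ N * (f * u i ^ M) - var i ^ (K * M) * h)"
      unfolding potential_clear h by (simp only: to_laurent_simps)
    finally show ?thesis by blast
  qed
  obtain g where g: "G = to_laurent g" using global_section_polynomial(1)[OF Gf clear] by blast
  have gf: "g \<in> forms t" using Gf unfolding g to_laurent_forms .
  show ?thesis
  proof (rule bexI[OF _ gf], unfold sat_forms_def, intro CollectI conjI allI)
    show "f - l ^ M * g \<in> forms (t + M)"
      using forms_mult[OF l_power_form gf, of M] by (intro forms_diff f) (simp only: add.commute)
    fix i
    obtain N h where h: "lvar i ^ N * a i = to_laurent h" "h \<in> I" by (rule local_sections_singleE[OF ai])
    have ag: "a i = potential M f i - to_laurent g" using G[of i] unfolding g by (simp add: algebra_simps)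
    have "to_laurent (var i ^ (K * M) * h) = lvar i ^ (K * M) * (lvar i ^ N * a i)"
      unfolding h(1) by (simp only: to_laurent_simps)
    also have "\<dots> = lvar i ^ N * (lvar i ^ (K * M) * potential M f i) - lvar i ^ N * (lvar i ^ (K * M) * to_laurent g)"
      unfolding ag by (simp only: right_diff_distrib mult.left_commute)
    also have "\<dots> = to_laurent (var i ^ N * (f * u i ^ M) - var i ^ N * (var i ^ (K * M) * g))"
      unfolding potential_clear by (simp only: to_laurent_simps)
    finally have e: "var i ^ (K * M) * h = var i ^ N * (f * u i ^ M) - var i ^ N * (var i ^ (K * M) * g)"
      by (simp only: to_laurent_inj)
    have "l ^ M * (var i ^ (K * M) * h) + (var i ^ N * f) * (var i ^ (K * M) - l ^ M * u i ^ M) \<in> I"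
      by (intro add_I mult_I h lu_power)
    moreover have "l ^ M * (var i ^ (K * M) * h) + (var i ^ N * f) * (var i ^ (K * M) - l ^ M * u i ^ M) =
        var i ^ (N + K * M) * (f - l ^ M * g)"
      unfolding e by (simp only: algebra_simps power_add)
    ultimately show "\<exists>N. var i ^ N * (f - l ^ M * g) \<in> I" by metis
  qed
qed

text \<open>Two local sections that represent the quotient of the same function by \<open>l ^ M\<close> differ by a section
  of the ideal.\<close>

lemma local_sections_potential_diff:
  assumes F: "F \<in> forms (int t)" "lvar i ^ N * F = to_laurent f'" and f: "f \<in> forms (t + M)"
    and c: "var i ^ N * f - l ^ M * f' \<in> I"
  shows "F - potential M f i \<in> local_sections I (int t) {i}"
proof (rule local_sections_singleI)
  let ?h = "f' * (var i ^ (K * M) - l ^ M * u i ^ M) - u i ^ M * (var i ^ N * f - l ^ M * f')"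
  show "F - potential M f i \<in> forms (int t)" by (intro forms_diff F potential_forms f)
  show "?h \<in> I" by (intro diff_I mult_I lu_power c)
  have "lvar i ^ (N + K * M) * (F - potential M f i) =
      lvar i ^ (K * M) * (lvar i ^ N * F) - lvar i ^ N * (lvar i ^ (K * M) * potential M f i)"
    by (simp only: power_add right_diff_distrib mult.assoc mult.left_commute)
  also have "\<dots> = to_laurent (var i ^ (K * M) * f' - var i ^ N * (f * u i ^ M))"
    unfolding potential_clear F(2) by (simp only: to_laurent_simps)
  also have "var i ^ (K * M) * f' - var i ^ N * (f * u i ^ M) = ?h"
    by (simp only: algebra_simps)
  finally show "lvar i ^ (N + K * M) * (F - potential M f i) = to_laurent ?h" .
qed

lemma forms_multiple_of_l:
  assumes f: "f \<in> forms (Suc n)" and n: "3 * K \<le> n"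
  obtains f' where "f' \<in> forms n" "f - l * f' \<in> I"
proof -
  obtain c where c: "f = (\<Sum>i\<in>UNIV. c i * var i ^ K)" "\<And>i. c i \<in> forms (Suc n - K)"
    by (rule forms_high_degree[OF f, of K]) (use n in auto)
  define f' where "f' = (\<Sum>i\<in>UNIV. c i * u i)"
  have "c i * u i \<in> forms n" for i
  proof -
    have "Suc n - K + (K - 1) = n" using n K by simp
    then show ?thesis using forms_mult[OF c(2) u, of i i] by (simp only:)
  qed
  then have f': "f' \<in> forms n" unfolding f'_def by (intro forms_sum)
  have "f - l * f' = (\<Sum>i\<in>UNIV. c i * (var i ^ K - l * u i))"
    unfolding c(1) f'_def sum_distrib_left sum_subtractf[symmetric]
    by (intro sum.cong refl) (simp only: algebra_simps)
  also have "\<dots> \<in> I" by (intro ideal.subspace_sum[OF I] mult_I lu)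
  finally show ?thesis using that f' by blast
qed

text \<open>Modulo \<open>I\<close>, a form of high degree has a factor \<open>l\<close>, and this factor cancels.\<close>

lemma connecting_reduce:
  assumes f: "f \<in> forms (t + Suc M)" and M: "3 * K \<le> t + M"
  obtains f' where "f' \<in> forms (t + M)" "connecting (Suc M) f - connecting M f' \<in> coboundaries I (int t) 1"
proof -
  obtain f' where f': "f' \<in> forms (t + M)" and ff: "f - l * f' \<in> I"
    using forms_multiple_of_l[of f "t + M"] f M by (metis add_Suc_right)
  have "connecting (Suc M) f - connecting M f' \<in> coboundaries I (int t) 1"
    unfolding coboundaries_1_iff
  proof (intro exI conjI allI)
    show "connecting (Suc M) f - connecting M f' =
        cech_diff (point_cochain (\<lambda>i. potential (Suc M) f i - potential M f' i))"
      unfolding connecting_def point_cochain_diff cech_diff_minus ..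
    fix i
    show "potential (Suc M) f i - potential M f' i \<in> local_sections I (int t) {i}"
    proof (rule local_sections_potential_diff[OF potential_forms[OF f] potential_clear f'])
      have "f' * (var i ^ (K * Suc M) - l ^ Suc M * u i ^ Suc M) - (l ^ M * u i ^ Suc M) * (f - l * f') \<in> I"
        by (intro diff_I mult_I lu_power ff)
      moreover have "f' * (var i ^ (K * Suc M) - l ^ Suc M * u i ^ Suc M) - (l ^ M * u i ^ Suc M) * (f - l * f') =
          var i ^ (K * Suc M) * f' - l ^ M * (f * u i ^ Suc M)"
        by (simp only: algebra_simps power_Suc)
      ultimately show "var i ^ (K * Suc M) * f' - l ^ M * (f * u i ^ Suc M) \<in> I" by metis
    qed
  qed
  then show ?thesis using that f' by blast
qed

text \<open>Write the cocycle as a difference of local functions \<open>F i\<close>.  They fit together on the scheme; since a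
  power of \<open>l\<close> is a combination of the \<open>var i ^ N\<close> that clear their denominators, the product of
  this power with the common function on the scheme is given by a polynomial.  The exponent that this
  yields depends on the cocycle and is then lowered to \<open>M\<close>.\<close>

lemma connecting_surj:
  assumes s: "s \<in> cocycles I (int t) 1" and M: "3 * K \<le> t + M"
  shows "\<exists>f\<in>forms (t + M). s - connecting M f \<in> coboundaries I (int t) 1"
proof -
  obtain F where F: "s = cech_diff (point_cochain F)" "\<And>i. F i \<in> forms (int t)"
    and Fc: "\<And>i. \<exists>N. lvar i ^ N * F i \<in> to_laurent ` UNIV"
    by (rule cocycle_potential[OF s]) (rule that)
  obtain N1 where N1: "\<And>i. lvar i ^ N1 i * F i \<in> to_laurent ` UNIV" using Fc by metis
  have ls: "\<exists>N. \<exists>g\<in>I. (\<Prod>i\<in>{i, j}. lvar i ^ N) * (F j - F i) = to_laurent g" if ij: "i < j" for i j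
  proof -
    have "s {i, j} \<in> local_sections I (int t) {i, j}"
    proof -
      have "s \<in> cochains I (int t) 1" using s by (simp add: cocycles_def)
      from this[unfolded cochains_def, THEN CollectD, THEN spec, of "{i, j}"] show ?thesis using ij by simp
    qed
    moreover have "s {i, j} = F j - F i" unfolding F(1) using ij by (rule cech_diff_pair[THEN trans]) simp
    ultimately show ?thesis unfolding local_sections_iff by simp
  qed
  obtain n01 where n01: "\<exists>g\<in>I. (\<Prod>i\<in>{0, 1}. lvar i ^ n01) * (F 1 - F 0) = to_laurent g"
    using ls[OF less_3(1)] by blast
  obtain n12 where n12: "\<exists>g\<in>I. (\<Prod>i\<in>{1, 2}. lvar i ^ n12) * (F 2 - F 1) = to_laurent g"
    using ls[OF less_3(2)] by blast
  obtain n02 where n02: "\<exists>g\<in>I. (\<Prod>i\<in>{0, 2}. lvar i ^ n02) * (F 2 - F 0) = to_laurent g"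
    using ls[OF less_3(3)] by blast
  define N where "N = N1 0 + N1 1 + N1 2 + n01 + n12 + n02"
  have N1N: "N1 i \<le> N" for i using exhaust_3'[of i] unfolding N_def by auto
  have "n01 \<le> N" "n12 \<le> N" "n02 \<le> N" unfolding N_def by auto
  note sh = ideal_shift[OF I n01 this(1)] ideal_shift[OF I n12 this(2)] ideal_shift[OF I n02 this(3)]
  have pairs: "(i = 0 \<and> j = 1) \<or> (i = 1 \<and> j = 2) \<or> (i = 0 \<and> j = 2)" if "i < j" for i j :: 3
    using exhaust_3'[of i] exhaust_3'[of j] that less_3 by (auto dest: less_asym)
  have lsN: "\<exists>g\<in>I. (\<Prod>i\<in>{i, j}. lvar i ^ N) * (F j - F i) = to_laurent g" if "i < j" for i j
    using pairs[OF that] by (elim disjE conjE) (simp_all only: sh)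
  have "\<exists>g. lvar i ^ N * F i = to_laurent g" for i
  proof -
    obtain g where g: "lvar i ^ N1 i * F i = to_laurent g" using N1[of i] by blast
    have "lvar i ^ N * F i = lvar i ^ (N - N1 i) * (lvar i ^ N1 i * F i)"
      using N1N[of i] by (simp only: mult.assoc[symmetric] power_add[symmetric] le_add_diff_inverse2)
    also have "\<dots> = to_laurent (var i ^ (N - N1 i) * g)" unfolding g by (simp only: to_laurent_simps)
    finally show ?thesis ..
  qed
  then obtain p where p: "\<And>i. lvar i ^ N * F i = to_laurent (p i)" by metis
  have pf: "p i \<in> forms (t + N)" for i
  proof -
    have "lvar i ^ N * F i \<in> forms (int N + int t)" by (intro forms_mult forms_lvar_power F)
    then show ?thesis unfolding p by (simp only: to_laurent_forms of_nat_add[symmetric] add.commute)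
  qed
  have comp: "var i ^ N * p j - var j ^ N * p i \<in> I" if ij: "i < j" for i j
  proof -
    obtain g where g: "g \<in> I" "(\<Prod>i\<in>{i, j}. lvar i ^ N) * (F j - F i) = to_laurent g"
      using lsN[OF ij] by blast
    have "(\<Prod>i\<in>{i, j}. lvar i ^ N) = lvar i ^ N * (lvar j ^ N :: (3, 'k) laurent)" using ij by simp
    then have "to_laurent g = lvar i ^ N * (lvar j ^ N * F j) - lvar j ^ N * (lvar i ^ N * F i)"
      unfolding g(2)[symmetric] by (simp only: right_diff_distrib mult.assoc mult.left_commute)
    also have "\<dots> = to_laurent (var i ^ N * p j - var j ^ N * p i)"
      unfolding p by (simp only: to_laurent_simps)
    finally show ?thesis using g(1) by (simp only: to_laurent_inj)
  qed
  have comp': "var j ^ N * p i - var i ^ N * p j \<in> I" for i j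
  proof (cases i j rule: linorder_cases)
    case less
    have "0 - (var i ^ N * p j - var j ^ N * p i) \<in> I" by (intro diff_I zero_I comp less)
    then show ?thesis by simp
  next
    case equal
    then show ?thesis using zero_I by simp
  next
    case greater
    then show ?thesis by (rule comp)
  qed
  \<comment> \<open>The polynomial that represents \<open>l ^ M'\<close> times the common function of the \<open>F i\<close> on the scheme.\<close>
  have big: "\<exists>f\<in>forms (t + M'). s - connecting M' f \<in> coboundaries I (int t) 1" if M': "3 * N \<le> M'" for M'
  proof -
    obtain c where c: "l ^ M' = (\<Sum>i\<in>UNIV. c i * var i ^ N)" "\<And>i. c i \<in> forms (M' - N)"
      by (rule forms_high_degree[OF l_power_form[of M'], of N]) (use M' in auto)
    define f where "f = (\<Sum>i\<in>UNIV. c i * p i)"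
    have "c i * p i \<in> forms (t + M')" for i
    proof -
      have "M' - N + (t + N) = t + M'" using M' by simp
      then show ?thesis using forms_mult[OF c(2) pf, of i i] by (simp only:)
    qed
    then have f: "f \<in> forms (t + M')" unfolding f_def by (intro forms_sum)
    have "s - connecting M' f \<in> coboundaries I (int t) 1"
      unfolding coboundaries_1_iff
    proof (intro exI conjI allI)
      show "s - connecting M' f = cech_diff (point_cochain (\<lambda>i. F i - potential M' f i))"
        unfolding connecting_def point_cochain_diff cech_diff_minus F(1) ..
      fix j
      show "F j - potential M' f j \<in> local_sections I (int t) {j}"
      proof (rule local_sections_potential_diff[OF F(2) p f])
        have "var j ^ N * f - l ^ M' * p j = (\<Sum>i\<in>UNIV. c i * (var j ^ N * p i - var i ^ N * p j))"
          unfolding c(1) f_def sum_distrib_left sum_distrib_right sum_subtractf[symmetric]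
          by (intro sum.cong refl) (simp only: algebra_simps)
        also have "\<dots> \<in> I" by (intro ideal.subspace_sum[OF I] mult_I comp')
        finally show "var j ^ N * f - l ^ M' * p j \<in> I" .
      qed
    qed
    with f show ?thesis ..
  qed
  have down: "\<exists>f\<in>forms (t + M). s - connecting M f \<in> coboundaries I (int t) 1"
    if "\<exists>f\<in>forms (t + (M + n)). s - connecting (M + n) f \<in> coboundaries I (int t) 1" for n
    using that
  proof (induction n)
    case (Suc n)
    obtain f where f: "f \<in> forms (t + Suc (M + n))" "s - connecting (Suc (M + n)) f \<in> coboundaries I (int t) 1"
      using Suc.prems unfolding add_Suc_right[of M n] by blast
    obtain f' where f': "f' \<in> forms (t + (M + n))"
      "connecting (Suc (M + n)) f - connecting (M + n) f' \<in> coboundaries I (int t) 1"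
      by (rule connecting_reduce[OF f(1)]) (use M in auto)
    have "(s - connecting (Suc (M + n)) f) + (connecting (Suc (M + n)) f - connecting (M + n) f')
        \<in> coboundaries I (int t) 1"
      using cochainvs.subspace_add[OF subspace_coboundaries[OF I] f(2) f'(2)] .
    then have "s - connecting (M + n) f' \<in> coboundaries I (int t) 1"
      by (simp only: add_diff_eq diff_add_cancel)
    then show ?case using f'(1) by (intro Suc.IH bexI)
  qed (simp only: add_0_right)
  show ?thesis by (rule down[of "3 * N"], rule big) simp
qed

text \<open>Here \<open>X\<close> represents the cokernel of multiplication by \<open>l ^ M\<close>, from degree \<open>t\<close> to degree
  \<open>t + M\<close> of the homogeneous coordinate ring of the scheme.  In degrees from \<open>3 * K\<close> on,
  multiplication by \<open>l\<close> is bijective on that ring, which makes the cokernel independent of \<open>M\<close>.\<close>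

theorem h1_eq_dim:
  assumes M: "3 * K \<le> t + M" and X: "polyvs.subspace X" "X \<subseteq> forms (t + M)"
    and inj: "\<And>x g. x \<in> X \<Longrightarrow> g \<in> forms t \<Longrightarrow> x - l ^ M * g \<in> sat_forms I (t + M) \<Longrightarrow> x = 0"
    and surj: "\<And>f. f \<in> forms (t + M) \<Longrightarrow> \<exists>x\<in>X. \<exists>g\<in>forms t. (f - x) - l ^ M * g \<in> sat_forms I (t + M)"
  shows "h_ideal 1 I (int t) = polyvs.dim X"
  unfolding h_ideal_def
proof -
  interpret vp: vector_space_pair "smult_pm :: 'k \<Rightarrow> (3, 'k) hpoly \<Rightarrow> _"
    "smult_cochain :: 'k \<Rightarrow> (3, 'k) cochain \<Rightarrow> _" by unfold_locales
  interpret c: Vector_Spaces.linear smult_pm smult_cochain "connecting M" by (rule linear_connecting)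
  show "cochainvs.quotient_dim (cocycles I (int t) 1) (coboundaries I (int t) 1) = polyvs.dim X"
  proof (rule vp.quotient_dim_eqI[OF linear_connecting X(1) subspace_coboundaries[OF I]
      subspace_cocycles[OF I] coboundaries_le_cocycles[OF I]])
    show "connecting M ` X \<subseteq> cocycles I (int t) 1" using X(2) connecting_cocycle by blast
    fix x assume x: "x \<in> X" "connecting M x \<in> coboundaries I (int t) 1"
    then obtain g where "g \<in> forms t" "x - l ^ M * g \<in> sat_forms I (t + M)"
      using connecting_coboundaryD[OF subsetD[OF X(2)]] by blast
    then show "x = 0" using inj x(1) by blast
  next
    fix s assume "s \<in> cocycles I (int t) 1"
    then obtain f where f: "f \<in> forms (t + M)" "s - connecting M f \<in> coboundaries I (int t) 1"
      using connecting_surj M by blast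
    obtain x g where x: "x \<in> X" "g \<in> forms t" "(f - x) - l ^ M * g \<in> sat_forms I (t + M)"
      using surj[OF f(1)] by blast
    have "f - x \<in> forms (t + M)" using f(1) x(1) X(2) forms_diff by blast
    then have "connecting M (f - x) \<in> coboundaries I (int t) 1"
      using x(2,3) by (rule connecting_coboundaryI)
    then have "(s - connecting M f) + (connecting M f - connecting M x) \<in> coboundaries I (int t) 1"
      using cochainvs.subspace_add[OF subspace_coboundaries[OF I] f(2)] by (simp only: c.diff)
    then show "\<exists>x\<in>X. s - connecting M x \<in> coboundaries I (int t) 1" using x(1) by auto
  qed
qed

end

subsection \<open>Global sections\<close>

lemma subspace_sat_forms:
  fixes I :: "('v::finite, 'k::field) hpoly set"
  assumes I: "ideal.subspace I"
  shows "polyvs.subspace (sat_forms I t)"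
  unfolding polyvs.subspace_def
proof (intro conjI ballI allI)
  show "0 \<in> sat_forms I t" using ideal.subspace_0[OF I] by (simp add: sat_forms_def)
  fix f g assume f: "f \<in> sat_forms I t" and g: "g \<in> sat_forms I t"
  have "\<exists>N. var i ^ N * (f + g) \<in> I" for i
  proof -
    obtain M N where MN: "var i ^ M * f \<in> I" "var i ^ N * g \<in> I" using f g unfolding sat_forms_def by blast
    have "var i ^ N * (var i ^ M * f) + var i ^ M * (var i ^ N * g) \<in> I"
      by (intro ideal.subspace_add[OF I] ideal.subspace_scale[OF I] MN)
    moreover have "var i ^ N * (var i ^ M * f) + var i ^ M * (var i ^ N * g) = var i ^ (M + N) * (f + g)"
      by (simp only: algebra_simps power_add)
    ultimately show ?thesis by metis
  qed
  then show "f + g \<in> sat_forms I t" using f g forms_add unfolding sat_forms_def by blast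
next
  fix c f assume f: "f \<in> sat_forms I t"
  have "\<exists>N. var i ^ N * smult_pm c f \<in> I" for i
  proof -
    obtain N where "var i ^ N * f \<in> I" using f unfolding sat_forms_def by blast
    then have "Poly_Mapping.single 0 c * (var i ^ N * f) \<in> I" by (rule ideal.subspace_scale[OF I])
    then show ?thesis unfolding smult_pm_def by (metis mult.left_commute)
  qed
  then show "smult_pm c f \<in> sat_forms I t" using f forms_smult unfolding sat_forms_def by blast
qed

lemma cocycles_0_iff:
  fixes I :: "(3, 'k::field) hpoly set"
  assumes s: "s \<in> cocycles I t 0"
  obtains G where "s = point_cochain (\<lambda>_. G)" "\<And>i. G \<in> local_sections I t {i}"
proof -
  obtain a where a: "s = point_cochain a" "\<And>i. a i \<in> local_sections I t {i}" and d: "cech_diff s = 0"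
    using s unfolding cocycles_def by (auto simp: cochains_0_iff)
  have "a j = a i" if "i < j" for i j :: 3
    using fun_cong[OF d, of "{i, j}"] that unfolding a(1) by (simp add: cech_diff_pair)
  then have e: "a i = a 0" for i using exhaust_3'[of i] less_3 by metis
  show ?thesis
  proof (rule that)
    show "s = point_cochain (\<lambda>_. a 0)" unfolding a(1) by (rule arg_cong[where f = point_cochain]) (rule ext, rule e)
    show "a 0 \<in> local_sections I t {i}" for i using a(2)[of i] e[of i] by simp
  qed
qed

lemma global_section_form:
  fixes I :: "(3, 'k::field) hpoly set"
  assumes G: "\<And>i. G \<in> local_sections I t {i}"
  shows "t < 0 \<Longrightarrow> G = 0" "t = int n \<Longrightarrow> \<exists>g\<in>sat_forms I n. G = to_laurent g"
proof -
  have Gf: "G \<in> forms t" by (rule local_sections_forms[OF G])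
  have c: "\<exists>N. lvar i ^ N * G \<in> to_laurent ` UNIV" for i
    using local_sections_singleE[OF G[of i]] by (metis rangeI)
  show "t < 0 \<Longrightarrow> G = 0" by (rule global_section_polynomial(2)[OF Gf c])
  assume t: "t = int n"
  obtain g where g: "G = to_laurent g" using global_section_polynomial(1)[OF Gf c] by blast
  have "\<exists>N. var i ^ N * g \<in> I" for i
  proof -
    obtain N h where h: "lvar i ^ N * G = to_laurent h" "h \<in> I" by (rule local_sections_singleE[OF G])
    then have "to_laurent (var i ^ N * g) = to_laurent h" unfolding g by (simp only: to_laurent_simps)
    then show ?thesis using h(2) by (metis to_laurent_inj)
  qed
  then show "\<exists>g\<in>sat_forms I n. G = to_laurent g"
    using g Gf unfolding sat_forms_def t g to_laurent_forms by blast
qed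

lemma h0_neg:
  fixes I :: "(3, 'k::field) hpoly set"
  assumes I: "ideal.subspace I" and t: "t < 0"
  shows "h_ideal 0 I t = 0"
proof -
  have "cocycles I t 0 \<subseteq> {0}"
  proof
    fix s assume "s \<in> cocycles I t 0"
    then obtain G where G: "s = point_cochain (\<lambda>_. G)" "\<And>i. G \<in> local_sections I t {i}"
      by (rule cocycles_0_iff) (rule that)
    have "G = 0" by (rule global_section_form(1)[OF G(2) t])
    then show "s \<in> {0}" unfolding G(1) by (auto simp: point_cochain_def)
  qed
  then have e: "cocycles I t 0 = {0}"
    using cochainvs.subspace_0[OF subspace_cocycles[OF I]] by blast
  show ?thesis
    unfolding h_ideal_def e coboundaries_def
    using cochainvs.quotient_dim_le(2)[of "{0}" "{0}" "{}"] by simp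
qed

lemma h0_eq_dim:
  fixes I :: "(3, 'k::field) hpoly set"
  assumes I: "ideal.subspace I"
  shows "h_ideal 0 I (int t) = polyvs.dim (sat_forms I t)"
proof -
  interpret vp: vector_space_pair "smult_pm :: 'k \<Rightarrow> (3, 'k) hpoly \<Rightarrow> _"
    "smult_cochain :: 'k \<Rightarrow> (3, 'k) cochain \<Rightarrow> _" by unfold_locales
  let ?p = "\<lambda>f. point_cochain (\<lambda>_::3. to_laurent f)"
  have lin: "Vector_Spaces.linear smult_pm smult_cochain (?p :: (3, 'k) hpoly \<Rightarrow> _)"
    by unfold_locales
      (simp_all only: to_laurent_simps to_laurent_smult point_cochain_add point_cochain_smult)
  have c: "?p f \<in> cocycles I (int t) 0" if f: "f \<in> sat_forms I t" for f
  proof -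
    have "cech_diff (?p f) \<sigma> = 0" for \<sigma>
    proof (cases "card \<sigma> = 2")
      case True
      then show ?thesis using card_3_cases[OF True] less_3 by (auto simp: cech_diff_pair)
    qed (rule cech_diff_support[of 1]; auto simp: point_cochain_def)
    then have "cech_diff (?p f) = 0" by (auto simp: fun_eq_iff)
    moreover have "to_laurent f \<in> local_sections I (int t) {i}" for i
    proof -
      obtain N where "var i ^ N * f \<in> I" using f unfolding sat_forms_def by blast
      then show ?thesis using f
        by (intro local_sections_singleI[of _ _ _ N "var i ^ N * f"])
          (auto simp: to_laurent_forms sat_forms_def to_laurent_simps)
    qed
    ultimately show ?thesis unfolding cocycles_def cochains_0_iff by blast
  qed
  have "cochainvs.quotient_dim (cocycles I (int t) 0) {0} = polyvs.dim (sat_forms I t)"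
  proof (rule vp.quotient_dim_eqI[OF lin subspace_sat_forms[OF I] _ subspace_cocycles[OF I]])
    show "cochainvs.subspace {0::(3, 'k) cochain}" by simp
    show "{0} \<subseteq> cocycles I (int t) 0" using cochainvs.subspace_0[OF subspace_cocycles[OF I]] by blast
    show "?p ` sat_forms I t \<subseteq> cocycles I (int t) 0" using c by blast
    fix f assume "?p f \<in> {0 :: (3, 'k) cochain}"
    then have "?p f {0} = 0" by (simp only: singleton_iff zero_fun_def)
    then have "to_laurent f = to_laurent (0 :: (3, 'k) hpoly)" by (simp add: to_laurent_simps)
    then show "f = 0" by (simp only: to_laurent_inj)
  next
    fix s assume "s \<in> cocycles I (int t) 0"
    then obtain G where G: "s = point_cochain (\<lambda>_. G)" "\<And>i. G \<in> local_sections I (int t) {i}"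
      by (rule cocycles_0_iff) (rule that)
    obtain g where "g \<in> sat_forms I t" "G = to_laurent g" using global_section_form(2)[OF G(2) refl] by blast
    then show "\<exists>x\<in>sat_forms I t. s - ?p x \<in> {0}" unfolding G(1) by auto
  qed
  then show ?thesis by (simp add: h_ideal_def coboundaries_def)
qed

lemma h0_pos_iff:
  fixes I :: "(3, 'k::field) hpoly set"
  assumes I: "ideal.subspace I"
  shows "h_ideal 0 I (int t) > 0 \<longleftrightarrow> (\<exists>f\<in>sat_forms I t. f \<noteq> 0)"
proof -
  obtain B where B: "B \<subseteq> sat_forms I t" "polyvs.independent B" "sat_forms I t \<subseteq> polyvs.span B"
    "card B = polyvs.dim (sat_forms I t)" by (rule polyvs.basis_exists)
  obtain C :: "(3, 'k) hpoly set" where C: "finite C" "forms t \<subseteq> polyvs.span C" by (rule forms_span)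
  have "B \<subseteq> polyvs.span C" using B(1) C(2) unfolding sat_forms_def by blast
  then have fin: "finite B" using polyvs.independent_span_bound[OF C(1) B(2)] by blast
  have "card B > 0 \<longleftrightarrow> (\<exists>f\<in>sat_forms I t. f \<noteq> 0)"
  proof
    assume "card B > 0"
    then obtain b where "b \<in> B" by (metis card.empty equals0I less_irrefl)
    moreover have "b \<noteq> 0" using \<open>b \<in> B\<close> B(2) polyvs.dependent_zero[of B] by metis
    ultimately show "\<exists>f\<in>sat_forms I t. f \<noteq> 0" using B(1) by blast
  next
    assume "\<exists>f\<in>sat_forms I t. f \<noteq> 0"
    then have "B \<noteq> {}" using B(3) by auto
    then show "card B > 0" using fin by (simp add: card_gt_0_iff)
  qed
  then show ?thesis using h0_eq_dim[OF I] B(4) by simp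
qed

section \<open>Points and their double structures\<close>

lemma eval_at_scale:
  fixes f :: "('v::finite, 'k::field) hpoly"
  assumes "f \<in> forms t" shows "eval_at f (c *s v) = c ^ t * eval_at f v"
proof -
  have "(\<Prod>i\<in>UNIV. ((c *s v) $ i) ^ Poly_Mapping.lookup m i) =
      c ^ t * (\<Prod>i\<in>UNIV. (v $ i) ^ Poly_Mapping.lookup m i)" if "m \<in> Poly_Mapping.keys f" for m
    using that assms
    by (auto simp: power_mult_distrib prod.distrib power_sum[symmetric] forms_def exp_degree_def)
  then show ?thesis
    unfolding eval_at_def sum_distrib_left by (intro sum.cong) (simp_all add: mult.left_commute)
qed

interpretation id_hom: const_hom "\<lambda>x::'k::comm_ring_1. x" by (rule const_hom_id)

lemma eval_at_simps:
  fixes f g :: "('v::finite, 'k::field) hpoly"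
  shows "eval_at (f + g) v = eval_at f v + eval_at g v" "eval_at (f - g) v = eval_at f v - eval_at g v"
    "eval_at (f * g) v = eval_at f v * eval_at g v" "eval_at (var i :: ('v, 'k) hpoly) v = v $ i"
    "eval_at (smult_pm c f) v = c * eval_at f v" "eval_at (0 :: ('v, 'k) hpoly) v = 0"
  by (simp_all add: eval_at_eq_insertion id_hom.insertion_add id_hom.insertion_diff id_hom.insertion_mult
      id_hom.insertion_smult_pm)

lemma linear_form_decomp:
  assumes f: "f \<in> forms (1::nat)"
  obtains c where "f = (\<Sum>i\<in>UNIV. smult_pm (c i) (var i :: ('v::finite, 'k::comm_ring_1) hpoly))"
proof (rule that)
  have key: "\<exists>j. m = Poly_Mapping.single j 1" if "m \<in> Poly_Mapping.keys f" for m
  proof -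
    have "(\<Sum>i\<in>UNIV. Poly_Mapping.lookup m i) = 1" using f that by (auto simp: forms_def exp_degree_def)
    then obtain j where j: "Poly_Mapping.lookup m j = 1" "\<forall>b. j \<noteq> b \<longrightarrow> Poly_Mapping.lookup m b = 0"
      using sum_eq_1_iff[of "UNIV :: 'v set" "Poly_Mapping.lookup m"] by (metis UNIV_I finite)
    then show ?thesis by (intro exI[of _ j] poly_mapping_eqI) (auto simp: lookup_single when_def)
  qed
  have inj: "inj (\<lambda>j::'v. Poly_Mapping.single j (1::nat))"
    by (rule injI) (metis keys_single one_neq_zero singleton_inject)
  show "f = (\<Sum>i\<in>UNIV. smult_pm (Poly_Mapping.lookup f (Poly_Mapping.single i 1)) (var i))"
  proof (rule poly_mapping_eqI)
    fix m
    show "Poly_Mapping.lookup f m = Poly_Mapping.lookup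
      (\<Sum>i\<in>UNIV. smult_pm (Poly_Mapping.lookup f (Poly_Mapping.single i 1)) (var i)) m"
    proof (cases "\<exists>j. m = Poly_Mapping.single j 1")
      case True
      then obtain j where j: "m = Poly_Mapping.single j 1" ..
      have "Poly_Mapping.single i (Suc 0) = Poly_Mapping.single j (Suc 0) \<longleftrightarrow> i = j" for i :: 'v
        using injD[OF inj, of i j] by auto
      then show ?thesis
        by (simp add: j lookup_sum smult_pm_def var_def Poly_Mapping.mult_single lookup_single when_def)
    next
      case False
      then have "Poly_Mapping.lookup f m = 0" using key in_keys_iff by metis
      moreover have "Poly_Mapping.single i (Suc 0) \<noteq> m" for i using False by auto
      ultimately show ?thesis
        by (simp add: lookup_sum smult_pm_def var_def Poly_Mapping.mult_single lookup_single when_def)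
    qed
  qed
qed

lemma eval_linear_form:
  fixes f :: "('v::finite, 'k::field) hpoly"
  assumes "f \<in> forms 1"
  shows "eval_at f (v + w) = eval_at f v + eval_at f w"
proof -
  obtain c where f: "f = (\<Sum>i\<in>UNIV. smult_pm (c i) (var i))" by (rule linear_form_decomp[OF assms])
  have "eval_at f x = (\<Sum>i\<in>UNIV. c i * x $ i)" for x
    unfolding f eval_at_eq_insertion id_hom.insertion_sum id_hom.insertion_smult_pm by simp
  then show ?thesis by (simp add: distrib_left sum.distrib)
qed

lemma proj_pointE:
  assumes "p \<in> proj_points"
  obtains w where "w \<noteq> 0" "p = vec.span {w}"
proof -
  have s: "vec.subspace p" and d: "vec.dim p = 1" using assms by (auto simp: proj_points_def)
  obtain B where B: "B \<subseteq> p" "vec.independent B" "p \<subseteq> vec.span B" "card B = 1"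
    using vec.basis_exists[of p] d by metis
  then obtain w where w: "B = {w}" by (meson card_1_singletonE)
  have "w \<noteq> 0" using B(2) vec.dependent_zero unfolding w by blast
  moreover have "p = vec.span {w}" using B(1,3) s vec.span_minimal unfolding w by blast
  ultimately show ?thesis by (rule that)
qed

lemma form_in_point_ideal_iff:
  fixes f :: "('v::finite, 'k::field) hpoly"
  assumes "f \<in> forms t"
  shows "f \<in> point_ideal (vec.span {w}) \<longleftrightarrow> eval_at f w = 0"
  unfolding point_ideal_def vec.span_singleton
proof
  assume "f \<in> {f. \<forall>v\<in>range (\<lambda>k. k *s w). eval_at f v = 0}"
  then have "eval_at f (1 *s w) = 0" by blast
  then show "eval_at f w = 0" by simp
next
  assume "eval_at f w = 0"
  then show "f \<in> {f. \<forall>v\<in>range (\<lambda>k. k *s w). eval_at f v = 0}"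
    using eval_at_scale[OF assms, of _ w] by auto
qed

lemma subspace_double_points: "ideal.subspace (double_points S)"
  unfolding double_points_def ideal_square_def by (intro ideal.subspace_Int ideal.subspace_span)

lemma double_points_insert: "double_points (insert p S) = ideal_square (point_ideal p) \<inter> double_points S"
  by (simp add: double_points_def)

lemma subspace_ideal_square: "ideal.subspace (ideal_square J)"
  by (simp add: ideal_square_def)

lemma ideal_square_mult: "f \<in> J \<Longrightarrow> g \<in> J \<Longrightarrow> f * g \<in> ideal_square J"
  unfolding ideal_square_def by (rule ideal.span_base) blast

lemma ideal_mult_right: "ideal.subspace J \<Longrightarrow> f \<in> J \<Longrightarrow> f * g \<in> J"
  for f :: "'a::comm_ring_1"
  using ideal.subspace_scale[of J f g] by (simp only: mult.commute)

text \<open>At each point of \<open>S\<close>, where \<open>l\<close> does not vanish, \<open>m\<close> has the same value as some multiple of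
  \<open>l\<close>.  The squares of the differences have a product that vanishes doubly along \<open>S\<close>.\<close>

lemma double_points_product:
  fixes S :: "('k::field ^ 'v::finite) set set"
  assumes S: "finite S" "S \<subseteq> proj_points" and l: "l \<in> forms 1" "\<And>p. p \<in> S \<Longrightarrow> l \<notin> point_ideal p"
    and m: "m \<in> forms 1"
  shows "\<exists>cs. length cs = 2 * card S \<and> (\<Prod>c\<leftarrow>cs. m - smult_pm c l) \<in> double_points S"
  using S l(2)
proof (induction S rule: finite_induct)
  case empty
  then show ?case by (intro exI[of _ "[]"]) (simp add: double_points_def)
next
  case (insert p S)
  then obtain cs where cs: "length cs = 2 * card S" "(\<Prod>c\<leftarrow>cs. m - smult_pm c l) \<in> double_points S" by auto
  obtain w where w: "p = vec.span {w}" using insert.prems(1) proj_pointE[of p] by blast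
  have lw: "eval_at l w \<noteq> 0" using insert.prems(2)[of p] form_in_point_ideal_iff[OF l(1)] w by simp
  \<comment> \<open>The value at the point of the function \<open>m / l\<close>.\<close>
  define c where "c = eval_at m w / eval_at l w"
  have "eval_at (m - smult_pm c l) w = 0" using lw by (simp add: eval_at_simps c_def)
  then have "m - smult_pm c l \<in> point_ideal p"
    unfolding w by (subst form_in_point_ideal_iff[OF forms_diff[OF m forms_smult[OF l(1)]]])
  then have sq: "(m - smult_pm c l) * (m - smult_pm c l) \<in> ideal_square (point_ideal p)"
    by (intro ideal_square_mult)
  have e: "(\<Prod>c\<leftarrow>c # c # cs. m - smult_pm c l) =
      ((m - smult_pm c l) * (m - smult_pm c l)) * (\<Prod>c\<leftarrow>cs. m - smult_pm c l)"
    by (simp only: list.map prod_list.Cons mult.assoc)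
  have "(\<Prod>c\<leftarrow>c # c # cs. m - smult_pm c l) \<in> double_points (insert p S)"
    unfolding double_points_insert e
    using ideal_mult_right[OF subspace_ideal_square sq] ideal.subspace_scale[OF subspace_double_points cs(2)]
    by blast
  moreover have "length (c # c # cs) = 2 * card (insert p S)" using cs(1) insert.hyps by simp
  ultimately show ?case by blast
qed

text \<open>The third conjunct handles the empty product, where the degree \<open>length cs - 1\<close> is truncated.\<close>

lemma product_of_linear_forms:
  fixes l m :: "('v::finite, 'k::field) hpoly"
  assumes l: "l \<in> forms 1" and m: "m \<in> forms 1"
  shows "\<exists>u. (\<Prod>c\<leftarrow>cs. m - smult_pm c l) = m ^ length cs - l * u \<and> m * u \<in> forms (length cs)
    \<and> (length cs = 0 \<longrightarrow> u = 0) \<and> u \<in> forms (length cs - 1)"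
proof (induction cs)
  case Nil
  then show ?case by (intro exI[of _ 0]) simp
next
  case (Cons c cs)
  then obtain u where u: "(\<Prod>c\<leftarrow>cs. m - smult_pm c l) = m ^ length cs - l * u" "m * u \<in> forms (length cs)"
    "u \<in> forms (length cs - 1)" "length cs = 0 \<longrightarrow> u = 0" by blast
  let ?u = "m * u + smult_pm c (m ^ length cs - l * u)"
  have lu: "l * u \<in> forms (length cs)"
    using forms_mult[OF l u(3)] u(4) by (cases "length cs") auto
  have mp: "m ^ length cs \<in> forms (length cs)" using forms_power[OF m, of "length cs"] by simp
  have uf: "?u \<in> forms (length cs)"
    by (intro forms_add u(2) forms_smult forms_diff lu mp)
  have "(\<Prod>c\<leftarrow>c # cs. m - smult_pm c l) = (m - smult_pm c l) * (m ^ length cs - l * u)"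
    by (simp add: u(1))
  also have "\<dots> = m ^ length (c # cs) - l * ?u"
    unfolding smult_pm_def by (simp only: algebra_simps length_Cons power_Suc)
  finally show ?case using uf forms_mult[OF m uf] by (intro exI[of _ ?u]) simp
qed

text \<open>The product of linear forms from the previous lemma is congruent to a power of \<open>m\<close> modulo \<open>l\<close>.  One
  more factor \<open>m\<close> makes the exponent positive for empty \<open>S\<close> as well.\<close>

lemma double_points_power:
  fixes S :: "('k::field ^ 'v::finite) set set"
  assumes S: "finite S" "S \<subseteq> proj_points" and l: "l \<in> forms 1" "\<And>p. p \<in> S \<Longrightarrow> l \<notin> point_ideal p"
    and m: "m \<in> forms 1"
  shows "\<exists>u\<in>forms (2 * card S). m ^ Suc (2 * card S) - l * u \<in> double_points S"
proof -
  obtain cs where cs: "length cs = 2 * card S" "(\<Prod>c\<leftarrow>cs. m - smult_pm c l) \<in> double_points S"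
    using double_points_product[OF S l m] by blast
  obtain u where u: "(\<Prod>c\<leftarrow>cs. m - smult_pm c l) = m ^ length cs - l * u" "m * u \<in> forms (length cs)"
    using product_of_linear_forms[OF l(1) m] by blast
  have "m * (m ^ length cs - l * u) \<in> double_points S"
    using cs(2) unfolding u(1) by (rule ideal.subspace_scale[OF subspace_double_points])
  moreover have "m * (m ^ length cs - l * u) = m ^ Suc (2 * card S) - l * (m * u)"
    unfolding cs(1) by (simp only: right_diff_distrib power_Suc mult.left_commute)
  ultimately show ?thesis using u(2) unfolding cs(1) by metis
qed

section \<open>Affine charts\<close>

text \<open>The coefficient of the pure power \<open>X ^ u\<close>.\<close>

definition top_X :: "nat \<Rightarrow> 'k::zero poly poly \<Rightarrow> 'k" where
  "top_X u f = coeff (coeff f u) 0"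

lemma top_X_lead_form: "top_X u f = coeff (lead_form u f) u"
  by (simp add: top_X_def coeff_lead_form)

lemma top_X_mult:
  fixes f g :: "'k::comm_ring_1 poly poly"
  assumes "f \<in> tdeg_le u" "g \<in> tdeg_le v"
  shows "top_X (u + v) (f * g) = top_X u f * top_X v g"
proof -
  have "coeff (p * q) (m + n) = coeff p m * coeff q n" if "degree p \<le> m" "degree q \<le> n"
    for p q :: "'k poly" and m n
  proof -
    have "coeff p i * coeff q (m + n - i) = 0" if "i \<le> m + n" "i \<noteq> m" for i
      using that \<open>degree p \<le> m\<close> \<open>degree q \<le> n\<close>
      by (cases "i < m") (auto simp: coeff_eq_0)
    then show ?thesis
      unfolding coeff_mult by (subst sum.remove[of _ m]) (auto intro!: sum.neutral)
  qed
  then show ?thesis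
    unfolding top_X_lead_form lead_form_mult[OF assms] using degree_lead_form by blast
qed

lemma tdeg_le_1: "(1 :: 'k::comm_ring_1 poly poly) \<in> tdeg_le 0" "top_X 0 (1 :: 'k::comm_ring_1 poly poly) = 1"
  using const_tdeg[of "1::'k"] by (simp_all add: one_pCons top_X_def)

lemma tdeg_le_power:
  fixes f :: "'k::comm_ring_1 poly poly"
  assumes "f \<in> tdeg_le 1"
  shows "f ^ n \<in> tdeg_le n \<and> top_X n (f ^ n) = top_X 1 f ^ n"
proof (induction n)
  case (Suc n)
  then show ?case using tdeg_le_mult[OF assms, of "f ^ n" n] top_X_mult[OF assms, of "f ^ n" n] by simp
qed (simp add: tdeg_le_1)

lemma tdeg_le_prod:
  fixes f :: "'i \<Rightarrow> 'k::comm_ring_1 poly poly"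
  assumes "finite A" "\<And>i. i \<in> A \<Longrightarrow> f i \<in> tdeg_le (n i)"
  shows "(\<Prod>i\<in>A. f i) \<in> tdeg_le (\<Sum>i\<in>A. n i) \<and> top_X (\<Sum>i\<in>A. n i) (\<Prod>i\<in>A. f i) = (\<Prod>i\<in>A. top_X (n i) (f i))"
  using assms
proof (induction A rule: finite_induct)
  case (insert i A)
  then show ?case using tdeg_le_mult[of "f i" "n i" "\<Prod>i\<in>A. f i" "\<Sum>i\<in>A. n i"]
      top_X_mult[of "f i" "n i" "\<Prod>i\<in>A. f i" "\<Sum>i\<in>A. n i"] by simp
qed (simp add: tdeg_le_1)

interpretation poly2_hom: const_hom "\<lambda>a::'k::comm_ring_1. [:[:a:]:]" by (rule const_hom_poly2)

text \<open>Restricting forms of degree \<open>t\<close> to an affine chart gives polynomials of total degree at most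
  \<open>t\<close>; the coefficient of \<open>X ^ t\<close> is the value at the point at infinity of the \<open>X\<close>-axis.\<close>

lemma insertion_forms:
  fixes f :: "('v::finite, 'k::field) hpoly"
  assumes f: "f \<in> forms t" and r: "\<And>i. r i \<in> tdeg_le 1"
  shows "insertion (\<lambda>a. [:[:a:]:]) r f \<in> tdeg_le t \<and>
    top_X t (insertion (\<lambda>a. [:[:a:]:]) r f) = eval_at f (\<chi> i. top_X 1 (r i))"
proof -
  define g where "g m = [:[:Poly_Mapping.lookup f m:]:] * (\<Prod>i\<in>UNIV. r i ^ Poly_Mapping.lookup m i)" for m
  have g: "g m \<in> tdeg_le t \<and>
    top_X t (g m) = Poly_Mapping.lookup f m * (\<Prod>i\<in>UNIV. top_X 1 (r i) ^ Poly_Mapping.lookup m i)"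
    if "m \<in> Poly_Mapping.keys f" for m
  proof -
    have t: "(\<Sum>i\<in>UNIV. Poly_Mapping.lookup m i) = t" using that f by (auto simp: forms_def exp_degree_def)
    let ?p = "\<Prod>i\<in>UNIV. r i ^ Poly_Mapping.lookup m i"
    have p: "?p \<in> tdeg_le t" "top_X t ?p = (\<Prod>i\<in>UNIV. top_X 1 (r i) ^ Poly_Mapping.lookup m i)"
      using tdeg_le_prod[of UNIV "\<lambda>i. r i ^ Poly_Mapping.lookup m i" "Poly_Mapping.lookup m"]
        tdeg_le_power[OF r] unfolding t by auto
    have c: "[:[:Poly_Mapping.lookup f m:]:] \<in> tdeg_le 0" by (rule const_tdeg)
    have "top_X 0 [:[:Poly_Mapping.lookup f m:]:] = Poly_Mapping.lookup f m" by (simp add: top_X_def)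
    then show ?thesis
      using tdeg_le_mult[OF c p(1)] top_X_mult[OF c p(1)] p(2) unfolding g_def by simp
  qed
  have "sum g A \<in> tdeg_le t \<and> top_X t (sum g A) = (\<Sum>m\<in>A. top_X t (g m))" if "A \<subseteq> Poly_Mapping.keys f" for A
    using that
  proof (induction A rule: infinite_finite_induct)
    case (insert m A)
    then show ?case using g[of m] by (simp add: tdeg_le_add) (simp add: top_X_def)
  qed (simp_all add: top_X_def)
  from this[OF subset_refl] show ?thesis
    using g unfolding insertion_def eval_at_def by (simp add: g_def cong: sum.cong)
qed

text \<open>The complement of a line \<open>l = 0\<close> that misses the scheme is an affine plane; \<open>\<rho>\<close> restricts
  homogeneous polynomials to it, with \<open>l\<close> becoming 1.\<close>

locale plane_chart = line_section I l u K for I :: "(3, 'k::field) hpoly set" and l u K +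
  fixes \<rho> :: "(3, 'k) hpoly \<Rightarrow> 'k poly poly"
  assumes rho_add: "\<rho> (f + g) = \<rho> f + \<rho> g" and rho_mult: "\<rho> (f * g) = \<rho> f * \<rho> g"
    and rho_const: "\<rho> (Poly_Mapping.single 0 c) = [:[:c:]:]"
    and rho_l: "\<rho> l = 1"
    and rho_forms: "\<rho> ` forms t = tdeg_le t"
    and rho_inj: "f \<in> forms t \<Longrightarrow> \<rho> f = 0 \<Longrightarrow> f = 0"
begin

lemma linear_rho: "Vector_Spaces.linear smult_pm (\<lambda>c. smult [:c:]) \<rho>"
  by unfold_locales (simp_all add: rho_add smult_pm_def rho_mult rho_const)

sublocale rho: Vector_Spaces.linear smult_pm "\<lambda>c. smult [:c:]" \<rho>
  by (rule linear_rho)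

lemma rho_1: "\<rho> 1 = 1"
  using rho_const[of 1] by (simp add: one_pCons)

lemma rho_power: "\<rho> (f ^ n) = \<rho> f ^ n"
  by (induction n) (simp_all add: rho_1 rho_mult)

lemma rho_in: "f \<in> forms t \<Longrightarrow> \<rho> f \<in> tdeg_le t"
  using rho_forms by blast

lemma rho_l_power: "\<rho> (l ^ n * f) = \<rho> f"
  by (simp add: rho_mult rho_power rho_l)

lemma rho_eq: "f \<in> forms t \<Longrightarrow> g \<in> forms t \<Longrightarrow> \<rho> f = \<rho> g \<Longrightarrow> f = g"
  using rho_inj[OF forms_diff, of f t g] by (simp add: rho.diff)

lemma sat_forms_mult:
  assumes f: "f \<in> sat_forms I t" and h: "h \<in> forms n"
  shows "h * f \<in> sat_forms I (n + t)"
  unfolding sat_forms_def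
proof (intro CollectI conjI allI)
  show "h * f \<in> forms (n + t)" using f h forms_mult unfolding sat_forms_def by blast
  fix i
  obtain N where "var i ^ N * f \<in> I" using f unfolding sat_forms_def by blast
  then have "h * (var i ^ N * f) \<in> I" by (rule mult_I)
  then show "\<exists>N. var i ^ N * (h * f) \<in> I" by (metis mult.left_commute)
qed

definition affine_ideal :: "'k poly poly set" where
  "affine_ideal = (\<Union>t. \<rho> ` sat_forms I t)"

lemma l_power_mult_forms: "f \<in> forms t \<Longrightarrow> t \<le> n \<Longrightarrow> l ^ (n - t) * f \<in> forms n"
  using forms_mult[OF l_power_form, of f t "n - t"] by simp

lemma sat_forms_l_power_cancel: "f \<in> forms t \<Longrightarrow> l ^ n * f \<in> sat_forms I (n + t) \<Longrightarrow> f \<in> sat_forms I t"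
proof (induction n)
  case (Suc n)
  have "l ^ n * f \<in> forms (n + t)" using forms_mult[OF l_power_form Suc.prems(1)] .
  moreover have "l * (l ^ n * f) \<in> sat_forms I (Suc (n + t))"
    using Suc.prems(2) by (simp only: power_Suc mult.assoc add_Suc)
  ultimately have "l ^ n * f \<in> sat_forms I (n + t)" by (rule sat_forms_l_cancel)
  then show ?case using Suc by blast
qed simp

text \<open>Since \<open>l\<close> is not a zero divisor on the scheme, a form belongs to the ideal as soon as its product
  with a power of \<open>l\<close> does.\<close>

lemma rho_in_affine_ideal_iff:
  assumes f: "f \<in> forms t" shows "\<rho> f \<in> affine_ideal \<longleftrightarrow> f \<in> sat_forms I t"
proof
  assume "\<rho> f \<in> affine_ideal"
  then obtain n g where g: "g \<in> sat_forms I n" "\<rho> f = \<rho> g" unfolding affine_ideal_def by blast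
  have gf: "g \<in> forms n" using g(1) by (simp add: sat_forms_def)
  let ?m = "max n t"
  have "l ^ (?m - t) * f = l ^ (?m - n) * g"
    by (rule rho_eq[of _ ?m]) (use f gf g(2) in \<open>simp_all add: l_power_mult_forms rho_l_power\<close>)
  moreover have "l ^ (?m - n) * g \<in> sat_forms I (?m - n + n)"
    by (rule sat_forms_mult[OF g(1) l_power_form])
  ultimately have "l ^ (?m - t) * f \<in> sat_forms I (?m - t + t)" by simp
  then show "f \<in> sat_forms I t" by (rule sat_forms_l_power_cancel[OF f])
qed (auto simp: affine_ideal_def)

lemma affine_ideal_form:
  assumes "p \<in> affine_ideal" obtains t f where "f \<in> sat_forms I t" "f \<in> forms t" "p = \<rho> f"
  using assms unfolding affine_ideal_def sat_forms_def by blast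

lemma ideal_affine_ideal: "ideal.subspace affine_ideal"
  unfolding ideal.subspace_def
proof (intro conjI ballI allI)
  have "\<rho> 0 \<in> affine_ideal" unfolding rho_in_affine_ideal_iff[OF forms_0, of 0]
    by (simp add: sat_forms_def zero_I)
  then show "0 \<in> affine_ideal" by (simp add: rho.zero)
  fix p q assume "p \<in> affine_ideal" "q \<in> affine_ideal"
  then obtain s t f g where f: "f \<in> sat_forms I s" "p = \<rho> f" and g: "g \<in> sat_forms I t" "q = \<rho> g"
    unfolding affine_ideal_def by blast
  let ?m = "max s t"
  have "l ^ (?m - s) * f \<in> sat_forms I (?m - s + s)" "l ^ (?m - t) * g \<in> sat_forms I (?m - t + t)"
    by (intro sat_forms_mult f g l_power_form)+
  then have "l ^ (?m - s) * f + l ^ (?m - t) * g \<in> sat_forms I ?m"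
    using polyvs.subspace_add[OF subspace_sat_forms[OF I]] by simp
  moreover have "\<rho> (l ^ (?m - s) * f + l ^ (?m - t) * g) = p + q"
    by (simp only: rho_add rho_l_power f g)
  ultimately have "p + q \<in> \<rho> ` sat_forms I ?m" by (metis imageI)
  then show "p + q \<in> affine_ideal" unfolding affine_ideal_def by blast
next
  fix c p :: "'k poly poly" assume "p \<in> affine_ideal"
  then obtain t f where f: "f \<in> sat_forms I t" "p = \<rho> f" unfolding affine_ideal_def by blast
  obtain n where "c \<in> tdeg_le n" using tdeg_le_ex by blast
  then obtain h where h: "h \<in> forms n" "c = \<rho> h" using rho_forms[of n] by blast
  have "c * p = \<rho> (h * f)" by (simp add: rho_mult f h)
  then show "c * p \<in> affine_ideal" unfolding affine_ideal_def using sat_forms_mult[OF f(1) h(1)] by blast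
qed

text \<open>The functions on the scheme are all given by polynomials of degree at most \<open>3 * K\<close>: in a higher
  degree every form is a multiple of \<open>l\<close> modulo \<open>I\<close>, and \<open>l\<close> becomes 1.\<close>

lemma affine_reduce: "\<exists>r\<in>tdeg_le (3 * K). p - r \<in> affine_ideal"
proof -
  have "\<exists>r\<in>tdeg_le (3 * K). \<rho> f - r \<in> affine_ideal" if "f \<in> forms (3 * K + n)" for f n
    using that
  proof (induction n arbitrary: f)
    case 0
    then show ?case using rho_in[of f "3 * K"] ideal.subspace_0[OF ideal_affine_ideal] by (intro bexI[of _ "\<rho> f"]) auto
  next
    case (Suc n)
    obtain f' where f': "f' \<in> forms (3 * K + n)" and ff: "f - l * f' \<in> I"
      using forms_multiple_of_l[of f "3 * K + n"] Suc.prems by (metis add_Suc_right le_add1)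
    have lf': "l * f' \<in> forms (3 * K + Suc n)" using forms_mult[OF l f'] by simp
    have "f - l * f' \<in> sat_forms I (3 * K + Suc n)"
      unfolding sat_forms_def using forms_diff[OF Suc.prems lf'] mult_I[OF ff] by blast
    then have "\<rho> (f - l * f') \<in> affine_ideal" unfolding affine_ideal_def by blast
    then have d: "\<rho> f - \<rho> f' \<in> affine_ideal" by (simp add: rho.diff rho_mult rho_l)
    obtain r where r: "r \<in> tdeg_le (3 * K)" "\<rho> f' - r \<in> affine_ideal" using Suc.IH[OF f'] by blast
    have "(\<rho> f - \<rho> f') + (\<rho> f' - r) \<in> affine_ideal" by (rule ideal.subspace_add[OF ideal_affine_ideal d r(2)])
    then show ?case using r(1) by auto
  qed
  note red = this
  obtain n where "p \<in> tdeg_le n" using tdeg_le_ex by blast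
  then have "p \<in> tdeg_le (3 * K + n)" by (rule tdeg_le_mono) simp
  then obtain f where "f \<in> forms (3 * K + n)" "p = \<rho> f" using rho_forms[of "3 * K + n"] by blast
  then show ?thesis using red by blast
qed

text \<open>The functions whose restriction to the scheme agrees with that of a polynomial of degree at most
  \<open>t\<close>.\<close>

definition interpolated :: "nat \<Rightarrow> 'k poly poly set" where
  "interpolated t = {a + r |a r. a \<in> affine_ideal \<and> r \<in> tdeg_le t}"

lemma interpolatedI: "p - r \<in> affine_ideal \<Longrightarrow> r \<in> tdeg_le t \<Longrightarrow> p \<in> interpolated t"
  unfolding interpolated_def by (intro CollectI exI[of _ "p - r"] exI[of _ r]) auto

lemma interpolatedE:
  assumes "p \<in> interpolated t" obtains r where "p - r \<in> affine_ideal" "r \<in> tdeg_le t"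
proof -
  obtain a r where ar: "p = a + r" "a \<in> affine_ideal" "r \<in> tdeg_le t"
    using assms unfolding interpolated_def by blast
  show ?thesis by (rule that[of r]) (use ar in simp_all)
qed

lemma tdeg_le_interpolated: "tdeg_le t \<subseteq> interpolated t"
  using interpolatedI[of r r t for r] ideal.subspace_0[OF ideal_affine_ideal] by auto

lemma subspace_affine_ideal: "bpoly.subspace affine_ideal"
  unfolding bpoly.subspace_def using ideal_affine_ideal ideal.subspace_scale[OF ideal_affine_ideal, of _ "[:[:_:]:]"]
  by (auto simp: ideal.subspace_def)

lemma subspace_interpolated: "bpoly.subspace (interpolated t)"
  unfolding interpolated_def by (rule bpoly.subspace_sums[OF subspace_affine_ideal subspace_tdeg_le])

lemma tdeg_le_span:
  obtains C :: "'k poly poly set" where "finite C" "C \<subseteq> tdeg_le t" "tdeg_le t \<subseteq> bpoly.span C"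
proof -
  obtain C :: "(3, 'k) hpoly set" where C: "finite C" "C \<subseteq> forms t" "forms t \<subseteq> polyvs.span C" by (rule forms_span)
  have "tdeg_le t \<subseteq> bpoly.span (\<rho> ` C)" unfolding rho_forms[symmetric] rho.span_image using C(3) by blast
  moreover have "\<rho> ` C \<subseteq> tdeg_le t" using C(2) rho_in by blast
  ultimately show ?thesis using that C(1) by blast
qed

lemma interpolated_finite_codim:
  obtains C :: "'k poly poly set" where "finite C" "bpoly.span (interpolated t \<union> C) = UNIV"
proof -
  obtain C :: "'k poly poly set" where C: "finite C" "C \<subseteq> tdeg_le (3 * K)" "tdeg_le (3 * K) \<subseteq> bpoly.span C"
    by (rule tdeg_le_span)
  have "p \<in> bpoly.span (interpolated t \<union> C)" for p
  proof -
    obtain r where r: "r \<in> tdeg_le (3 * K)" "p - r \<in> affine_ideal" using affine_reduce by blast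
    have "p - r \<in> interpolated t" using interpolatedI[of "p - r" 0 t] r(2) by simp
    then have "p - r \<in> bpoly.span (interpolated t \<union> C)" by (intro bpoly.span_base) simp
    moreover have "r \<in> bpoly.span (interpolated t \<union> C)" using r(1) C(3) bpoly.span_mono[of C "interpolated t \<union> C"] by blast
    ultimately have "(p - r) + r \<in> bpoly.span (interpolated t \<union> C)" by (rule bpoly.span_add)
    then show ?thesis by simp
  qed
  then show ?thesis using that C(1) by blast
qed

text \<open>In the affine chart, the first cohomology measures the failure of polynomials of degree at
  most \<open>t\<close> to interpolate on the scheme.\<close>

theorem h1_affine: "h_ideal 1 I (int t) = bpoly.quotient_dim UNIV (interpolated t)"
proof -
  interpret pb: vector_space_pair "smult_pm :: 'k \<Rightarrow> (3, 'k) hpoly \<Rightarrow> _"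
    "\<lambda>c. smult [:c:] :: 'k poly poly \<Rightarrow> 'k poly poly" by unfold_locales
  \<comment> \<open>From degree \<open>3 * K\<close> on, the homogeneous coordinate ring of the scheme is the ring of all its functions.\<close>
  define M where "M = 3 * K"
  let ?W = "{f \<in> forms (t + M). \<exists>g\<in>forms t. f - l ^ M * g \<in> sat_forms I (t + M)}"
  have lg: "l ^ M * g \<in> forms (t + M)" if "g \<in> forms t" for g
    using forms_mult[OF l_power_form that, of M] by (simp only: add.commute)
  have W_iff: "f \<in> ?W \<longleftrightarrow> \<rho> f \<in> interpolated t" if f: "f \<in> forms (t + M)" for f
  proof
    assume "f \<in> ?W"
    then obtain g where g: "g \<in> forms t" "f - l ^ M * g \<in> sat_forms I (t + M)" by blast
    then have "\<rho> (f - l ^ M * g) \<in> affine_ideal" unfolding affine_ideal_def by blast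
    then have "\<rho> f - \<rho> g \<in> affine_ideal" by (simp only: rho.diff rho_l_power)
    then show "\<rho> f \<in> interpolated t" using rho_in[OF g(1)] by (rule interpolatedI)
  next
    assume "\<rho> f \<in> interpolated t"
    then obtain r where r: "\<rho> f - r \<in> affine_ideal" "r \<in> tdeg_le t" by (rule interpolatedE)
    obtain g where g: "g \<in> forms t" "r = \<rho> g" using r(2) rho_forms[of t] by blast
    have "\<rho> (f - l ^ M * g) \<in> affine_ideal" using r(1) by (simp only: rho.diff rho_l_power g)
    then show "f \<in> ?W" using rho_in_affine_ideal_iff[OF forms_diff[OF f lg[OF g(1)]]] f g(1) by blast
  qed
  have subW: "polyvs.subspace ?W"
  proof -
    have "polyvs.subspace (forms (t + M) \<inter> {f. \<rho> f \<in> interpolated t})"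
      by (intro polyvs.subspace_inter subspace_forms rho.subspace_linear_preimage subspace_interpolated)
    moreover have "?W = forms (t + M) \<inter> {f. \<rho> f \<in> interpolated t}" using W_iff by blast
    ultimately show ?thesis by simp
  qed
  obtain C :: "(3, 'k) hpoly set" where C: "finite C" "C \<subseteq> forms (t + M)" "forms (t + M) \<subseteq> polyvs.span C"
    by (rule forms_span)
  have C3: "forms (t + M) \<subseteq> polyvs.span (?W \<union> C)"
    using C(3) polyvs.span_mono[of C "?W \<union> C"] by blast
  obtain X B where X: "polyvs.subspace X" "X = polyvs.span B" "finite B" "polyvs.independent B"
      "X \<subseteq> forms (t + M)" "card B \<le> card C"
    and d: "\<And>x. x \<in> X \<Longrightarrow> x \<in> ?W \<Longrightarrow> x = 0" "\<And>v. v \<in> forms (t + M) \<Longrightarrow> \<exists>x\<in>X. v - x \<in> ?W"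
    by (rule polyvs.finite_complement[OF subW subspace_forms _ C(1,2) C3]) (blast, rule that)
  have "h_ideal 1 I (int t) = polyvs.dim X"
  proof (rule h1_eq_dim[of t M, OF _ X(1,5)])
    show "3 * K \<le> t + M" by (simp add: M_def)
    show "x = 0" if "x \<in> X" "g \<in> forms t" "x - l ^ M * g \<in> sat_forms I (t + M)" for x g
      using that X(5) by (intro d(1)) blast+
    show "\<exists>x\<in>X. \<exists>g\<in>forms t. f - x - l ^ M * g \<in> sat_forms I (t + M)" if "f \<in> forms (t + M)" for f
      using d(2)[OF that] by blast
  qed
  also have "\<dots> = bpoly.quotient_dim UNIV (interpolated t)"
  proof (rule pb.quotient_dim_eqI[OF linear_rho X(1) subspace_interpolated bpoly.subspace_UNIV subset_UNIV subset_UNIV, symmetric])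
    show "x = 0" if "x \<in> X" "\<rho> x \<in> interpolated t" for x
      using that d(1)[OF that(1)] W_iff X(5) by blast
    fix p :: "'k poly poly"
    obtain r where r: "r \<in> tdeg_le M" "p - r \<in> affine_ideal"
      using affine_reduce[of p] unfolding M_def[symmetric] by blast
    have "r \<in> tdeg_le (t + M)" using r(1) by (rule tdeg_le_mono) simp
    then obtain f where f: "f \<in> forms (t + M)" "r = \<rho> f" using rho_forms[of "t + M"] by blast
    obtain x where x: "x \<in> X" "f - x \<in> ?W" using d(2)[OF f(1)] by (elim bexE)
    have "f - x \<in> forms (t + M)" using x(2) by (simp only: mem_Collect_eq)
    then have "\<rho> (f - x) \<in> interpolated t" using W_iff[of "f - x"] x(2) by (simp only:)
    then have "r - \<rho> x \<in> interpolated t" unfolding f(2) rho.diff .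
    moreover have "p - r \<in> interpolated t" using interpolatedI[of "p - r" 0 t] r(2) by simp
    ultimately have "(p - r) + (r - \<rho> x) \<in> interpolated t" by (intro bpoly.subspace_add[OF subspace_interpolated])
    then show "\<exists>x\<in>X. p - \<rho> x \<in> interpolated t" using x(1) by auto
  qed
  finally show ?thesis .
qed

lemma interpolated_mono: "s \<le> t \<Longrightarrow> interpolated s \<subseteq> interpolated t"
  unfolding interpolated_def using tdeg_le_mono by blast

lemma h1_eq_0_iff: "h_ideal 1 I (int t) = 0 \<longleftrightarrow> interpolated t = UNIV"
proof -
  obtain C :: "'k poly poly set" where C: "finite C" "bpoly.span (interpolated t \<union> C) = UNIV" by (rule interpolated_finite_codim)
  show ?thesis unfolding h1_affine
    using bpoly.quotient_dim_le(2)[OF subspace_interpolated bpoly.subspace_UNIV subset_UNIV C(1) subset_UNIV] C(2) by auto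
qed

lemma h1_le_1:
  assumes "\<And>p. \<exists>c. p - smult [:c:] g \<in> interpolated t" shows "h_ideal 1 I (int t) \<le> 1"
proof -
  have "p \<in> bpoly.span (interpolated t \<union> {g})" for p
  proof -
    obtain c where "p - smult [:c:] g \<in> interpolated t" using assms by blast
    then have "(p - smult [:c:] g) + smult [:c:] g \<in> bpoly.span (interpolated t \<union> {g})"
      by (intro bpoly.span_add bpoly.span_scale bpoly.span_base) auto
    then show ?thesis by simp
  qed
  then have "UNIV \<subseteq> bpoly.span (interpolated t \<union> {g})" by blast
  then show ?thesis unfolding h1_affine
    using bpoly.quotient_dim_le(1)[OF subspace_interpolated bpoly.subspace_UNIV subset_UNIV, of "{g}"] by simp
qed

definition homogeneous_lift :: "nat \<Rightarrow> 'k poly \<Rightarrow> 'k poly poly" where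
  "homogeneous_lift n q = (\<Sum>i\<le>n. monom (monom (coeff q i) (n - i)) i)"

lemma coeff_homogeneous_lift:
  "coeff (coeff (homogeneous_lift n q) i) j = (if i + j = n then coeff q i else 0)"
  by (auto simp: homogeneous_lift_def coeff_sum if_distrib[of "\<lambda>p. coeff p j"] cong: if_cong)

text \<open>Forms of degree \<open>Suc t\<close>, modulo the leading forms of members of the ideal, give the functions on
  the scheme that polynomials of degree \<open>Suc t\<close> interpolate, modulo those that polynomials of
  degree \<open>t\<close> interpolate.\<close>

theorem h1_drop:
  "h_ideal 1 I (int t) + upoly.dim (lead_form (Suc t) ` (affine_ideal \<inter> tdeg_le (Suc t)))
    = h_ideal 1 I (int (Suc t)) + Suc (Suc t)"
proof -
  let ?V = "lead_form (Suc t) ` (affine_ideal \<inter> tdeg_le (Suc t))"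
  let ?D = "{p :: 'k poly. degree p \<le> Suc t}"
  interpret ub: vector_space_pair "smult :: 'k \<Rightarrow> 'k poly \<Rightarrow> _"
    "\<lambda>c. smult [:c:] :: 'k poly poly \<Rightarrow> 'k poly poly" by unfold_locales
  interpret lf: Vector_Spaces.linear "\<lambda>c. smult [:c:]" smult "lead_form (Suc t) :: 'k poly poly \<Rightarrow> 'k poly"
    by (rule linear_lead_form)
  have subV: "upoly.subspace ?V"
    by (intro lf.subspace_image bpoly.subspace_inter subspace_affine_ideal subspace_tdeg_le)
  have VD: "?V \<subseteq> ?D" using degree_lead_form by auto
  let ?C = "(\<lambda>i. monom (1::'k) i) ` {..Suc t}"
  have C: "finite ?C" "?C \<subseteq> ?D" "?D \<subseteq> upoly.span (A \<union> ?C)" for A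
    using degree_le_span_monom upoly.span_mono[of ?C "A \<union> ?C"] by (auto intro: order_trans[OF degree_monom_le])
  obtain E B where E: "upoly.subspace E" "E = upoly.span B" "finite B" "upoly.independent B" "E \<subseteq> ?D"
      "card B \<le> card ?C"
    and dE: "\<And>x. x \<in> E \<Longrightarrow> x \<in> ?V \<Longrightarrow> x = 0" "\<And>v. v \<in> ?D \<Longrightarrow> \<exists>x\<in>E. v - x \<in> ?V"
    by (rule upoly.finite_complement[OF subV subspace_degree_le VD C]) (rule that)
  have qE: "upoly.quotient_dim ?D ?V = upoly.dim E"
    by (rule upoly.quotient_dim_complement[OF E(1) subV subspace_degree_le VD E(5) dE])
  have linl: "Vector_Spaces.linear smult (\<lambda>c. smult [:c:]) (homogeneous_lift (Suc t))"
    by unfold_locales (auto simp: poly_eq_iff coeff_homogeneous_lift)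
  have lift_tdeg: "homogeneous_lift (Suc t) q \<in> tdeg_le (Suc t)" for q
    by (auto simp: tdeg_le_def coeff_homogeneous_lift split: if_splits)
  have lift_lead: "lead_form (Suc t) (homogeneous_lift (Suc t) q) = q" if "q \<in> ?D" for q
    using that by (auto simp: poly_eq_iff coeff_lead_form coeff_homogeneous_lift coeff_eq_0)
  have q2: "bpoly.quotient_dim (interpolated (Suc t)) (interpolated t) = upoly.dim E"
  proof (rule ub.quotient_dim_eqI[OF linl E(1) subspace_interpolated subspace_interpolated])
    show "interpolated t \<subseteq> interpolated (Suc t)" by (rule interpolated_mono) simp
    show "homogeneous_lift (Suc t) ` E \<subseteq> interpolated (Suc t)"
      using tdeg_le_interpolated lift_tdeg by blast
    fix e assume e: "e \<in> E" "homogeneous_lift (Suc t) e \<in> interpolated t"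
    obtain r where r: "homogeneous_lift (Suc t) e - r \<in> affine_ideal" "r \<in> tdeg_le t" using e(2) by (rule interpolatedE)
    have "homogeneous_lift (Suc t) e - r \<in> tdeg_le (Suc t)"
      by (intro tdeg_le_diff lift_tdeg tdeg_le_mono[OF r(2)]) simp
    then have "lead_form (Suc t) (homogeneous_lift (Suc t) e - r) \<in> ?V" using r(1) by blast
    moreover have "lead_form (Suc t) (homogeneous_lift (Suc t) e - r) = e"
      using e(1) E(5) tdeg_le_lead_form_eq_0[OF r(2), of "Suc t"] by (auto simp: lead_form_diff lift_lead)
    ultimately show "e = 0" using dE(1) e(1) by simp
  next
    fix p assume "p \<in> interpolated (Suc t)"
    then obtain r where r: "p - r \<in> affine_ideal" "r \<in> tdeg_le (Suc t)" by (rule interpolatedE)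
    have "lead_form (Suc t) r \<in> ?D" using degree_lead_form by auto
    then obtain e where e: "e \<in> E" "lead_form (Suc t) r - e \<in> ?V" using dE(2) by blast
    then obtain b where b: "b \<in> affine_ideal" "b \<in> tdeg_le (Suc t)" "lead_form (Suc t) r - e = lead_form (Suc t) b"
      by blast
    let ?s = "r - homogeneous_lift (Suc t) e - b"
    have "?s \<in> tdeg_le (Suc t)" by (intro tdeg_le_diff r(2) lift_tdeg b(2))
    moreover have "lead_form (Suc t) ?s = 0"
      using b(3) e(1) E(5) lift_lead[of e] by (auto simp: lead_form_diff)
    ultimately have s: "?s \<in> tdeg_le t" by (rule lead_form_zero_tdeg)
    have "(p - r) + b \<in> affine_ideal" by (rule ideal.subspace_add[OF ideal_affine_ideal r(1) b(1)])
    moreover have "(p - r) + b = (p - homogeneous_lift (Suc t) e) - ?s" by (simp only: algebra_simps)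
    ultimately have "p - homogeneous_lift (Suc t) e \<in> interpolated t" using s by (metis interpolatedI)
    then show "\<exists>e\<in>E. p - homogeneous_lift (Suc t) e \<in> interpolated t" using e(1) by blast
  qed
  obtain C1 :: "'k poly poly set" where C1: "finite C1" "bpoly.span (interpolated (Suc t) \<union> C1) = UNIV"
    by (rule interpolated_finite_codim)
  obtain C2 :: "'k poly poly set" where C2: "finite C2" "C2 \<subseteq> tdeg_le (Suc t)" "tdeg_le (Suc t) \<subseteq> bpoly.span C2"
    by (rule tdeg_le_span)
  have C2l: "C2 \<subseteq> interpolated (Suc t)" using C2(2) tdeg_le_interpolated by blast
  have C2s: "interpolated (Suc t) \<subseteq> bpoly.span (interpolated t \<union> C2)"
  proof
    fix p assume "p \<in> interpolated (Suc t)"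
    then obtain r where r: "p - r \<in> affine_ideal" "r \<in> tdeg_le (Suc t)" by (rule interpolatedE)
    have "p - r \<in> interpolated t" using interpolatedI[of "p - r" 0 t] r(1) by simp
    then have "p - r \<in> bpoly.span (interpolated t \<union> C2)" by (intro bpoly.span_base) simp
    moreover have "r \<in> bpoly.span (interpolated t \<union> C2)" using r(2) C2(3) bpoly.span_mono[of C2 "interpolated t \<union> C2"] by blast
    ultimately have "(p - r) + r \<in> bpoly.span (interpolated t \<union> C2)" by (rule bpoly.span_add)
    then show "p \<in> bpoly.span (interpolated t \<union> C2)" by simp
  qed
  have add: "bpoly.quotient_dim UNIV (interpolated t) =
      bpoly.quotient_dim UNIV (interpolated (Suc t)) + bpoly.quotient_dim (interpolated (Suc t)) (interpolated t)"
    by (rule bpoly.quotient_dim_additive[OF subspace_interpolated subspace_interpolated bpoly.subspace_UNIV _ subset_UNIV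
          C1(1) subset_UNIV _ C2(1) C2l C2s]) (use C1(2) interpolated_mono in auto)
  have "upoly.quotient_dim ?D {0} = upoly.quotient_dim ?D ?V + upoly.quotient_dim ?V {0}"
  proof -
    obtain BV where BV: "BV \<subseteq> ?V" "upoly.independent BV" "?V \<subseteq> upoly.span BV" by (rule upoly.basis_exists[of ?V])
    have "BV \<subseteq> upoly.span ?C" using BV(1) VD degree_le_span_monom by blast
    then have "finite BV" using upoly.independent_span_bound[OF C(1) BV(2)] by blast
    then show ?thesis
      using BV upoly.span_mono[of BV "{0} \<union> BV"] upoly.subspace_0[OF subV]
      by (intro upoly.quotient_dim_additive[OF upoly.subspace_single_0 subV subspace_degree_le _ VD C, of BV]) auto
  qed
  moreover have "upoly.quotient_dim A {0} = upoly.dim A" if "upoly.subspace A" for A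
    by (rule upoly.quotient_dim_complement)
      (use that upoly.subspace_0[OF that] in \<open>auto intro: bexI[of _ _ A]\<close>)
  ultimately have "Suc (Suc t) = upoly.dim E + upoly.dim ?V"
    using subV subspace_degree_le dim_degree_le qE by metis
  then show ?thesis unfolding h1_affine add q2 by simp
qed

end

section \<open>Saturated ideals and the affine ideal\<close>

text \<open>Membership is tested on homogeneous components; multiplication by an arbitrary polynomial is reduced
  to constants and variables.\<close>

lemma graded_ideal:
  fixes J :: "nat \<Rightarrow> ('v::finite, 'k::comm_ring_1) hpoly set"
  assumes J0: "\<And>t. 0 \<in> J t" and Ja: "\<And>t f g. f \<in> J t \<Longrightarrow> g \<in> J t \<Longrightarrow> f + g \<in> J t"
    and Jm: "\<And>s t h f. h \<in> forms s \<Longrightarrow> f \<in> J t \<Longrightarrow> h * f \<in> J (s + t)"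
  shows "ideal.subspace {f. \<forall>t. component t f \<in> J t}" (is "ideal.subspace ?H")
  unfolding ideal.subspace_def
proof (intro conjI ballI allI)
  show "0 \<in> ?H" using J0 by simp
  show "f + g \<in> ?H" if "f \<in> ?H" "g \<in> ?H" for f g using that Ja by (simp add: component_add)
  have "\<forall>f\<in>?H. c * f \<in> ?H" for c
  proof (induction c rule: hpoly_induct)
    case (const a)
    have "component t (Poly_Mapping.single 0 a * f) = Poly_Mapping.single 0 a * component t f" for t and f :: "('v, 'k) hpoly"
      using component_mult_form[OF forms_const, of t a f] by simp
    then show ?case using Jm[OF forms_const] by fastforce
  next
    case (var i)
    show ?case
    proof (intro ballI CollectI allI)
      fix f t assume f: "f \<in> ?H"
      show "component t (var i * f) \<in> J t"
      proof (cases t)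
        case 0
        then show ?thesis using component_mult_low[OF forms_var, of 0 i f] J0 by simp
      next
        case (Suc n)
        have "var i * component n f \<in> J (1 + n)" using f by (intro Jm forms_var) simp
        then show ?thesis using component_mult_form[OF forms_var, of n i f] Suc by simp
      qed
    qed
  next
    case (add g h)
    then show ?case using Ja by (simp add: distrib_right component_add)
  next
    case (mult g h)
    show ?case
    proof
      fix f assume "f \<in> ?H"
      then have "h * f \<in> ?H" using mult(2) by blast
      then have "g * (h * f) \<in> ?H" using mult(1) by blast
      then show "g * h * f \<in> ?H" by (simp only: mult.assoc)
    qed
  qed
  then show "c * f \<in> ?H" if "f \<in> ?H" for c f using that by blast
qed

lemma closed_subscheme_component:
  fixes I :: "('v::finite, 'k::comm_ring_1) hpoly set"
  assumes I: "closed_subscheme I" and f: "f \<in> I"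
  shows "component t f \<in> I"
proof -
  have Is: "ideal.subspace I" and sp: "ideal.span {f \<in> I. \<exists>t. f \<in> forms t} = I"
    using I by (auto simp: closed_subscheme_def)
  have "ideal.subspace {f. \<forall>t. component t f \<in> I \<inter> forms t}"
    by (rule graded_ideal)
      (auto intro: ideal.subspace_0[OF Is] ideal.subspace_add[OF Is] ideal.subspace_scale[OF Is] forms_add forms_mult)
  moreover have "{f \<in> I. \<exists>t. f \<in> forms t} \<subseteq> {f. \<forall>t. component t f \<in> I \<inter> forms t}"
  proof
    fix f assume f: "f \<in> {f \<in> I. \<exists>t. f \<in> forms t}"
    then obtain s where s: "f \<in> forms s" by blast
    have "component t f \<in> I" for t
      using f ideal.subspace_0[OF Is] by (auto simp: component_of_form[OF s])
    then show "f \<in> {f. \<forall>t. component t f \<in> I \<inter> forms t}" using component_forms by blast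
  qed
  ultimately have "I \<subseteq> {f. \<forall>t. component t f \<in> I \<inter> forms t}"
    using ideal.span_minimal sp by blast
  then show ?thesis using f by blast
qed

lemma sat_forms_closed:
  assumes "closed_subscheme I" shows "sat_forms I t = I \<inter> forms t"
proof
  show "sat_forms I t \<subseteq> I \<inter> forms t"
    using assms unfolding closed_subscheme_def sat_forms_def by blast
  have "var i ^ N * f \<in> I" if "f \<in> I" for f i N
    using assms that ideal.subspace_scale unfolding closed_subscheme_def by blast
  then show "I \<inter> forms t \<subseteq> sat_forms I t" unfolding sat_forms_def by blast
qed

lemma tdeg_le_0_const: "p \<in> tdeg_le 0 \<Longrightarrow> p = [:[:coeff (coeff p 0) 0:]:]"
  by (rule poly_eqI, rule poly_eqI) (auto simp: coeff_pCons tdeg_leD split: nat.splits)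

text \<open>If a product of factors carries \<open>g\<close> into an ideal, a last multiple outside the ideal exists.\<close>

lemma last_multiple_outside:
  fixes A :: "'a::comm_ring_1 set"
  assumes "(\<Prod>c\<leftarrow>cs. F c) * g \<in> A" "g \<notin> A"
  shows "\<exists>h c. h * g \<notin> A \<and> F c * (h * g) \<in> A"
  using assms(1)
proof (induction cs)
  case Nil
  then show ?case using assms(2) by simp
next
  case (Cons c cs)
  show ?case
  proof (cases "(\<Prod>c\<leftarrow>cs. F c) * g \<in> A")
    case False
    moreover have "F c * ((\<Prod>c\<leftarrow>cs. F c) * g) \<in> A"
      using Cons.prems by (simp only: list.map prod_list.Cons mult.assoc)
    ultimately show ?thesis by blast
  qed (rule Cons.IH)
qed

context plane_chart
begin

lemma plane_chart_mono:
  assumes "ideal.subspace I'" "I \<subseteq> I'" shows "plane_chart I' l u K \<rho>"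
proof -
  have "line_section I' l u K" by unfold_locales (use assms l K u lu in auto)
  then show ?thesis
    by (intro plane_chart.intro plane_chart_axioms.intro rho_add rho_mult rho_const rho_l rho_forms rho_inj)
qed

lemma affine_ideal_mono:
  assumes "ideal.subspace I'" "I \<subseteq> I'" shows "affine_ideal \<subseteq> plane_chart.affine_ideal I' \<rho>"
proof -
  interpret c: plane_chart I' l u K \<rho> by (rule plane_chart_mono[OF assms])
  have "sat_forms I t \<subseteq> sat_forms I' t" for t using assms(2) unfolding sat_forms_def by blast
  then show ?thesis unfolding affine_ideal_def c.affine_ideal_def by blast
qed

text \<open>The homogenisation of an ideal of the affine chart, that is, the closure in the plane of an affine
  scheme.\<close>

definition scheme_of :: "'k poly poly set \<Rightarrow> (3, 'k) hpoly set" where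
  "scheme_of J = {f. \<forall>t. \<rho> (component t f) \<in> J}"

lemma scheme_of_form:
  assumes "ideal.subspace J" "f \<in> forms t" shows "f \<in> scheme_of J \<longleftrightarrow> \<rho> f \<in> J"
proof -
  have "\<rho> (component n f) = (if t = n then \<rho> f else 0)" for n
    using component_of_form[OF assms(2), of n] by (simp add: rho.zero)
  then show ?thesis unfolding scheme_of_def using ideal.subspace_0[OF assms(1)] by auto
qed

text \<open>For saturation: a power of \<open>l\<close> is a combination of powers of the variables, and \<open>l\<close> becomes 1 in the
  chart, so that the restrictions of these powers generate the unit ideal.\<close>

lemma closed_scheme_of:
  assumes J: "ideal.subspace J" shows "closed_subscheme (scheme_of J)"
  unfolding closed_subscheme_def
proof (intro conjI allI impI)
  have "ideal.subspace {f. \<forall>t. component t f \<in> {g. \<rho> g \<in> J}}"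
  proof (rule graded_ideal)
    show "0 \<in> {g. \<rho> g \<in> J}" for t :: nat using ideal.subspace_0[OF J] by (simp add: rho.zero)
    show "f + g \<in> {g. \<rho> g \<in> J}" if "f \<in> {g. \<rho> g \<in> J}" "g \<in> {g. \<rho> g \<in> J}" for t :: nat and f g
      using that ideal.subspace_add[OF J] by (simp add: rho_add)
    show "h * f \<in> {g. \<rho> g \<in> J}" if "f \<in> {g. \<rho> g \<in> J}" for s t :: nat and h f
      using that ideal.subspace_scale[OF J] by (simp add: rho_mult)
  qed
  then show sub: "ideal.subspace (scheme_of J)" unfolding scheme_of_def by simp
  show "ideal.span {f \<in> scheme_of J. \<exists>t. f \<in> forms t} = scheme_of J"
  proof
    show "ideal.span {f \<in> scheme_of J. \<exists>t. f \<in> forms t} \<subseteq> scheme_of J"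
      by (rule ideal.span_minimal[OF _ sub]) blast
    show "scheme_of J \<subseteq> ideal.span {f \<in> scheme_of J. \<exists>t. f \<in> forms t}"
    proof
      fix f assume f: "f \<in> scheme_of J"
      have "component t f \<in> {f \<in> scheme_of J. \<exists>t. f \<in> forms t}" for t
        using f component_forms[of t f] scheme_of_form[OF J component_forms] by (auto simp: scheme_of_def)
      then have "(\<Sum>t\<in>exp_degree ` Poly_Mapping.keys f. component t f) \<in> ideal.span {f \<in> scheme_of J. \<exists>t. f \<in> forms t}"
        by (intro ideal.span_sum ideal.span_base)
      then show "f \<in> ideal.span {f \<in> scheme_of J. \<exists>t. f \<in> forms t}" unfolding sum_components .
    qed
  qed
  fix f assume sat: "\<forall>i. \<exists>N. var i ^ N * f \<in> scheme_of J"
  then obtain N0 where N0: "\<And>i. var i ^ N0 i * f \<in> scheme_of J" by metis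
  define N where "N = (\<Sum>i\<in>UNIV. N0 i)"
  have N: "var i ^ N * f \<in> scheme_of J" for i
  proof -
    have "N0 i \<le> N" unfolding N_def by (rule member_le_sum) auto
    then have "var i ^ N = var i ^ (N - N0 i) * (var i ^ N0 i :: (3, 'k) hpoly)" by (simp flip: power_add)
    then show ?thesis using ideal.subspace_scale[OF sub N0[of i]] by (simp only: mult.assoc)
  qed
  show "f \<in> scheme_of J" unfolding scheme_of_def
  proof (intro CollectI allI)
    fix t
    have c: "\<rho> (var i ^ N) * \<rho> (component t f) \<in> J" for i
      using N[of i] component_mult_form[OF forms_var_power, of N t i f]
      unfolding scheme_of_def by (metis (mono_tags, lifting) mem_Collect_eq rho_mult)
    obtain a where a: "l ^ (3 * N) = (\<Sum>i\<in>UNIV. a i * var i ^ N)"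
      by (rule forms_high_degree[OF l_power_form[of "3 * N"], of N]) auto
    have "\<rho> (component t f) = \<rho> (l ^ (3 * N) * component t f)" by (simp only: rho_l_power)
    also have "\<dots> = (\<Sum>i\<in>UNIV. \<rho> (a i) * (\<rho> (var i ^ N) * \<rho> (component t f)))"
      unfolding a sum_distrib_right rho.sum by (simp only: rho_mult mult.assoc)
    also have "\<dots> \<in> J" by (intro ideal.subspace_sum[OF J] ideal.subspace_scale[OF J] c)
    finally show "\<rho> (component t f) \<in> J" .
  qed
qed

lemma linear_product_affine:
  assumes m: "m \<in> forms 1" and cs: "(\<Prod>c\<leftarrow>cs. m - smult_pm c l) \<in> I"
  shows "(\<Prod>c\<leftarrow>cs. \<rho> m - [:[:c:]:]) \<in> affine_ideal"
proof -
  have "(\<Prod>c\<leftarrow>cs. m - smult_pm c l) \<in> forms (length cs)"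
  proof (induction cs)
    case (Cons c cs)
    have "m - smult_pm c l \<in> forms 1" by (intro forms_diff m forms_smult l)
    then show ?case using forms_mult[of "m - smult_pm c l" 1 _ "length cs"] Cons by simp
  qed (simp add: forms_1)
  then have "(\<Prod>c\<leftarrow>cs. m - smult_pm c l) \<in> sat_forms I (length cs)"
    unfolding sat_forms_def using mult_I[OF cs] by blast
  then have "\<rho> (\<Prod>c\<leftarrow>cs. m - smult_pm c l) \<in> affine_ideal" unfolding affine_ideal_def by blast
  moreover have "\<rho> (\<Prod>c\<leftarrow>cs. m - smult_pm c l) = (\<Prod>c\<leftarrow>cs. \<rho> m - [:[:c:]:])"
    by (induction cs) (simp_all add: rho_1 rho_mult rho.diff rho.scale rho_l)
  ultimately show ?thesis by simp
qed

end

section \<open>Critical schemes\<close>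

locale critical_chart = plane_chart I l u K \<rho> for I :: "(3, 'k::field) hpoly set" and l u K \<rho> +
  fixes d :: nat
  assumes closed: "closed_subscheme I" and h1_pos: "h_ideal 1 I (int d) > 0"
    and critical: "\<And>I'. closed_subscheme I' \<Longrightarrow> I \<subset> I' \<Longrightarrow> h_ideal 1 I' (int d) = 0"
begin

lemma interpolated_neq_UNIV: "interpolated d \<noteq> UNIV"
  using h1_pos h1_eq_0_iff[of d] by (metis less_irrefl)

text \<open>A larger ideal \<open>J\<close> of the chart is the ideal of a proper subscheme, which has no cohomology in
  degree \<open>d\<close>.\<close>

lemma critical_ideal:
  assumes J: "ideal.subspace J" and sub: "affine_ideal \<subset> J"
  shows "\<exists>r\<in>tdeg_le d. p - r \<in> J"
proof -
  have cl: "closed_subscheme (scheme_of J)" by (rule closed_scheme_of[OF J])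
  then have id: "ideal.subspace (scheme_of J)" by (simp add: closed_subscheme_def)
  have le: "I \<subseteq> scheme_of J"
  proof
    fix f assume f: "f \<in> I"
    have "component t f \<in> sat_forms I t" for t
      using closed_subscheme_component[OF closed f] component_forms sat_forms_closed[OF closed] by blast
    then have "\<rho> (component t f) \<in> affine_ideal" for t unfolding affine_ideal_def by blast
    then show "f \<in> scheme_of J" unfolding scheme_of_def using sub by blast
  qed
  obtain q where q: "q \<in> J" "q \<notin> affine_ideal" using sub by blast
  obtain n where "q \<in> tdeg_le n" using tdeg_le_ex by blast
  then obtain f where f: "f \<in> forms n" "q = \<rho> f" using rho_forms[of n] by blast
  have "f \<in> scheme_of J" using scheme_of_form[OF J f(1)] q(1) f(2) by simp
  moreover have "f \<notin> I" using q(2) f rho_in_affine_ideal_iff[OF f(1)] sat_forms_closed[OF closed] by blast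
  ultimately have "I \<subset> scheme_of J" using le by blast
  then have h0: "h_ideal 1 (scheme_of J) (int d) = 0" by (rule critical[OF cl])
  interpret c: plane_chart "scheme_of J" l u K \<rho> by (rule plane_chart_mono[OF id le])
  have "p \<in> c.interpolated d" using h0 c.h1_eq_0_iff by simp
  then obtain r where r: "p - r \<in> c.affine_ideal" "r \<in> tdeg_le d" by (rule c.interpolatedE)
  obtain t g where g: "g \<in> sat_forms (scheme_of J) t" "g \<in> forms t" "p - r = \<rho> g"
    by (rule c.affine_ideal_form[OF r(1)])
  have "p - r \<in> J" using g scheme_of_form[OF J g(2)] sat_forms_closed[OF cl] by auto
  with r(2) show ?thesis by blast
qed

text \<open>No function that is not zero on the scheme has all its multiples interpolated in degree \<open>d\<close>:
  such functions form an ideal, and by criticality it is not larger than the ideal of the scheme.\<close>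

lemma multiples_interpolated_imp_zero:
  assumes F: "\<And>w. F * w \<in> interpolated d" shows "F \<in> affine_ideal"
proof -
  define J where "J = {p. \<forall>w. p * w \<in> interpolated d}"
  have J: "ideal.subspace J"
    unfolding ideal.subspace_def J_def
  proof (intro conjI ballI allI CollectI)
    show "0 * w \<in> interpolated d" for w using bpoly.subspace_0[OF subspace_interpolated] by simp
    show "(p + q) * w \<in> interpolated d" if "p \<in> {p. \<forall>w. p * w \<in> interpolated d}" "q \<in> {p. \<forall>w. p * w \<in> interpolated d}" for p q w
      using that bpoly.subspace_add[OF subspace_interpolated] by (simp add: distrib_right)
    show "(c * p) * w \<in> interpolated d" if p: "p \<in> {p. \<forall>w. p * w \<in> interpolated d}" for c p w
    proof -
      have "p * (c * w) \<in> interpolated d" using p by blast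
      then show ?thesis by (simp only: mult.assoc mult.left_commute)
    qed
  qed
  have aff_int: "a \<in> interpolated d" if "a \<in> affine_ideal" for a
    using interpolatedI[of a 0 d] that by simp
  have sub: "affine_ideal \<subseteq> J"
    unfolding J_def using aff_int ideal_mult_right[OF ideal_affine_ideal] by blast
  have "J = affine_ideal"
  proof (rule ccontr)
    assume "J \<noteq> affine_ideal"
    then have "affine_ideal \<subset> J" using sub by blast
    note crit = critical_ideal[OF J this]
    have "p \<in> interpolated d" for p
    proof -
      obtain r where r: "r \<in> tdeg_le d" "p - r \<in> J" using crit by blast
      have "(p - r) * 1 \<in> interpolated d" using r(2) unfolding J_def by blast
      moreover have "r \<in> interpolated d" using r(1) tdeg_le_interpolated by blast
      ultimately have "(p - r) * 1 + r \<in> interpolated d" by (rule bpoly.subspace_add[OF subspace_interpolated])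
      then show ?thesis by simp
    qed
    then show False using interpolated_neq_UNIV by blast
  qed
  then show ?thesis using F unfolding J_def by blast
qed

text \<open>A function \<open>g\<close> on the scheme that \<open>X - a\<close> and \<open>Y - b\<close> annihilate, but that is not zero, spans an
  ideal of dimension one.  By criticality, enlarging the ideal of the scheme by \<open>g\<close> removes all
  cohomology in degree \<open>d\<close>.\<close>

lemma h1_eq_1:
  assumes X: "(\<Prod>c\<leftarrow>cs. varX - [:[:c:]:]) \<in> affine_ideal"
    and Y: "(\<Prod>c\<leftarrow>cs'. varY - [:[:c:]:]) \<in> affine_ideal"
  shows "h_ideal 1 I (int d) = 1"
proof -
  note A = ideal_affine_ideal
  note A_add = ideal.subspace_add[OF A] and A_mult = ideal.subspace_scale[OF A]
  have one: "1 \<notin> affine_ideal"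
  proof
    assume "1 \<in> affine_ideal"
    then have "p \<in> affine_ideal" for p using A_mult[of 1 p] by simp
    then have "p \<in> interpolated d" for p using interpolatedI[of p 0 d] by simp
    then show False using interpolated_neq_UNIV by blast
  qed
  obtain h a where ha: "h * 1 \<notin> affine_ideal" "(varX - [:[:a:]:]) * (h * 1) \<in> affine_ideal"
    using last_multiple_outside[of "\<lambda>c. varX - [:[:c:]:]" cs 1 affine_ideal] X one by auto
  have "(\<Prod>c\<leftarrow>cs'. varY - [:[:c:]:]) * (h * 1) \<in> affine_ideal"
    by (rule ideal_mult_right[OF A Y])
  then obtain k b where kb: "k * (h * 1) \<notin> affine_ideal" "(varY - [:[:b:]:]) * (k * (h * 1)) \<in> affine_ideal"
    using last_multiple_outside[of "\<lambda>c. varY - [:[:c:]:]" cs' "h * 1" affine_ideal] ha(1) by blast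
  define g where "g = k * (h * 1)"
  have g: "g \<notin> affine_ideal" "(varY - [:[:b:]:]) * g \<in> affine_ideal" unfolding g_def by (fact kb)+
  have gX: "(varX - [:[:a:]:]) * g \<in> affine_ideal"
    using A_mult[OF ha(2), of k] by (simp only: g_def mult.left_commute)
  \<comment> \<open>Multiplication by any \<open>p\<close> acts on \<open>g\<close> as its value at the point \<open>(a, b)\<close>.\<close>
  have eig: "\<exists>c. p * g - [:[:c:]:] * g \<in> affine_ideal" if "p \<in> tdeg_le n" for p n
    using that
  proof (induction n arbitrary: p)
    case 0
    show ?case
      by (rule exI[of _ "coeff (coeff p 0) 0"], subst (1) tdeg_le_0_const[OF 0])
        (simp only: diff_self ideal.subspace_0[OF A])
  next
    case (Suc n)
    obtain q r e where q: "q \<in> tdeg_le n" "r \<in> tdeg_le n" "p = varX * q + varY * r + [:[:e:]:]"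
      by (rule tdeg_le_Suc_decompose[OF Suc.prems])
    obtain c1 c2 where c: "q * g - [:[:c1:]:] * g \<in> affine_ideal" "r * g - [:[:c2:]:] * g \<in> affine_ideal"
      using Suc.IH q(1,2) by metis
    have k: "[:[:c1:]:] * [:[:a:]:] = [:[:c1 * a:]:]" "[:[:c2:]:] * [:[:b:]:] = [:[:c2 * b:]:]"
      "[:[:c1 * a + c2 * b + e:]:] = [:[:c1 * a:]:] + [:[:c2 * b:]:] + [:[:e:]:]" by simp_all
    have "varX * (q * g - [:[:c1:]:] * g) + [:[:c1:]:] * ((varX - [:[:a:]:]) * g) +
       (varY * (r * g - [:[:c2:]:] * g) + [:[:c2:]:] * ((varY - [:[:b:]:]) * g)) \<in> affine_ideal"
      by (intro A_add A_mult c gX g)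
    moreover have "varX * (q * g - [:[:c1:]:] * g) + [:[:c1:]:] * ((varX - [:[:a:]:]) * g) +
       (varY * (r * g - [:[:c2:]:] * g) + [:[:c2:]:] * ((varY - [:[:b:]:]) * g)) =
       p * g - [:[:c1 * a + c2 * b + e:]:] * g"
      unfolding q(3) k(3) k(1,2)[symmetric] by (simp only: algebra_simps)
    ultimately show ?case by metis
  qed
  define J where "J = {p. \<exists>c. p - [:[:c:]:] * g \<in> affine_ideal}"
  have J: "ideal.subspace J"
    unfolding ideal.subspace_def J_def
  proof (intro conjI ballI allI CollectI)
    show "\<exists>c. 0 - [:[:c:]:] * g \<in> affine_ideal"
      using ideal.subspace_0[OF A] by (intro exI[of _ 0]) simp
    show "\<exists>c. p + q - [:[:c:]:] * g \<in> affine_ideal"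
      if pq: "p \<in> {p. \<exists>c. p - [:[:c:]:] * g \<in> affine_ideal}" "q \<in> {p. \<exists>c. p - [:[:c:]:] * g \<in> affine_ideal}" for p q
    proof -
      obtain c1 c2 where c: "p - [:[:c1:]:] * g \<in> affine_ideal" "q - [:[:c2:]:] * g \<in> affine_ideal" using pq by blast
      have k: "[:[:c1 + c2:]:] = [:[:c1:]:] + [:[:c2:]:]" by simp
      have "p + q - [:[:c1 + c2:]:] * g = (p - [:[:c1:]:] * g) + (q - [:[:c2:]:] * g)"
        unfolding k by (simp only: algebra_simps)
      then show ?thesis using A_add[OF c] by metis
    qed
    show "\<exists>c. q * p - [:[:c:]:] * g \<in> affine_ideal"
      if p: "p \<in> {p. \<exists>c. p - [:[:c:]:] * g \<in> affine_ideal}" for q p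
    proof -
      obtain c1 where c1: "p - [:[:c1:]:] * g \<in> affine_ideal" using p by blast
      obtain n where "q * [:[:c1:]:] \<in> tdeg_le n" using tdeg_le_ex by blast
      then obtain c2 where c2: "(q * [:[:c1:]:]) * g - [:[:c2:]:] * g \<in> affine_ideal" using eig by blast
      have "q * (p - [:[:c1:]:] * g) + ((q * [:[:c1:]:]) * g - [:[:c2:]:] * g) \<in> affine_ideal"
        by (intro A_add A_mult c1 c2)
      moreover have "q * (p - [:[:c1:]:] * g) + ((q * [:[:c1:]:]) * g - [:[:c2:]:] * g) = q * p - [:[:c2:]:] * g"
        by (simp only: algebra_simps)
      ultimately show ?thesis by metis
    qed
  qed
  have "g \<in> J" unfolding J_def using ideal.subspace_0[OF A] by (intro CollectI exI[of _ 1]) (simp flip: one_pCons)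
  moreover have "affine_ideal \<subseteq> J" unfolding J_def by (intro subsetI CollectI exI[of _ 0]) simp
  ultimately have sub: "affine_ideal \<subset> J" using g(1) by blast
  have "\<exists>c. p - smult [:c:] g \<in> interpolated d" for p
  proof -
    obtain r where r: "r \<in> tdeg_le d" "p - r \<in> J" using critical_ideal[OF J sub] by blast
    then obtain c where "p - r - [:[:c:]:] * g \<in> affine_ideal" unfolding J_def by blast
    then have "(p - smult [:c:] g) - r \<in> affine_ideal" by (simp add: algebra_simps)
    then show ?thesis using interpolatedI r(1) by blast
  qed
  then have "h_ideal 1 I (int d) \<le> 1" by (rule h1_le_1)
  then show ?thesis using h1_pos by simp
qed

end

section \<open>Coordinates adapted to a finite set of points\<close>

text \<open>As \<open>c\<close> varies, the lines through the point \<open>(1, a, b)\<close> other than \<open>var 2 = b * var 0\<close>.\<close>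

definition chart_form :: "'k::comm_ring_1 \<Rightarrow> 'k \<Rightarrow> 'k \<Rightarrow> (3, 'k) hpoly" where
  "chart_form a b c = (var 1 - smult_pm a (var 0)) + smult_pm c (var 2 - smult_pm b (var 0))"

text \<open>The homogeneous coordinates as affine linear functions of \<open>X = var 0\<close> and
  \<open>Y = var 2 - b * var 0\<close>, where \<open>chart_form a b c = 1\<close>.  The point at infinity of the \<open>X\<close>-axis is
  \<open>(1, a, b)\<close>.\<close>

definition chart_coords :: "'k::comm_ring_1 \<Rightarrow> 'k \<Rightarrow> 'k \<Rightarrow> 3 \<Rightarrow> 'k poly poly" where
  "chart_coords a b c i = (if i = 0 then varX
     else if i = 1 then 1 - [:[:c:]:] * varY + [:[:a:]:] * varX else varY + [:[:b:]:] * varX)"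

definition chart_map :: "'k::comm_ring_1 \<Rightarrow> 'k \<Rightarrow> 'k \<Rightarrow> (3, 'k) hpoly \<Rightarrow> 'k poly poly" where
  "chart_map a b c = insertion (\<lambda>x. [:[:x:]:]) (chart_coords a b c)"

lemma chart_form_forms: "chart_form a b c \<in> forms 1"
  unfolding chart_form_def by (intro forms_add forms_diff forms_smult forms_var)

lemma chart_map_var:
  "chart_map a b c (var 0) = varX" "chart_map a b c (var 1) = 1 - [:[:c:]:] * varY + [:[:a:]:] * varX"
  "chart_map a b c (var 2) = varY + [:[:b:]:] * varX"
  using neq_3 by (simp_all add: chart_map_def chart_coords_def del: mult_pCons_left)

lemma chart_map_hom:
  "chart_map a b c (f + g) = chart_map a b c f + chart_map a b c g"
  "chart_map a b c (f - g) = chart_map a b c f - chart_map a b c g"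
  "chart_map a b c (f * g) = chart_map a b c f * chart_map a b c g"
  "chart_map a b c (Poly_Mapping.single 0 x) = [:[:x:]:]"
  "chart_map a b c (smult_pm x f) = [:[:x:]:] * chart_map a b c f"
  by (simp_all only: chart_map_def poly2_hom.insertion_add poly2_hom.insertion_diff poly2_hom.insertion_mult
      poly2_hom.insertion_const poly2_hom.insertion_smult_pm)

lemma chart_map_form: "chart_map a b c (chart_form a b c) = 1"
  unfolding chart_form_def chart_map_hom chart_map_var by (simp only: algebra_simps)

lemma chart_map_beta: "chart_map a b c (var 2 - smult_pm b (var 0)) = varY"
  unfolding chart_map_hom chart_map_var by (simp only: algebra_simps)

lemma chart_coords_tdeg: "chart_coords a b c i \<in> tdeg_le 1"
  and chart_coords_top: "top_X 1 (chart_coords a b c i) = (if i = 0 then 1 else if i = 1 then a else b)"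
  using neq_3 by (auto simp: chart_coords_def tdeg_le_def top_X_def coeff_pCons split: nat.splits if_splits)

lemma chart_map_in: "f \<in> forms t \<Longrightarrow> chart_map a b c f \<in> tdeg_le t"
  for a :: "'k::field"
  unfolding chart_map_def using insertion_forms[of f t "chart_coords a b c", OF _ chart_coords_tdeg] by blast

lemma chart_map_top: "f \<in> forms t \<Longrightarrow>
    top_X t (chart_map a b c f) = eval_at f (\<chi> i. if i = 0 then 1 else if i = 1 then a else b)"
  for a :: "'k::field"
  unfolding chart_map_def using insertion_forms[of f t "chart_coords a b c", OF _ chart_coords_tdeg]
  unfolding chart_coords_top by blast

lemma chart_map_onto:
  fixes a :: "'k::field"
  assumes "p \<in> tdeg_le t" shows "\<exists>f\<in>forms t. p = chart_map a b c f"
  using assms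
proof (induction t arbitrary: p)
  case 0
  then show ?case
    using tdeg_le_0_const[OF 0] forms_const by (metis chart_map_hom(4))
next
  case (Suc t)
  obtain q r e where q: "q \<in> tdeg_le t" "r \<in> tdeg_le t" "p = varX * q + varY * r + [:[:e:]:]"
    by (rule tdeg_le_Suc_decompose[OF Suc.prems])
  obtain f g where fg: "f \<in> forms t" "q = chart_map a b c f" "g \<in> forms t" "r = chart_map a b c g"
    using Suc.IH[OF q(1)] Suc.IH[OF q(2)] by blast
  let ?h = "var 0 * f + (var 2 - smult_pm b (var 0)) * g + smult_pm e (chart_form a b c ^ Suc t)"
  have pow: "chart_map a b c (chart_form a b c ^ n) = 1" for n
    unfolding chart_map_def poly2_hom.insertion_power
    unfolding chart_map_def[symmetric] chart_map_form by simp
  have 1: "1 + t = Suc t" by simp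
  have "var 0 * f \<in> forms (1 + t)" "(var 2 - smult_pm b (var 0)) * g \<in> forms (1 + t)"
    by (intro forms_mult forms_diff forms_smult forms_var fg)+
  moreover have "chart_form a b c ^ Suc t \<in> forms (Suc t)"
    using forms_power[OF chart_form_forms, of a b c "Suc t"] by simp
  ultimately have "?h \<in> forms (Suc t)" unfolding 1 by (intro forms_add forms_smult)
  moreover have "p = chart_map a b c ?h"
    unfolding chart_map_hom(1,3,5) chart_map_beta chart_map_var(1) pow q(3) fg(2,4) by (simp only: mult_1_right)
  ultimately show ?case by blast
qed

lemma insertion_linear_forms:
  fixes f :: "('v::finite, 'k::comm_ring_1) hpoly" and y :: "'v \<Rightarrow> ('v, 'k) hpoly"
  assumes f: "f \<in> forms t" and y: "\<And>i. y i \<in> forms 1"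
  shows "insertion (Poly_Mapping.single 0) y f \<in> forms t"
  unfolding insertion_def
proof (rule forms_sum)
  fix m assume "m \<in> Poly_Mapping.keys f"
  then have t: "(\<Sum>i\<in>UNIV. Poly_Mapping.lookup m i) = t" using f by (auto simp: forms_def exp_degree_def)
  have p: "y j ^ n \<in> forms n" for j n using forms_power[OF y[of j], where n = n] by simp
  have "(\<Prod>i\<in>A. y i ^ Poly_Mapping.lookup m i) \<in> forms (\<Sum>i\<in>A. Poly_Mapping.lookup m i)" for A
  proof (induction A rule: infinite_finite_induct)
    case (insert j A)
    then show ?case using forms_mult[OF p] by simp
  qed (simp_all add: forms_1)
  then show "Poly_Mapping.single 0 (Poly_Mapping.lookup f m) * (\<Prod>i\<in>UNIV. y i ^ Poly_Mapping.lookup m i) \<in> forms t"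
    using forms_mult[OF forms_const] t by fastforce
qed

text \<open>Setting the second coordinate to 1 determines a form: no two of its monomials collide.\<close>

lemma dehomogenize_inj:
  fixes f :: "(3, 'k::comm_ring_1) hpoly"
  assumes f: "f \<in> forms t"
    and z: "insertion (\<lambda>x. [:[:x:]:]) (\<lambda>i. if i = 0 then varX else if i = 1 then 1 else varY) f = 0"
  shows "f = 0"
proof (rule ccontr)
  assume "f \<noteq> 0"
  then obtain m where m: "m \<in> Poly_Mapping.keys f" by (metis all_not_in_conv keys_eq_empty)
  have deg: "Poly_Mapping.lookup n 0 + (Poly_Mapping.lookup n 1 + Poly_Mapping.lookup n 2) = t"
    if "n \<in> Poly_Mapping.keys f" for n
  proof -
    have "(\<Sum>i\<in>{0, 1, 2}. Poly_Mapping.lookup n i) = t"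
      using f that unfolding UNIV_3'[symmetric] by (auto simp: forms_def exp_degree_def)
    then show ?thesis using neq_3 by simp
  qed
  let ?g = "\<lambda>n. [:[:Poly_Mapping.lookup f n:]:] * (\<Prod>i\<in>UNIV. (if i = 0 then varX else if i = 1 then 1 else varY) ^ Poly_Mapping.lookup n i)"
  have g: "?g n = monom (monom (Poly_Mapping.lookup f n) (Poly_Mapping.lookup n 2)) (Poly_Mapping.lookup n 0)" for n
  proof -
    have "(\<Prod>i\<in>UNIV. (if i = 0 then varX else if i = 1 then 1 else varY :: 'k poly poly) ^ Poly_Mapping.lookup n i) =
      varX ^ Poly_Mapping.lookup n 0 * varY ^ Poly_Mapping.lookup n 2"
      unfolding UNIV_3' using neq_3 by (simp del: mult_pCons_left)
    moreover have "varY ^ j = ([:monom 1 j:] :: 'k poly poly)" for j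
    proof (induction j)
      case (Suc j)
      then show ?case by (simp add: monom_Suc)
    qed (simp add: one_pCons)
    moreover have "varX ^ j = (monom 1 j :: 'k poly poly)" for j
      by (induction j) (simp_all add: monom_Suc)
    ultimately show ?thesis by (simp add: smult_monom flip: monom_0) (simp add: mult_monom monom_0 smult_monom mult.commute)
  qed
  have inj: "n = m" if "n \<in> Poly_Mapping.keys f" "Poly_Mapping.lookup n 0 = Poly_Mapping.lookup m 0"
      "Poly_Mapping.lookup n 2 = Poly_Mapping.lookup m 2" for n
  proof (rule poly_mapping_eqI)
    fix i show "Poly_Mapping.lookup n i = Poly_Mapping.lookup m i"
      using exhaust_3'[of i] deg[OF m] deg[OF that(1)] that by auto
  qed
  have "0 = coeff (coeff (\<Sum>n\<in>Poly_Mapping.keys f. ?g n) (Poly_Mapping.lookup m 0)) (Poly_Mapping.lookup m 2)"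
    using z unfolding insertion_def by simp
  also have "\<dots> = (\<Sum>n\<in>Poly_Mapping.keys f. if n = m then Poly_Mapping.lookup f m else 0)"
    unfolding g coeff_sum by (intro sum.cong) (auto dest: inj)
  also have "\<dots> = Poly_Mapping.lookup f m" using m by simp
  finally show False using m in_keys_iff by metis
qed

text \<open>Up to a linear change of coordinates, the chart map sets the second coordinate to 1.\<close>

lemma chart_map_inj:
  fixes a :: "'k::field"
  assumes f: "f \<in> forms t" and z: "chart_map a b c f = 0"
  shows "f = 0"
proof -
  define y :: "3 \<Rightarrow> (3, 'k) hpoly" where "y = (\<lambda>i. if i = 0 then var 0
    else if i = 1 then var 1 - smult_pm c (var 2) + smult_pm a (var 0) else var 2 + smult_pm b (var 0))"
  define y' :: "3 \<Rightarrow> (3, 'k) hpoly" where "y' = (\<lambda>i. if i = 0 then var 0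
    else if i = 1 then var 1 + smult_pm c (var 2 - smult_pm b (var 0)) - smult_pm a (var 0)
    else var 2 - smult_pm b (var 0))"
  let ?L = "insertion (Poly_Mapping.single 0) y" and ?L' = "insertion (Poly_Mapping.single 0) y'"
  have yf: "y i \<in> forms 1" for i
    unfolding y_def by (simp only: forms_add forms_diff forms_smult forms_var split: if_split) simp
  let ?r = "\<lambda>i::3. if i = 0 then varX else if i = 1 then 1 else varY :: 'k poly poly"
  let ?deh = "insertion (\<lambda>x. [:[:x:]:]) ?r"
  have "?deh (?L g) = insertion (\<lambda>x. [:[:x:]:]) (\<lambda>i. ?deh (?L (var i))) g" for g
    by (rule poly2_hom.insertion_unique)
      (simp_all only: single_hom.insertion_add single_hom.insertion_mult single_hom.insertion_const
        poly2_hom.insertion_add poly2_hom.insertion_mult poly2_hom.insertion_const)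
  moreover have "(\<lambda>i. ?deh (?L (var i))) = chart_coords a b c"
    unfolding single_hom.insertion_var using neq_3
    by (auto simp: fun_eq_iff y_def chart_coords_def poly2_hom.insertion_add poly2_hom.insertion_diff
        poly2_hom.insertion_smult_pm simp del: mult_pCons_left)
  ultimately have "?deh (?L f) = 0" using z unfolding chart_map_def by simp
  then have Lf: "?L f = 0" by (rule dehomogenize_inj[OF insertion_linear_forms[OF f yf]])
  have "?L' (?L g) = insertion (Poly_Mapping.single 0) (\<lambda>i. ?L' (?L (var i))) g" for g
    by (rule single_hom.insertion_unique) (simp_all only: single_hom.insertion_add single_hom.insertion_mult single_hom.insertion_const)
  moreover have "?L' (y i) = var i" for i
  proof -
    consider "i = 0" | "i = 1" | "i = 2" using exhaust_3' by blast
    then show ?thesis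
      by cases (use neq_3 in \<open>simp_all add: y_def y'_def single_hom.insertion_add single_hom.insertion_diff single_hom.insertion_smult_pm
        flip: smult_pm_def\<close>)
  qed
  then have "(\<lambda>i. ?L' (?L (var i))) = var" unfolding single_hom.insertion_var by (rule ext)
  moreover have "g = insertion (Poly_Mapping.single 0) var g" for g :: "(3, 'k) hpoly"
    by (rule single_hom.insertion_unique) simp_all
  ultimately have "f = ?L' (?L f)" by metis
  then show ?thesis unfolding Lf by simp
qed

text \<open>On the curve \<open>(1, x, x ^ Suc s)\<close> distinct monomials of degree \<open>s\<close> become distinct powers of \<open>x\<close>,
  by the uniqueness of expansions in base \<open>Suc s\<close>.\<close>

lemma kronecker_substitution:
  fixes f :: "(3, 'k::field) hpoly"
  assumes f: "f \<in> forms s" "f \<noteq> 0"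
  shows "finite {x. eval_at f (\<chi> i. if i = 0 then 1 else if i = 1 then x else x ^ Suc s) = 0}"
proof -
  interpret p: const_hom "\<lambda>a::'k. [:a:]" by (rule const_hom_poly)
  define r :: "3 \<Rightarrow> 'k poly" where "r = (\<lambda>i. if i = 0 then 1 else if i = 1 then monom 1 1 else monom 1 (Suc s))"
  define g where "g = insertion (\<lambda>a. [:a:]) r f"
  have eval: "poly g x = eval_at f (\<chi> i. if i = 0 then 1 else if i = 1 then x else x ^ Suc s)" for x
  proof -
    have "poly (insertion (\<lambda>a. [:a:]) r h) x =
        insertion (\<lambda>a. a) (\<lambda>i. poly (insertion (\<lambda>a. [:a:]) r (var i)) x) h" for h
      by (rule id_hom.insertion_unique) (simp_all add: p.insertion_add p.insertion_mult)
    moreover have "(\<lambda>i. poly (insertion (\<lambda>a. [:a:]) r (var i)) x) =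
        (\<lambda>i. (\<chi> i. if i = 0 then 1 else if i = 1 then x else x ^ Suc s) $ i)"
      by (auto simp: fun_eq_iff r_def poly_monom)
    ultimately show ?thesis unfolding g_def eval_at_eq_insertion by metis
  qed
  obtain m where m: "m \<in> Poly_Mapping.keys f" using f(2) by (metis all_not_in_conv keys_eq_empty)
  have deg: "Poly_Mapping.lookup n 0 + (Poly_Mapping.lookup n 1 + Poly_Mapping.lookup n 2) = s"
    if "n \<in> Poly_Mapping.keys f" for n
  proof -
    have "(\<Sum>i\<in>{0, 1, 2}. Poly_Mapping.lookup n i) = s"
      using f that unfolding UNIV_3'[symmetric] by (auto simp: forms_def exp_degree_def)
    then show ?thesis using neq_3 by simp
  qed
  let ?e = "\<lambda>n. Poly_Mapping.lookup n 1 + Suc s * Poly_Mapping.lookup n (2::3)"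
  have t: "[:Poly_Mapping.lookup f n:] * (\<Prod>i\<in>UNIV. r i ^ Poly_Mapping.lookup n i) =
      monom (Poly_Mapping.lookup f n) (?e n)" for n
  proof -
    have "(\<Prod>i\<in>UNIV. r i ^ Poly_Mapping.lookup n i) = monom 1 (?e n)"
      unfolding UNIV_3' r_def using neq_3 by (simp add: monom_power mult_monom)
    then show ?thesis by (simp add: smult_monom)
  qed
  have inj: "n = m" if n: "n \<in> Poly_Mapping.keys f" "?e n = ?e m" for n
  proof -
    have b: "Poly_Mapping.lookup n 1 < Suc s" "Poly_Mapping.lookup m 1 < Suc s" using deg[OF n(1)] deg[OF m] by auto
    have "Poly_Mapping.lookup n 1 = ?e n mod Suc s" "Poly_Mapping.lookup m 1 = ?e m mod Suc s"
      "Poly_Mapping.lookup n 2 = ?e n div Suc s" "Poly_Mapping.lookup m 2 = ?e m div Suc s"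
      using b by (simp_all del: mult_Suc)
    then have e: "Poly_Mapping.lookup n 1 = Poly_Mapping.lookup m 1" "Poly_Mapping.lookup n 2 = Poly_Mapping.lookup m 2"
      using n(2) by metis+
    show ?thesis
    proof (rule poly_mapping_eqI)
      fix i show "Poly_Mapping.lookup n i = Poly_Mapping.lookup m i"
        using exhaust_3'[of i] deg[OF m] deg[OF n(1)] e by auto
    qed
  qed
  have "coeff g (?e m) = (\<Sum>n\<in>Poly_Mapping.keys f. if n = m then Poly_Mapping.lookup f m else 0)"
    unfolding g_def insertion_def t coeff_sum by (intro sum.cong) (auto dest: inj)
  also have "\<dots> = Poly_Mapping.lookup f m" using m by simp
  finally have "g \<noteq> 0" using m in_keys_iff by (metis coeff_0)
  then have "finite {x. poly g x = 0}" by (rule poly_roots_finite)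
  then show ?thesis unfolding eval .
qed

text \<open>A general point \<open>(1, a, b)\<close> and a general line through it avoid finitely many conditions.\<close>

lemma ex_chart:
  fixes S :: "('k::field_char_0 ^ 3) set set" and f :: "(3, 'k) hpoly"
  assumes S: "finite S" "S \<subseteq> proj_points" and f: "f \<in> forms s" "f \<noteq> 0"
  obtains a b c where "eval_at f (\<chi> i. if i = 0 then 1 else if i = 1 then a else b) \<noteq> 0"
    "\<And>p. p \<in> S \<Longrightarrow> chart_form a b c \<notin> point_ideal p"
proof -
  have "\<forall>p\<in>S. \<exists>w. w \<noteq> 0 \<and> p = vec.span {w}" using S(2) proj_pointE by (metis subsetD)
  then obtain w where w: "\<And>p. p \<in> S \<Longrightarrow> w p \<noteq> 0 \<and> p = vec.span {w p}" by metis
  have "finite ({x. eval_at f (\<chi> i. if i = 0 then 1 else if i = 1 then x else x ^ Suc s) = 0} \<union>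
      (\<lambda>p. w p $ 1 / w p $ 0) ` S)"
    using kronecker_substitution[OF f] S(1) by simp
  then obtain a where a: "a \<notin> {x. eval_at f (\<chi> i. if i = 0 then 1 else if i = 1 then x else x ^ Suc s) = 0} \<union>
      (\<lambda>p. w p $ 1 / w p $ 0) ` S"
    using ex_new_if_finite[OF infinite_UNIV_char_0] by blast
  \<comment> \<open>Only the point itself has to avoid \<open>S\<close> here; the line through it is chosen afterwards.\<close>
  define b where "b = a ^ Suc s"
  have "finite ((\<lambda>p. - (w p $ 1 - a * w p $ 0) / (w p $ 2 - b * w p $ 0)) ` S)" using S(1) by simp
  then obtain c where c: "c \<notin> (\<lambda>p. - (w p $ 1 - a * w p $ 0) / (w p $ 2 - b * w p $ 0)) ` S"
    using ex_new_if_finite[OF infinite_UNIV_char_0] by blast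
  show ?thesis
  proof (rule that)
    show "eval_at f (\<chi> i. if i = 0 then 1 else if i = 1 then a else b) \<noteq> 0" using a unfolding b_def by blast
    fix p assume p: "p \<in> S"
    have "eval_at (chart_form a b c) (w p) \<noteq> 0"
    proof
      assume "eval_at (chart_form a b c) (w p) = 0"
      then have e: "(w p $ 1 - a * w p $ 0) + c * (w p $ 2 - b * w p $ 0) = 0"
        by (simp add: chart_form_def eval_at_simps)
      have z: "w p $ 2 - b * w p $ 0 = 0"
      proof (rule ccontr)
        assume nz: "w p $ 2 - b * w p $ 0 \<noteq> 0"
        have "c = - (w p $ 1 - a * w p $ 0) / (w p $ 2 - b * w p $ 0)"
          unfolding nonzero_eq_divide_eq[OF nz] using e by (simp only: eq_neg_iff_add_eq_0 add.commute)
        then show False using c p by blast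
      qed
      then have y: "w p $ 1 - a * w p $ 0 = 0" using e by simp
      have "w p $ 0 \<noteq> 0"
      proof
        assume 0: "w p $ 0 = 0"
        then have "w p $ i = 0" for i using y z exhaust_3'[of i] by auto
        then show False using w[OF p] by (simp add: vec_eq_iff)
      qed
      then have "a = w p $ 1 / w p $ 0" using y by (simp add: eq_divide_eq)
      then show False using a p by blast
    qed
    then show "chart_form a b c \<notin> point_ideal p"
      using form_in_point_ideal_iff[OF chart_form_forms, of a b c "w p"] w[OF p] by simp
  qed
qed

section \<open>Numerical characters\<close>

text \<open>The inequalities \<open>i < s \<le> ns ! i\<close>, where \<open>s\<close> is the length, make every summand nonnegative, and in
  degree \<open>d\<close> a summand is positive exactly if \<open>ns ! i \<ge> d + 2\<close>; so only one is positive, and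
  monotonicity makes it the first.  At a gap after the index \<open>i\<close>, exactly the summands up to \<open>i\<close> lose
  one in each of the two steps from \<open>ns ! (i + 1) - 1\<close> to \<open>ns ! (i + 1) + 1\<close>.\<close>

lemma character_arith:
  fixes ns :: "int list" and q :: "nat \<Rightarrow> nat"
  assumes len: "2 \<le> length ns" and sorted: "sorted_wrt (\<ge>) ns"
    and ge: "\<forall>i<length ns. int (length ns) \<le> ns ! i"
    and q: "\<And>t. int (q t) = (\<Sum>i<length ns. max 0 (ns ! i - int t - 1) - max 0 (int i - int t - 1))"
    and d: "q d = 1"
  shows "ns ! 0 = int d + 2" "ns ! 1 < int d + 2"
    and "\<not> connected_character ns \<Longrightarrow> \<exists>i t. i + 1 < length ns \<and> length ns \<le> Suc t \<and> Suc t \<le> d \<and>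
        q t = q (Suc t) + (i + 1) \<and> q (Suc t) = q (Suc (Suc t)) + (i + 1)"
proof -
  let ?s = "length ns"
  have mono: "ns ! j \<le> ns ! i" if "i \<le> j" "j < ?s" for i j
    using sorted that by (cases "i = j") (auto simp: sorted_wrt_iff_nth_less)
  define h where "h t i = max 0 (ns ! i - int t - 1) - max 0 (int i - int t - 1)" for t i
  have h0: "0 \<le> h t i" if "i < ?s" for t i using ge that unfolding h_def by (auto simp: max_def)
  have sum1: "(\<Sum>i<?s. h d i) = 1" using q[of d] d unfolding h_def by simp
  have hpos: "1 \<le> h d i" if "i < ?s" "int d + 2 \<le> ns ! i" for i
    using that ge unfolding h_def by (auto simp: max_def)
  have "\<exists>i<?s. 0 < h d i"
  proof (rule ccontr)
    assume "\<not> ?thesis"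
    then have "(\<Sum>i<?s. h d i) \<le> 0" by (intro sum_nonpos) (meson lessThan_iff not_less)
    then show False using sum1 by simp
  qed
  then obtain i where i: "i < ?s" "0 < h d i" by blast
  have "int d + 2 \<le> ns ! i" using i ge unfolding h_def by (auto simp: max_def split: if_splits)
  then have n0: "int d + 2 \<le> ns ! 0" using mono[of 0 i] i by simp
  have pair: "h d 0 + h d 1 \<le> 1"
  proof -
    have "sum (h d) {0, 1} \<le> sum (h d) {..<?s}" using len h0 by (intro sum_mono2) auto
    then show ?thesis using sum1 by simp
  qed
  have "h d 0 = ns ! 0 - int d - 1" unfolding h_def using n0 by simp
  moreover have "h d 0 \<le> 1" using pair h0[of 1 d] len by simp
  ultimately show e0: "ns ! 0 = int d + 2" using n0 by simp
  have h00: "1 \<le> h d 0" by (rule hpos) (use len n0 in auto)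
  show "ns ! 1 < int d + 2"
  proof (rule ccontr)
    assume "\<not> ?thesis"
    then have "1 \<le> h d 1" using hpos[of 1] len by simp
    then show False using pair h00 by simp
  qed
  assume "\<not> connected_character ns"
  then obtain i where i: "i + 1 < ?s" "ns ! i > ns ! (i + 1) + 1"
    unfolding connected_character_def by (auto simp: not_le)
  define t where "t = nat (ns ! (i + 1) - 1)"
  have ge1: "int ?s \<le> ns ! (i + 1)" using ge i by simp
  have t: "ns ! (i + 1) = int t + 1" using ge1 len unfolding t_def by simp
  have drop: "q u = q (Suc u) + (i + 1)" if u: "u = t \<or> u = Suc t" for u
  proof -
    have "h u j - h (Suc u) j = (if j \<le> i then 1 else 0)" if j: "j < ?s" for j
    proof (cases "j \<le> i")
      case True
      then have "ns ! i \<le> ns ! j" using mono i by simp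
      then show ?thesis using True u i t ge1 j unfolding h_def by (auto simp: max_def)
    next
      case False
      then have "ns ! j \<le> ns ! (i + 1)" using mono j by simp
      then show ?thesis using False u t ge1 j unfolding h_def by (auto simp: max_def)
    qed
    then have "(\<Sum>j<?s. h u j - h (Suc u) j) = (\<Sum>j<?s. if j \<le> i then 1 else 0)"
      by (intro sum.cong) auto
    also have "\<dots> = (\<Sum>j\<in>{..i}. 1)" using i by (intro sum.mono_neutral_cong_right) auto
    finally have "int (q u) - int (q (Suc u)) = int i + 1" unfolding q sum_subtractf[symmetric] h_def by simp
    then show ?thesis by linarith
  qed
  have "ns ! i \<le> int d + 2" using mono[of 0 i] i e0 by simp
  then have "Suc t \<le> d" "?s \<le> Suc t" using i t ge1 by simp_all
  then show "\<exists>i t. i + 1 < length ns \<and> length ns \<le> Suc t \<and> Suc t \<le> d \<and>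
        q t = q (Suc t) + (i + 1) \<and> q (Suc t) = q (Suc (Suc t)) + (i + 1)"
    using drop i(1) by blast
qed

section \<open>Critical schemes of minimal Terracini sets\<close>

text \<open>If the line \<open>m = 0\<close> contained the scheme, the scheme would lie in the double points supported at the
  points of \<open>S\<close> on that line.  These points are a proper subset of the spanning set \<open>S\<close>, and so
  minimality forbids cohomology.\<close>

lemma critical_scheme_not_in_line:
  fixes S :: "('k::field_char_0 ^ 3) set set" and Z :: "(3, 'k) hpoly set"
  assumes chart: "plane_chart (double_points S) l u K \<rho>"
    and S: "finite S" "S \<subseteq> proj_points" "vec.span (\<Union>S) = UNIV"
    and min: "\<And>A. A \<subset> S \<Longrightarrow> h_ideal 1 (double_points A) (int d) = 0"
    and Z: "closed_subscheme Z" "double_points S \<subseteq> Z" "h_ideal 1 Z (int d) > 0"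
    and m: "m \<in> forms 1" "m \<noteq> 0"
  shows "m \<notin> Z"
proof
  assume mZ: "m \<in> Z"
  have Zs: "ideal.subspace Z" using Z(1) by (simp add: closed_subscheme_def)
  define A where "A = {p \<in> S. m \<in> point_ideal p}"
  have "A \<noteq> S"
  proof
    assume "A = S"
    then have "\<Union>S \<subseteq> {v. eval_at m v = 0}" unfolding A_def point_ideal_def by blast
    moreover have "vec.subspace {v. eval_at m v = 0}"
      unfolding vec.subspace_def
      using eval_linear_form[OF m(1)] eval_at_scale[OF m(1)] eval_at_scale[OF m(1), of 0 0] by auto
    ultimately have "eval_at m v = 0" for v using vec.span_minimal S(3) by blast
    then have "{x. eval_at m (\<chi> i. if i = 0 then 1 else if i = 1 then x else x ^ Suc 1) = 0} = UNIV" by blast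
    then show False using kronecker_substitution[OF m] infinite_UNIV_char_0 by metis
  qed
  then have AS: "A \<subset> S" unfolding A_def by blast
  have sub: "double_points A \<subseteq> Z"
  proof
    fix f assume f: "f \<in> double_points A"
    have "\<exists>N. var i ^ N * f \<in> Z" for i
    proof -
      have "finite (S - A)" "S - A \<subseteq> proj_points" "\<And>p. p \<in> S - A \<Longrightarrow> m \<notin> point_ideal p"
        using S unfolding A_def by auto
      then obtain w where w: "var i ^ Suc (2 * card (S - A)) - m * w \<in> double_points (S - A)"
        using double_points_power[of "S - A" m "var i"] m(1) forms_var by blast
      let ?g = "var i ^ Suc (2 * card (S - A)) - m * w"
      have "?g * f \<in> double_points S"
      proof -
        have "?g * f \<in> ideal_square (point_ideal p)" if "p \<in> S" for p
        proof (cases "p \<in> A")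
          case True
          then have "f \<in> ideal_square (point_ideal p)" using f unfolding double_points_def by blast
          then show ?thesis by (rule ideal.subspace_scale[OF subspace_ideal_square])
        next
          case False
          then have "?g \<in> ideal_square (point_ideal p)" using w that unfolding double_points_def by blast
          then show ?thesis by (rule ideal_mult_right[OF subspace_ideal_square])
        qed
        then show ?thesis unfolding double_points_def by blast
      qed
      then have "?g * f + (w * f) * m \<in> Z"
        using Z(2) by (intro ideal.subspace_add[OF Zs] ideal.subspace_scale[OF Zs mZ]) blast
      moreover have "?g * f + (w * f) * m = var i ^ Suc (2 * card (S - A)) * f"
        by (simp only: algebra_simps)
      ultimately show ?thesis by metis
    qed
    then show "f \<in> Z" using Z(1) unfolding closed_subscheme_def by blast
  qed
  have dS: "double_points S \<subseteq> double_points A" unfolding double_points_def A_def by blast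
  interpret S: plane_chart "double_points S" l u K \<rho> by (rule chart)
  interpret A: plane_chart "double_points A" l u K \<rho>
    by (rule S.plane_chart_mono[OF subspace_double_points dS])
  interpret Z: plane_chart Z l u K \<rho> by (rule S.plane_chart_mono[OF Zs Z(2)])
  have "A.interpolated d = UNIV" using A.h1_eq_0_iff[of d] min[OF AS] by blast
  moreover have "A.interpolated d \<subseteq> Z.interpolated d"
    unfolding A.interpolated_def Z.interpolated_def using A.affine_ideal_mono[OF Zs sub] by blast
  ultimately have "Z.interpolated d = UNIV" by blast
  then have "h_ideal 1 Z (int d) = 0" using Z.h1_eq_0_iff[of d] by blast
  then show False using Z(3) by simp
qed

lemma min_degree_eq:
  fixes Z :: "(3, 'k::field) hpoly set"
  assumes Z: "ideal.subspace Z" and ex: "h_ideal 0 Z (int n) > 0"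
  obtains s where "min_degree Z = int s" "h_ideal 0 Z (int s) > 0" "\<And>t. h_ideal 0 Z (int t) > 0 \<Longrightarrow> s \<le> t"
proof -
  define s where "s = (LEAST n. h_ideal 0 Z (int n) > 0)"
  have s: "h_ideal 0 Z (int s) > 0" unfolding s_def by (rule LeastI[of "\<lambda>n. h_ideal 0 Z (int n) > 0", OF ex])
  have least: "s \<le> t" if "h_ideal 0 Z (int t) > 0" for t unfolding s_def using that by (rule Least_le)
  have "min_degree Z = int s" unfolding min_degree_def
  proof (rule Least_equality)
    show "h_ideal 0 Z (int s) > 0" by (rule s)
    fix t assume t: "h_ideal 0 Z t > 0"
    then have "0 \<le> t" using h0_neg[OF Z, of t] by (cases "t < 0") auto
    then obtain n where "t = int n" by (metis nonneg_eq_int)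
    then show "int s \<le> t" using least t by simp
  qed
  then show ?thesis using that s least by blast
qed

theorem theorem2p11:
  fixes S :: "('k::{alg_closed_field,field_char_0} ^ 3) set set"
    and Z :: "(3, 'k) hpoly set"
    and d :: int and x :: nat and ns :: "int list"
  assumes "S \<in> min_terracini d x"
    and "critical_scheme d S Z"
    and "numerical_character Z ns"
  shows "length ns \<ge> 2 \<and> ns ! 0 = d + 2 \<and> d + 2 > ns ! 1 \<and> connected_character ns"
proof -
  have S: "S \<subseteq> proj_points" "finite S" "h_ideal 0 (double_points S) d > 0" "vec.span (\<Union>S) = UNIV"
    and min: "\<And>A. A \<subset> S \<Longrightarrow> h_ideal 1 (double_points A) d = 0"
    using assms(1) by (auto simp: min_terracini_def terracini_def)
  have Z: "closed_subscheme Z" "double_points S \<subseteq> Z" "h_ideal 1 Z d > 0"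
    and crit: "\<And>Z'. closed_subscheme Z' \<Longrightarrow> Z \<subset> Z' \<Longrightarrow> h_ideal 1 Z' d = 0"
    using assms(2) by (auto simp: critical_scheme_def zero_dim_scheme_def)
  have Zs: "ideal.subspace Z" using Z(1) by (simp add: closed_subscheme_def)
  have char: "int (length ns) = min_degree Z" "sorted_wrt (\<ge>) ns" "\<forall>i<length ns. ns ! i \<ge> min_degree Z"
    and charq: "\<And>t. 0 \<le> t \<Longrightarrow> int (h_ideal 1 Z t) =
        (\<Sum>i<length ns. max 0 (ns ! i - t - 1) - max 0 (int i - t - 1))"
    using assms(3) unfolding numerical_character_def by blast+
  have "0 \<le> d" using S(3) h0_neg[OF subspace_double_points, of d S] by (cases "d < 0") auto
  then obtain e where e: "d = int e" by (metis nonneg_eq_int)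
  have "h_ideal 0 Z (int e) > 0"
  proof -
    obtain f where "f \<in> sat_forms (double_points S) e" "f \<noteq> 0"
      using S(3) h0_pos_iff[OF subspace_double_points, of S e] unfolding e by blast
    then have "f \<in> sat_forms Z e" using Z(2) unfolding sat_forms_def by blast
    then show ?thesis using h0_pos_iff[OF Zs, of e] \<open>f \<noteq> 0\<close> by blast
  qed
  then obtain s where s: "min_degree Z = int s" "h_ideal 0 Z (int s) > 0"
    "\<And>t. h_ideal 0 Z (int t) > 0 \<Longrightarrow> s \<le> t" using min_degree_eq[OF Zs] by blast
  have len: "length ns = s" using char(1) s(1) by simp
  obtain f0 where f0: "f0 \<in> sat_forms Z s" "f0 \<noteq> 0" using s(2) h0_pos_iff[OF Zs] by blast
  have f0f: "f0 \<in> forms s" using f0(1) by (simp add: sat_forms_def)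
  \<comment> \<open>The point \<open>(1, a, b)\<close> lies off a curve of least degree through \<open>Z\<close>, so \<open>X\<close> has full degree in its equation.\<close>
  obtain a b c where abc: "eval_at f0 (\<chi> i. if i = 0 then 1 else if i = 1 then a else b) \<noteq> 0"
    "\<And>p. p \<in> S \<Longrightarrow> chart_form a b c \<notin> point_ideal p"
    using ex_chart[OF S(2,1) f0f f0(2)] by blast
  define l where "l = chart_form a b c"
  define \<rho> where "\<rho> = chart_map a b c"
  have lf: "l \<in> forms 1" unfolding l_def by (rule chart_form_forms)
  have lS: "\<And>p. p \<in> S \<Longrightarrow> l \<notin> point_ideal p" using abc(2) unfolding l_def .
  have "\<forall>i. \<exists>u\<in>forms (2 * card S). var i ^ Suc (2 * card S) - l * u \<in> double_points S"
    using double_points_power[OF S(2,1) lf lS forms_var] by blast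
  then obtain u where u: "\<And>i. u i \<in> forms (2 * card S)"
    "\<And>i. var i ^ Suc (2 * card S) - l * u i \<in> double_points S" by metis
  have chart: "plane_chart (double_points S) l u (Suc (2 * card S)) \<rho>"
  proof unfold_locales
    show "\<rho> ` forms t = tdeg_le t" for t
      using chart_map_in chart_map_onto unfolding \<rho>_def by blast
    show "f = 0" if "f \<in> forms t" "\<rho> f = 0" for f t using chart_map_inj that unfolding \<rho>_def by blast
  qed (use u lf subspace_double_points chart_map_form in \<open>simp_all add: \<rho>_def chart_map_hom(1,3,4) l_def\<close>)
  \<comment> \<open>Since \<open>S\<close> spans the plane, \<open>Z\<close> lies on no line.\<close>
  have not_line: "m \<notin> Z" if "m \<in> forms 1" "m \<noteq> 0" for m
    by (rule critical_scheme_not_in_line[OF chart S(2,1,4) _ Z(1,2) _ that, of e])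
      (use min Z(3) e in auto)
  have "2 \<le> s"
  proof (rule ccontr)
    assume "\<not> 2 \<le> s"
    then consider "s = 0" | "s = 1" by linarith
    then show False
    proof cases
      case 1
      \<comment> \<open>A nonzero constant in the ideal would bring lines with it.\<close>
      have "var 0 * f0 \<in> forms 1" using forms_mult[OF forms_var f0f, of 0] 1 by simp
      moreover have "var 0 * f0 \<noteq> 0"
        using f0(2) keys_single_times[of "Poly_Mapping.single (0::3) 1" f0] unfolding var_def
        by (metis image_is_empty keys_eq_empty)
      moreover have "var 0 * f0 \<in> Z"
        using f0(1) sat_forms_closed[OF Z(1)] ideal.subspace_scale[OF Zs] by blast
      ultimately show False using not_line by blast
    next
      case 2
      then show False using not_line[of f0] f0 f0f sat_forms_closed[OF Z(1), of s] by auto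
    qed
  qed
  then have len2: "2 \<le> length ns" using len by simp
  interpret S: plane_chart "double_points S" l u "Suc (2 * card S)" \<rho> by (rule chart)
  interpret Z: plane_chart Z l u "Suc (2 * card S)" \<rho> by (rule S.plane_chart_mono[OF Zs Z(2)])
  interpret Z: critical_chart Z l u "Suc (2 * card S)" \<rho> e
    by unfold_locales (use Z crit e in auto)
  have h1: "h_ideal 1 Z (int e) = 1"
  proof -
    obtain cs where cs: "(\<Prod>c\<leftarrow>cs. var 0 - smult_pm c l) \<in> Z"
      using double_points_product[OF S(2,1) lf lS forms_var, of 0] Z(2) by blast
    have beta: "var 2 - smult_pm b (var 0) \<in> forms 1" by (intro forms_diff forms_smult forms_var)
    obtain cs' where cs': "(\<Prod>c\<leftarrow>cs'. (var 2 - smult_pm b (var 0)) - smult_pm c l) \<in> Z"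
      using double_points_product[OF S(2,1) lf lS beta] Z(2) by blast
    have "\<rho> (var 0) = varX" "\<rho> (var 2 - smult_pm b (var 0)) = varY"
      unfolding \<rho>_def by (rule chart_map_var, rule chart_map_beta)
    then show ?thesis
      using Z.linear_product_affine[OF forms_var cs] Z.linear_product_affine[OF beta cs'] by (intro Z.h1_eq_1) auto
  qed
  define q where "q t = h_ideal 1 Z (int t)" for t :: nat
  have qc: "int (q t) = (\<Sum>i<length ns. max 0 (ns ! i - int t - 1) - max 0 (int i - int t - 1))" for t
    unfolding q_def by (rule charq) simp
  have ge: "\<forall>i<length ns. int (length ns) \<le> ns ! i" using char(3) s(1) len by simp
  have qe: "q e = 1" unfolding q_def by (rule h1)
  note arith = character_arith[OF len2 char(2) ge qc qe]
  have "connected_character ns"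
  proof (rule ccontr)
    assume "\<not> connected_character ns"
    then obtain i t where it: "i + 1 < s" "s \<le> Suc t" "Suc t \<le> e"
      "q t = q (Suc t) + (i + 1)" "q (Suc t) = q (Suc (Suc t)) + (i + 1)"
      using arith(3) unfolding len by blast
    let ?T = "Suc t"
    let ?V = "\<lambda>n. lead_form n ` (Z.affine_ideal \<inter> tdeg_le n)"
    have V1: "upoly.dim (?V ?T) + (i + 1) = Suc ?T"
      using Z.h1_drop[of t] it(4) unfolding q_def by linarith
    have V2: "upoly.dim (?V (Suc ?T)) + (i + 1) = Suc (Suc ?T)"
      using Z.h1_drop[of ?T] it(5) unfolding q_def by linarith
    \<comment> \<open>Raises the degree of the equation to \<open>?T\<close> and keeps the coefficient of the pure power of \<open>X\<close>.\<close>
    let ?h = "varX ^ (?T - s) * \<rho> f0"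
    have pw: "(varX ^ (?T - s) :: 'k poly poly) \<in> tdeg_le (?T - s)" "top_X (?T - s) (varX ^ (?T - s) :: 'k poly poly) = 1"
    proof -
      have "(varX ^ (?T - s) :: 'k poly poly) \<in> tdeg_le (?T - s) \<and> top_X (?T - s) (varX ^ (?T - s) :: 'k poly poly) = top_X 1 varX ^ (?T - s)"
        by (rule tdeg_le_power[OF varX_tdeg(1)])
      then show "(varX ^ (?T - s) :: 'k poly poly) \<in> tdeg_le (?T - s)" "top_X (?T - s) (varX ^ (?T - s) :: 'k poly poly) = 1"
        by (simp_all add: top_X_def)
    qed
    have rf: "\<rho> f0 \<in> tdeg_le s" "top_X s (\<rho> f0) \<noteq> 0"
      unfolding \<rho>_def using chart_map_in[OF f0f] chart_map_top[OF f0f] abc(1) by auto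
    have "\<rho> f0 \<in> Z.affine_ideal" unfolding Z.affine_ideal_def using f0(1) by blast
    then have hI: "?h \<in> Z.affine_ideal" by (rule ideal.subspace_scale[OF Z.ideal_affine_ideal])
    have Ts: "?T - s + s = ?T" using it(2) by simp
    have hT: "?h \<in> tdeg_le ?T" "top_X ?T ?h \<noteq> 0"
      using tdeg_le_mult[OF pw(1) rf(1)] top_X_mult[OF pw(1) rf(1)] rf(2) pw(2) unfolding Ts by auto
    interpret flat_growth Z.affine_ideal ?T ?h
      by unfold_locales
        (use Z.ideal_affine_ideal hI hT V1 V2 in \<open>simp_all add: top_X_lead_form\<close>)
    obtain F where F: "F \<noteq> 0" "F \<in> tdeg_le (Suc ?T - upoly.dim (?V ?T))"
      "\<And>w. \<exists>r\<in>tdeg_le ?T. F * w - r \<in> Z.affine_ideal" using multiples_low_degree by blast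
    have "F * w \<in> Z.interpolated e" for w
    proof -
      obtain r where r: "r \<in> tdeg_le ?T" "F * w - r \<in> Z.affine_ideal" using F(3) by blast
      show ?thesis by (rule Z.interpolatedI[OF r(2) tdeg_le_mono[OF r(1) it(3)]])
    qed
    \<comment> \<open>This contradicts the minimality of \<open>s\<close>: a curve of degree \<open>i + 1 < s\<close> contains \<open>Z\<close>.\<close>
    then have FI: "F \<in> Z.affine_ideal" by (rule Z.multiples_interpolated_imp_zero)
    have "Suc ?T - upoly.dim (?V ?T) = i + 1" using V1 by linarith
    then have "F \<in> tdeg_le (i + 1)" using F(2) by simp
    then obtain f where f: "f \<in> forms (i + 1)" "F = \<rho> f" using Z.rho_forms[of "i + 1"] by blast
    have "f \<in> sat_forms Z (i + 1)" using FI f Z.rho_in_affine_ideal_iff[OF f(1)] by simp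
    moreover have "f \<noteq> 0" using F(1) f(2) S.rho.zero by auto
    ultimately have "h_ideal 0 Z (int (i + 1)) > 0" using h0_pos_iff[OF Zs] by blast
    then have "s \<le> i + 1" by (rule s(3))
    then show False using it(1) by simp
  qed
  then show ?thesis using len2 arith(1,2) e by simp
qed

end
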